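(* Let $p>1$, $s\in(0,1)$, let $\Omega\subset\mathbb{R}^N$ be a bounded domain with $C^{1,1}$ boundary, and let $f:\mathbb{R}\to\mathbb{R}$ be of class $C^1$, nondecreasing, with $f(0)>0$ and $\lim_{t\to\infty}\frac{f(t)}{t^{p-1}}=\infty$. For $\lambda>0$ let $(P_\lambda)$ denote the problem $$(-\Delta)_p^s u=\lambda f(u)\ \text{in }\Omega,\qquad u>0\ \text{in }\Omega,\qquad u=0\ \text{in }\mathbb{R}^N\setminus\Omega,$$ and let $\lambda^*\in(0,\infty)$ be its critical value for bounded solutions, $\lambda^*=\sup\{\lambda>0:(P_\lambda)\text{ has a bounded solution}\}$. If $t\mapsto f(t)^{\frac1{p-1}}$ is convex on $[0,\infty)$, then $(P_\lambda)$ has no $W_0^{s,p}(\Omega)$ solution for $\lambda>\lambda^*$.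
   Context: Function space: $[u]_{s,p}=\left(\int_{\mathbb{R}^{2N}}\frac{|u(x)-u(y)|^p}{|x-y|^{N+sp}}\,dx\,dy\right)^{1/p}$, $W^{s,p}(\mathbb{R}^N)=\{u\in L^p(\mathbb{R}^N):[u]_{s,p}<\infty\}$, and $W_0^{s,p}(\Omega)=\{u\in W^{s,p}(\mathbb{R}^N): u=0 \text{ a.e. in }\mathbb{R}^N\setminus\Omega\}$ with norm $\|u\|_{W_0^{s,p}(\Omega)}=[u]_{s,p}$; $W_0^{s,p}(\Omega)^*$ is its dual. Operator: for $u,v\in W_0^{s,p}(\Omega)$, $\langle(-\Delta)_p^s u,v\rangle=\int_{\mathbb{R}^{2N}}\frac{J_u(x,y)(v(x)-v(y))}{|x-y|^{N+sp}}\,dx\,dy$ with $J_u(x,y)=|u(x)-u(y)|^{p-2}(u(x)-u(y))$ (read as $0$ when $u(x)=u(y)$). A $W_0^{s,p}(\Omega)$ solution (= weak solution) of $(P_\lambda)$ is a function $u\in W_0^{s,p}(\Omega)$ with $u>0$ in $\Omega$, $f(u)\in W_0^{s,p}(\Omega)^*$ (i.e. for every $v\in W_0^{s,p}(\Omega)$, $f(u)v\in L^1(\Omega)$ and $|\int_\Omega f(u)v\,dx|\le C\|v\|_{W_0^{s,p}(\Omega)}$ with $C$ independent of $v$), and $\langle(-\Delta)_p^su,v\rangle=\lambda\int_\Omega f(u)v\,dx$ for all $v\in W_0^{s,p}(\Omega)$ with $v\ge0$. It is bounded if $u\in L^\infty(\Omega)$. Under the stated assumptions on $f$ (without convexity),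 $\lambda^*\in(0,\infty)$, $(P_\lambda)$ has a bounded solution for every $\lambda\in(0,\lambda^* )$ and none for $\lambda>\lambda^*$. *)

theory Defs
  imports "HOL-Analysis.Analysis"
begin

section \<open>Domains with \<open>C\<close>-1,1 boundary\<close>

text \<open>
  A real function on the hyperplane orthogonal to the unit vector \<open>e\<close> which is differentiable there
  with Lipschitz gradient. Only the values of \<open>g\<close> on the hyperplane matter. In dimension one the
  hyperplane is a single point and the condition is vacuous.
\<close>

definition C11_on_hyperplane :: "'a::euclidean_space \<Rightarrow> ('a \<Rightarrow> real) \<Rightarrow> bool" where
  "C11_on_hyperplane e g \<longleftrightarrow>
     (\<exists>G L. (\<forall>y. y \<bullet> e = 0 \<longrightarrow> (g has_derivative (\<lambda>h. G y \<bullet> h)) (at y within {z. z \<bullet> e = 0})) \<and>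
            L-lipschitz_on {z. z \<bullet> e = 0} G)"

text \<open>
  Near each boundary point, after a choice of the \<open>N\<close>-th coordinate axis \<open>e\<close>, the set is the
  region above the graph of such a function; \<open>x - (x \<bullet> e) *\<^sub>R e\<close> collects the
  remaining \<open>N - 1\<close> coordinates of \<open>x\<close>.
\<close>

definition C11_boundary :: "'a::euclidean_space set \<Rightarrow> bool" where
  "C11_boundary \<Omega> \<longleftrightarrow>
     (\<forall>x0\<in>frontier \<Omega>. \<exists>r>0. \<exists>e g. norm e = 1 \<and> C11_on_hyperplane e g \<and>
        \<Omega> \<inter> ball x0 r = {x \<in> ball x0 r. x \<bullet> e > g (x - (x \<bullet> e) *\<^sub>R e)})"

definition bounded_C11_domain :: "'a::euclidean_space set \<Rightarrow> bool" where
  "bounded_C11_domain \<Omega> \<longleftrightarrow>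
     open \<Omega> \<and> connected \<Omega> \<and> \<Omega> \<noteq> {} \<and> bounded \<Omega> \<and> C11_boundary \<Omega>"


section \<open>Fractional Sobolev spaces\<close>

text \<open>
  Elements of the spaces are Lebesgue measurable functions, not classes modulo null sets; all
  conditions below are invariant under changes on null sets. On the diagonal \<open>x = y\<close>, a null set,
  the kernels below take the value 0.
\<close>

definition gagliardo_energy :: "real \<Rightarrow> real \<Rightarrow> ('a::euclidean_space \<Rightarrow> real) \<Rightarrow> ennreal" where
  "gagliardo_energy s p u =
     (\<integral>\<^sup>+ z. ennreal (\<bar>u (fst z) - u (snd z)\<bar> powr p
                    / norm (fst z - snd z) powr (real DIM('a) + s * p))
        \<partial>(lebesgue :: ('a \<times> 'a) measure))"

definition gagliardo_seminorm :: "real \<Rightarrow> real \<Rightarrow> ('a::euclidean_space \<Rightarrow> real) \<Rightarrow> real" where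
  "gagliardo_seminorm s p u = enn2real (gagliardo_energy s p u) powr (1 / p)"

definition frac_sobolev :: "real \<Rightarrow> real \<Rightarrow> ('a::euclidean_space \<Rightarrow> real) set" where
  "frac_sobolev s p =
     {u. u \<in> borel_measurable lebesgue \<and> integrable lebesgue (\<lambda>x. \<bar>u x\<bar> powr p) \<and>
         gagliardo_energy s p u < \<infinity>}"

definition frac_sobolev0 :: "real \<Rightarrow> real \<Rightarrow> 'a::euclidean_space set \<Rightarrow> ('a \<Rightarrow> real) set" where
  "frac_sobolev0 s p \<Omega> = {u \<in> frac_sobolev s p. AE x in lebesgue. x \<notin> \<Omega> \<longrightarrow> u x = 0}"

text \<open>The function \<open>h\<close> on \<open>\<Omega>\<close> defines, by integration, an element of the dual of
  \<open>frac_sobolev0 s p \<Omega>\<close>.\<close>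

definition in_frac_sobolev0_dual ::
    "real \<Rightarrow> real \<Rightarrow> 'a::euclidean_space set \<Rightarrow> ('a \<Rightarrow> real) \<Rightarrow> bool" where
  "in_frac_sobolev0_dual s p \<Omega> h \<longleftrightarrow>
     (\<exists>C. \<forall>v\<in>frac_sobolev0 s p \<Omega>.
        set_integrable lebesgue \<Omega> (\<lambda>x. h x * v x) \<and>
        \<bar>LINT x:\<Omega>|lebesgue. h x * v x\<bar> \<le> C * gagliardo_seminorm s p v)"


section \<open>The fractional \<open>p\<close>-Laplacian and the Dirichlet problem\<close>

text \<open>Since \<open>0 powr a = 0\<close>, the factor \<open>J\<close> vanishes where \<open>u x = u y\<close>, also for \<open>p < 2\<close>.\<close>

definition J :: "real \<Rightarrow> ('a \<Rightarrow> real) \<Rightarrow> 'a \<Rightarrow> 'a \<Rightarrow> real" where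
  "J p u x y = \<bar>u x - u y\<bar> powr (p - 2) * (u x - u y)"

definition frac_p_laplacian ::
    "real \<Rightarrow> real \<Rightarrow> ('a::euclidean_space \<Rightarrow> real) \<Rightarrow> ('a \<Rightarrow> real) \<Rightarrow> real" where
  "frac_p_laplacian s p u v =
     (LINT z|(lebesgue :: ('a \<times> 'a) measure).
        J p u (fst z) (snd z) * (v (fst z) - v (snd z))
        / norm (fst z - snd z) powr (real DIM('a) + s * p))"

definition weak_solution ::
    "real \<Rightarrow> real \<Rightarrow> 'a::euclidean_space set \<Rightarrow> (real \<Rightarrow> real) \<Rightarrow> real \<Rightarrow> ('a \<Rightarrow> real) \<Rightarrow> bool" where
  "weak_solution s p \<Omega> f l u \<longleftrightarrow>
     u \<in> frac_sobolev0 s p \<Omega> \<and>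
     (AE x in lebesgue. x \<in> \<Omega> \<longrightarrow> u x > 0) \<and>
     in_frac_sobolev0_dual s p \<Omega> (\<lambda>x. f (u x)) \<and>
     (\<forall>v\<in>frac_sobolev0 s p \<Omega>. (AE x in lebesgue. v x \<ge> 0) \<longrightarrow>
        frac_p_laplacian s p u v = l * (LINT x:\<Omega>|lebesgue. f (u x) * v x))"

definition bounded_weak_solution ::
    "real \<Rightarrow> real \<Rightarrow> 'a::euclidean_space set \<Rightarrow> (real \<Rightarrow> real) \<Rightarrow> real \<Rightarrow> ('a \<Rightarrow> real) \<Rightarrow> bool" where
  "bounded_weak_solution s p \<Omega> f l u \<longleftrightarrow>
     weak_solution s p \<Omega> f l u \<and> (\<exists>M. AE x in lebesgue. x \<in> \<Omega> \<longrightarrow> \<bar>u x\<bar> \<le> M)"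

text \<open>The supremum is taken in the extended reals, so that it is meaningful without a priori
  knowledge that the set is nonempty and bounded.\<close>

definition critical_value ::
    "real \<Rightarrow> real \<Rightarrow> 'a::euclidean_space set \<Rightarrow> (real \<Rightarrow> real) \<Rightarrow> ereal" where
  "critical_value s p \<Omega> f =
     Sup (ereal ` {l. l > 0 \<and> (\<exists>u. bounded_weak_solution s p \<Omega> f l u)})"

end

theory Submission
  imports Defs
begin

text \<open>
  Write \<open>g = f powr (1 / (p - 1))\<close>. Given a solution \<open>u\<close> at \<open>l\<close> and \<open>l' < l\<close>, let \<open>\<Phi>\<close> solve
  \<open>\<Phi>' = c g(\<Phi>) / g\<close>, \<open>\<Phi>(0) = 0\<close>, with \<open>c = (l' / l) powr (1 / (p - 1))\<close>. Convexity of \<open>g\<close> makes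
  \<open>\<Phi>\<close> concave, so \<open>\<Phi>(u)\<close> is a supersolution at \<open>l'\<close>, and \<open>g(\<Phi>(t)) \<le> C (1 + t)\<close>. Minimising
  the energy truncated above \<open>\<Phi>(u)\<close> produces a solution \<open>w \<le> \<Phi>(u)\<close> at \<open>l'\<close> whose right-hand side
  satisfies \<open>f(w) \<le> C (1 + u) powr (p - 1)\<close>. Hence \<open>w\<close> is better integrable than \<open>u\<close> by a fixed
  amount, and finitely many such steps, each lowering the parameter slightly, end in a bounded
  solution at any given \<open>l' < l\<close>. So \<open>l\<close> cannot exceed the critical value.
\<close>

section \<open>Powers and products of Lebesgue measures\<close>

text \<open>The obstacle is that \<open>u\<close> may be unbounded and \<open>f\<close> has no
  growth bound, so the equation for \<open>u\<close> itself yields no integrability. The formal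
  reason behind the transformation: for concave \<open>\<Phi>\<close> the operator at
  \<open>\<Phi>(u)\<close> is at least \<open>\<Phi>'(u) powr (p - 1) * l * f(u)\<close>, and the
  differential equation turns this into \<open>l' * f(\<Phi>(u))\<close>. The linear bound comes
  from the gap between \<open>l'\<close> and \<open>l\<close>: with \<open>H\<close> the primitive
  of \<open>1 / g\<close>, the difference \<open>H(t) - H(\<Phi>(t)) = (1 - c) * H(t)\<close> stays
  away from 0 for \<open>t \<ge> 1\<close>, while the mean value theorem bounds it by
  \<open>t / g(\<Phi>(t))\<close>. The new right-hand side then has the homogeneity
  \<open>p - 1\<close> of the operator, which suits level-set methods, but one pass gains at most
  the exponent \<open>(s * p / N) * (p / (p - 1))\<close> in dimension \<open>N\<close>, dictated by
  Faber-Krahn and Young. No compact or Sobolev embedding enters: minimisers come from pointwise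
  order, and all integrability from Faber-Krahn.\<close>

definition jp :: "real \<Rightarrow> real \<Rightarrow> real" where
  "jp p a = \<bar>a\<bar> powr (p - 2) * a"

lemma abs_jp: "\<bar>jp p a\<bar> = \<bar>a\<bar> powr (p - 1)"
proof (cases "a = 0")
  case False
  then have "\<bar>a\<bar> powr (p - 2) * \<bar>a\<bar> = \<bar>a\<bar> powr (p - 2) * \<bar>a\<bar> powr 1"
    by simp
  also have "\<dots> = \<bar>a\<bar> powr (p - 1)"
    by (subst powr_add[symmetric]) simp
  finally show ?thesis by (simp add: jp_def abs_mult)
qed (simp add: jp_def)

lemma jp_minus: "jp p (- a) = - jp p a"
  by (simp add: jp_def)

lemma jp_0 [simp]: "jp p 0 = 0"
  by (simp add: jp_def)

lemma jp_nonneg_iff: "0 \<le> jp p a \<longleftrightarrow> 0 \<le> a"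
  by (auto simp: jp_def zero_le_mult_iff)

lemma jp_of_nonneg: "0 \<le> a \<Longrightarrow> jp p a = a powr (p - 1)"
  using abs_jp[of p a] jp_nonneg_iff[of p a] by simp

lemma jp_mult_self: "jp p a * a = \<bar>a\<bar> powr p"
proof (cases "a = 0")
  case False
  have "jp p a * a = \<bar>jp p a\<bar> * \<bar>a\<bar>"
    by (simp add: jp_def abs_mult algebra_simps)
  also have "\<dots> = \<bar>a\<bar> powr (p - 1) * \<bar>a\<bar> powr 1"
    using False by (simp add: abs_jp)
  also have "\<dots> = \<bar>a\<bar> powr p"
    by (subst powr_add[symmetric]) simp
  finally show ?thesis .
qed simp

lemma jp_strict_mono:
  assumes "p > 1" "a < b" shows "jp p a < jp p b"
proof -
  consider "0 \<le> a" | "b \<le> 0" | "a < 0" "0 < b" by linarith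
  then show ?thesis
  proof cases
    case 1 then show ?thesis using assms by (simp add: jp_of_nonneg powr_less_mono2)
  next
    case 2
    then have "jp p (- b) < jp p (- a)"
      using assms by (simp add: jp_of_nonneg powr_less_mono2)
    then show ?thesis by (simp add: jp_minus)
  next
    case 3
    then show ?thesis using jp_nonneg_iff[of p a] jp_nonneg_iff[of p b] by linarith
  qed
qed

lemma jp_mono: "p > 1 \<Longrightarrow> a \<le> b \<Longrightarrow> jp p a \<le> jp p b"
  using jp_strict_mono[of p a b] by (cases "a = b") auto

lemma has_real_derivative_abs_powr:
  assumes "p > 1"
  shows "((\<lambda>x. \<bar>x\<bar> powr p) has_real_derivative p * jp p x) (at x)"
proof -
  consider "x > 0" | "x < 0" | "x = 0" by linarith
  then show ?thesis
  proof cases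
    case 1
    have "((\<lambda>x. x powr p) has_real_derivative p * jp p x) (at x)"
      using 1 by (auto intro!: derivative_eq_intros simp: jp_of_nonneg)
    then show ?thesis
      by (rule has_field_derivative_transform_within_open[where S = "{0<..}"]) (use 1 in auto)
  next
    case 2
    have "((\<lambda>x. (- x) powr p) has_real_derivative p * jp p x) (at x)"
      using 2 jp_minus[of p "- x"]
      by (auto intro!: derivative_eq_intros simp: jp_of_nonneg)
    then show ?thesis
      by (rule has_field_derivative_transform_within_open[where S = "{..<0}"]) (use 2 in auto)
  next
    case 3
    \<comment> \<open>At the origin the difference quotient is \<open>jp p y\<close> itself, whose
      modulus \<open>\<bar>y\<bar> powr (p - 1)\<close> tends to 0 because
      \<open>p > 1\<close>.\<close>
    have "((\<lambda>y. \<bar>y::real\<bar> powr (p - 1)) \<longlongrightarrow> \<bar>0\<bar> powr (p - 1)) (at 0)"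
      using assms by (intro tendsto_intros eventuallyI) auto
    then have "((\<lambda>y. \<bar>jp p y\<bar>) \<longlongrightarrow> 0) (at 0)"
      by (simp add: abs_jp)
    then have "(jp p \<longlongrightarrow> 0) (at 0)"
      by (rule tendsto_rabs_zero_cancel)
    then have "((\<lambda>y. (\<bar>y\<bar> powr p - \<bar>0\<bar> powr p) / (y - 0)) \<longlongrightarrow> 0) (at 0)"
    proof (rule Lim_transform_eventually)
      show "\<forall>\<^sub>F y in at 0. jp p y = (\<bar>y\<bar> powr p - \<bar>0\<bar> powr p) / (y - 0)"
        by (auto simp: eventually_at_filter jp_mult_self[symmetric])
    qed
    then show ?thesis
      unfolding 3 has_field_derivative_iff by simp
  qed
qed

text \<open>Convexity in tangent form: by the mean value theorem the chord slope is a value of the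
  derivative \<open>p * jp p\<close> between the two points, and \<open>jp p\<close> is
  monotone.\<close>

lemma abs_powr_tangent:
  assumes "p > 1"
  shows "\<bar>a\<bar> powr p + p * jp p a * (b - a) \<le> \<bar>b\<bar> powr p"
proof (cases a b rule: linorder_cases)
  case less
  obtain c where c: "a < c" "c < b" "\<bar>b\<bar> powr p - \<bar>a\<bar> powr p = (b - a) * (p * jp p c)"
    using MVT2[OF less has_real_derivative_abs_powr[OF assms]] by blast
  have "(b - a) * (p * jp p a) \<le> (b - a) * (p * jp p c)"
    using c less assms jp_mono[of p a c] by (intro mult_left_mono) auto
  then show ?thesis using c(3) by (simp add: algebra_simps)
next
  case greater
  obtain c where c: "b < c" "c < a" "\<bar>a\<bar> powr p - \<bar>b\<bar> powr p = (a - b) * (p * jp p c)"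
    using MVT2[OF greater has_real_derivative_abs_powr[OF assms]] by blast
  have "(a - b) * (p * jp p c) \<le> (a - b) * (p * jp p a)"
    using c greater assms jp_mono[of p c a] by (intro mult_left_mono) auto
  then show ?thesis using c(3) by (simp add: algebra_simps)
qed simp

text \<open>A convex function summed over a pair with fixed sum grows as the pair spreads. With
  \<open>t \<le> r\<close>, the tangents at \<open>t\<close> and \<open>r\<close> are evaluated at
  \<open>c\<close> and \<open>a\<close>; both shifts have length \<open>t - c\<close>, and the
  slopes are ordered.\<close>

lemma abs_powr_four_points:
  fixes a c t r :: real
  assumes p: "p > 1" and "c \<le> t" "c \<le> r" "t + r = a + c"
  shows "\<bar>t\<bar> powr p + \<bar>r\<bar> powr p \<le> \<bar>a\<bar> powr p + \<bar>c\<bar> powr p"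
proof -
  have *: "\<bar>t\<bar> powr p + \<bar>r\<bar> powr p \<le> \<bar>a\<bar> powr p + \<bar>c\<bar> powr p"
    if "c \<le> t" "c \<le> r" "t + r = a + c" "t \<le> r" for t r :: real
  proof -
    have "p * jp p t * (t - c) \<le> p * jp p r * (t - c)"
      using that jp_mono[OF p \<open>t \<le> r\<close>] p
      by (intro mult_right_mono mult_left_mono) auto
    moreover have "t - c = a - r" using that by simp
    ultimately have "p * jp p t * (t - c) \<le> p * jp p r * (a - r)" by simp
    with abs_powr_tangent[OF p, of r a] abs_powr_tangent[OF p, of t c]
    show ?thesis by (simp add: algebra_simps)
  qed
  show ?thesis
  proof (cases "t \<le> r")
    case True with * assms show ?thesis by blast
  next
    case False
    then show ?thesis using *[of r t] assms by (simp add: add.commute)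
  qed
qed

text \<open>If \<open>a, c\<close> and \<open>b, d\<close> are ordered alike, minima and maxima only
  permute the two differences. If they are ordered oppositely, the new differences lie between the
  old ones and have the same sum, so convexity applies.\<close>

lemma abs_powr_submodular:
  fixes a b c d :: real
  assumes p: "p > 1"
  shows "\<bar>min a c - min b d\<bar> powr p + \<bar>max a c - max b d\<bar> powr p
           \<le> \<bar>a - b\<bar> powr p + \<bar>c - d\<bar> powr p"
proof -
  consider "a \<le> c" "b \<le> d" | "c \<le> a" "d \<le> b" | "c \<le> a" "b \<le> d" | "a \<le> c" "d \<le> b"
    using linear[of a c] linear[of b d] by blast
  then show ?thesis
  proof cases
    case 3
    then show ?thesis
      using abs_powr_four_points[OF p, of "c - d" "c - b" "a - d" "a - b"] by simp
  next
    case 4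
    then show ?thesis
      using abs_powr_four_points[OF p, of "a - b" "a - d" "c - b" "c - d"] by simp
  qed (auto simp: min_def max_def)
qed

lemma abs_add_powr_le:
  fixes a b :: real
  assumes "p \<ge> 0"
  shows "\<bar>a + b\<bar> powr p \<le> 2 powr p * (\<bar>a\<bar> powr p + \<bar>b\<bar> powr p)"
proof -
  have "\<bar>a + b\<bar> powr p \<le> (2 * max \<bar>a\<bar> \<bar>b\<bar>) powr p"
    using assms by (intro powr_mono2) auto
  also have "\<dots> = 2 powr p * max \<bar>a\<bar> \<bar>b\<bar> powr p"
    by (simp add: powr_mult)
  also have "max \<bar>a\<bar> \<bar>b\<bar> powr p \<le> \<bar>a\<bar> powr p + \<bar>b\<bar> powr p"
    by (simp add: max_def)
  finally show ?thesis by simp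
qed

text \<open>A crude Young inequality: both moduli are replaced by their maximum. It makes the form
  of the operator integrable for any two members of the space.\<close>

lemma abs_jp_mult_le:
  assumes "p > 1"
  shows "\<bar>jp p a\<bar> * \<bar>d\<bar> \<le> \<bar>a\<bar> powr p + \<bar>d\<bar> powr p"
proof -
  have "\<bar>jp p a\<bar> * \<bar>d\<bar> \<le> \<bar>jp p (max \<bar>a\<bar> \<bar>d\<bar>)\<bar> * max \<bar>a\<bar> \<bar>d\<bar>"
    unfolding abs_jp using assms by (intro mult_mono powr_mono2) auto
  also have "\<dots> = max \<bar>a\<bar> \<bar>d\<bar> powr p"
    using jp_mult_self[of p "max \<bar>a\<bar> \<bar>d\<bar>"] jp_nonneg_iff[of p "max \<bar>a\<bar> \<bar>d\<bar>"]
    by (simp add: le_max_iff_disj)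
  also have "\<dots> \<le> \<bar>a\<bar> powr p + \<bar>d\<bar> powr p"
    by (simp add: max_def)
  finally show ?thesis .
qed

lemma borel_measurable_jp [measurable]: "jp p \<in> borel_measurable borel"
  unfolding jp_def by measurable

section \<open>Null sets and measurability on the space of pairs\<close>

lemma null_sets_lborel_vimage_fst:
  fixes M :: "'a::euclidean_space set"
  assumes "M \<in> null_sets lborel"
  shows "fst -` M \<in> null_sets (lborel :: ('a \<times> 'b::euclidean_space) measure)"
proof -
  have "emeasure (lborel \<Otimes>\<^sub>M lborel) (M \<times> (UNIV :: 'b set)) = 0"
    using assms by (subst lborel.emeasure_pair_measure_Times) auto
  moreover have "M \<times> (UNIV :: 'b set) = fst -` M" by auto
  ultimately show ?thesis
    using assms by (auto simp: null_sets_def lborel_prod intro!: continuous_intros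
        measurable_sets_borel[OF borel_measurable_continuous_onI])
qed

lemma null_sets_lborel_vimage_snd:
  fixes M :: "'b::euclidean_space set"
  assumes "M \<in> null_sets lborel"
  shows "snd -` M \<in> null_sets (lborel :: ('a::euclidean_space \<times> 'b) measure)"
proof -
  have "emeasure (lborel \<Otimes>\<^sub>M lborel) ((UNIV :: 'a set) \<times> M) = 0"
    using assms by (subst lborel.emeasure_pair_measure_Times) auto
  moreover have "(UNIV :: 'a set) \<times> M = snd -` M" by auto
  ultimately show ?thesis
    using assms by (auto simp: null_sets_def lborel_prod intro!: continuous_intros
        measurable_sets_borel[OF borel_measurable_continuous_onI])
qed

text \<open>On pairs, \<open>lebesgue\<close> is the completion of a product of Borel measures. The
  exceptional set is therefore first enlarged to a Borel null set, whose cylinder is null by the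
  product formula.\<close>

lemma AE_lebesgue_fst_snd:
  fixes P :: "'a::euclidean_space \<Rightarrow> bool"
  assumes "AE x in lebesgue. P x"
  shows "AE z in (lebesgue :: ('a \<times> 'b::euclidean_space) measure). P (fst z)"
    and "AE z in (lebesgue :: ('b \<times> 'a) measure). P (snd z)"
proof -
  have "AE x in lborel. P x"
    using assms by (simp add: AE_completion_iff)
  then obtain M where M: "{x. \<not> P x} \<subseteq> M" "M \<in> null_sets lborel"
    by (auto simp: eventually_ae_filter)
  have "AE z in (lborel :: ('a \<times> 'b) measure). P (fst z)"
    using M by (intro AE_I'[OF null_sets_lborel_vimage_fst[OF M(2)]]) auto
  then show "AE z in (lebesgue :: ('a \<times> 'b) measure). P (fst z)"
    by (rule AE_completion)
  have "AE z in (lborel :: ('b \<times> 'a) measure). P (snd z)"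
    using M by (intro AE_I'[OF null_sets_lborel_vimage_snd[OF M(2)]]) auto
  then show "AE z in (lebesgue :: ('b \<times> 'a) measure). P (snd z)"
    by (rule AE_completion)
qed

text \<open>A Borel representative composes with the projections, and it differs from
  \<open>u\<close> only on a null cylinder.\<close>

lemma borel_measurable_lebesgue_fst_snd:
  fixes u :: "'a::euclidean_space \<Rightarrow> real"
  assumes "u \<in> borel_measurable lebesgue"
  shows "(\<lambda>z. u (fst z)) \<in> borel_measurable (lebesgue :: ('a \<times> 'b::euclidean_space) measure)"
    and "(\<lambda>z. u (snd z)) \<in> borel_measurable (lebesgue :: ('b \<times> 'a) measure)"
proof -
  obtain u' where u': "u' \<in> borel_measurable lborel" "AE x in lborel. u x = u' x"
    using completion_ex_borel_measurable_real[of u lborel] assms by blast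
  have ae: "AE x in lebesgue. u' x = u x"
    using AE_completion[OF u'(2)] by auto
  have [measurable]: "u' \<in> borel_measurable borel" using u' by simp
  show "(\<lambda>z. u (fst z)) \<in> borel_measurable (lebesgue :: ('a \<times> 'b) measure)"
    by (rule borel_measurable_AE[OF _ AE_lebesgue_fst_snd(1)[OF ae]])
       (auto intro!: measurable_completion simp: borel_prod[symmetric])
  show "(\<lambda>z. u (snd z)) \<in> borel_measurable (lebesgue :: ('b \<times> 'a) measure)"
    by (rule borel_measurable_AE[OF _ AE_lebesgue_fst_snd(2)[OF ae]])
       (auto intro!: measurable_completion simp: borel_prod[symmetric])
qed

section \<open>The energy as an integral for a weighted measure\<close>

text \<open>With the kernel absorbed into the measure, energy and operator become plain integrals of
  differences. On the diagonal the weight is \<open>1 / 0 = 0\<close>, in agreement with the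
  original kernels.\<close>

definition gmeas :: "real \<Rightarrow> real \<Rightarrow> ('a::euclidean_space \<times> 'a) measure" where
  "gmeas s p = density lebesgue
     (\<lambda>z. ennreal (1 / norm (fst z - snd z) powr (real DIM('a) + s * p)))"

definition dq :: "('a \<Rightarrow> real) \<Rightarrow> 'a \<times> 'a \<Rightarrow> real" where
  "dq u z = u (fst z) - u (snd z)"

text \<open>A Bochner integral, hence 0 also for infinite energy; energies are compared only where
  integrability is known.\<close>

definition genergy :: "real \<Rightarrow> real \<Rightarrow> ('a::euclidean_space \<Rightarrow> real) \<Rightarrow> real" where
  "genergy s p u = (\<integral>z. \<bar>dq u z\<bar> powr p \<partial>gmeas s p)"

lemma measurable_gmeas [simp, measurable_cong]: "sets (gmeas s p) = sets lebesgue"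
  by (simp add: gmeas_def)

lemma measurable_dq [measurable]:
  assumes "u \<in> borel_measurable lebesgue"
  shows "dq u \<in> borel_measurable lebesgue"
  unfolding dq_def using borel_measurable_lebesgue_fst_snd[OF assms]
  by (rule borel_measurable_diff)

lemma kernel_measurable [measurable]:
  "(\<lambda>z::'a::euclidean_space \<times> 'a. norm (fst z - snd z) powr e) \<in> borel_measurable lebesgue"
  by (rule measurable_completion) (simp add: borel_prod[symmetric])

lemma AE_gmeas:
  fixes P :: "'a::euclidean_space \<Rightarrow> bool"
  assumes "AE x in lebesgue. P x"
  shows "AE z in gmeas s p. P (fst z) \<and> P (snd z)"
proof -
  have "AE z in (lebesgue :: ('a \<times> 'a) measure). P (fst z) \<and> P (snd z)"
    by (rule eventually_conj[OF AE_lebesgue_fst_snd[OF assms]])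
  then have "AE z in (lebesgue :: ('a \<times> 'a) measure).
      0 < ennreal (1 / norm (fst z - snd z) powr (real DIM('a) + s * p)) \<longrightarrow> P (fst z) \<and> P (snd z)"
    by (rule eventually_mono) blast
  then show ?thesis
    unfolding gmeas_def by (subst AE_density) measurable
qed

lemma gagliardo_energy_eq:
  assumes [measurable]: "u \<in> borel_measurable lebesgue"
  shows "gagliardo_energy s p u = (\<integral>\<^sup>+ z. ennreal (\<bar>dq u z\<bar> powr p) \<partial>gmeas s p)"
  unfolding gagliardo_energy_def gmeas_def dq_def[symmetric]
  by (subst nn_integral_density)
     (auto simp: ennreal_mult[symmetric] mult.commute intro!: nn_integral_cong)

lemma frac_p_laplacian_eq:
  assumes [measurable]: "u \<in> borel_measurable lebesgue" "v \<in> borel_measurable lebesgue"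
  shows "frac_p_laplacian s p u v = (\<integral>z. jp p (dq u z) * dq v z \<partial>gmeas s p)"
  unfolding frac_p_laplacian_def gmeas_def J_def dq_def[symmetric]
  by (subst integral_density)
     (auto simp: jp_def intro!: Bochner_Integration.integral_cong)

lemma mem_frac_sobolev_iff:
  "u \<in> frac_sobolev s p \<longleftrightarrow> u \<in> borel_measurable lebesgue \<and>
     integrable lebesgue (\<lambda>x. \<bar>u x\<bar> powr p) \<and> integrable (gmeas s p) (\<lambda>z. \<bar>dq u z\<bar> powr p)"
proof -
  have "gagliardo_energy s p u < \<infinity> \<longleftrightarrow> integrable (gmeas s p) (\<lambda>z. \<bar>dq u z\<bar> powr p)"
    if [measurable]: "u \<in> borel_measurable lebesgue"
    unfolding gagliardo_energy_eq[OF that] by (simp add: integrable_iff_bounded)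
  then show ?thesis by (auto simp: frac_sobolev_def)
qed

lemma gagliardo_seminorm_eq:
  assumes "u \<in> frac_sobolev s p"
  shows "gagliardo_seminorm s p u = genergy s p u powr (1 / p)"
  using assms unfolding gagliardo_seminorm_def mem_frac_sobolev_iff genergy_def
  by (subst gagliardo_energy_eq) (auto simp: nn_integral_eq_integral)

lemma genergy_nonneg: "0 \<le> genergy s p u"
  by (simp add: genergy_def)

lemma frac_sobolev0_iff:
  "u \<in> frac_sobolev0 s p \<Omega> \<longleftrightarrow> u \<in> borel_measurable lebesgue \<and>
     integrable lebesgue (\<lambda>x. \<bar>u x\<bar> powr p) \<and>
     integrable (gmeas s p) (\<lambda>z. \<bar>dq u z\<bar> powr p) \<and> (AE x in lebesgue. x \<notin> \<Omega> \<longrightarrow> u x = 0)"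
  by (auto simp: frac_sobolev0_def mem_frac_sobolev_iff)

lemma frac_sobolev0_measurable: "u \<in> frac_sobolev0 s p \<Omega> \<Longrightarrow> u \<in> borel_measurable lebesgue"
  by (simp add: frac_sobolev0_iff)

lemma frac_sobolev0_energy_integrable:
  "u \<in> frac_sobolev0 s p \<Omega> \<Longrightarrow> integrable (gmeas s p) (\<lambda>z. \<bar>dq u z\<bar> powr p)"
  by (simp add: frac_sobolev0_iff)

lemma gagliardo_seminorm_eq0:
  "u \<in> frac_sobolev0 s p \<Omega> \<Longrightarrow> gagliardo_seminorm s p u = genergy s p u powr (1 / p)"
  by (rule gagliardo_seminorm_eq) (simp add: frac_sobolev0_def)

section \<open>Closure properties of the space and submodularity of the energy\<close>

lemma abs_powr_dominated:
  fixes a b c :: real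
  assumes "p \<ge> 0" "C \<ge> 0" "\<bar>c\<bar> \<le> C * (\<bar>a\<bar> + \<bar>b\<bar>)"
  shows "\<bar>c\<bar> powr p \<le> (2 * C) powr p * (\<bar>a\<bar> powr p + \<bar>b\<bar> powr p)"
proof -
  have "\<bar>c\<bar> powr p \<le> (C * (\<bar>a\<bar> + \<bar>b\<bar>)) powr p"
    using assms by (intro powr_mono2) auto
  also have "\<dots> = C powr p * (\<bar>\<bar>a\<bar> + \<bar>b\<bar>\<bar>) powr p"
    using assms by (simp add: powr_mult)
  also have "\<dots> \<le> C powr p * (2 powr p * (\<bar>\<bar>a\<bar>\<bar> powr p + \<bar>\<bar>b\<bar>\<bar> powr p))"
    using assms by (intro mult_left_mono abs_add_powr_le) auto
  finally show ?thesis using assms by (simp add: powr_mult algebra_simps)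
qed

text \<open>The common criterion behind sums, Lipschitz images, lattice operations and products with
  cut-offs: values and increments both controlled by those of two members.\<close>

lemma frac_sobolev0_dominated:
  assumes p: "p > 1" and u: "u \<in> frac_sobolev0 s p \<Omega>" and v: "v \<in> frac_sobolev0 s p \<Omega>"
    and w [measurable]: "w \<in> borel_measurable lebesgue" and C: "C \<ge> 0"
    and 1: "\<And>x. \<bar>w x\<bar> \<le> C * (\<bar>u x\<bar> + \<bar>v x\<bar>)"
    and 2: "\<And>x y. \<bar>w x - w y\<bar> \<le> C * (\<bar>u x - u y\<bar> + \<bar>v x - v y\<bar>)"
  shows "w \<in> frac_sobolev0 s p \<Omega>"
proof -
  note uv = u[unfolded frac_sobolev0_iff] v[unfolded frac_sobolev0_iff]
  have 3: "\<bar>dq w z\<bar> \<le> C * (\<bar>dq u z\<bar> + \<bar>dq v z\<bar>)" for z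
    using 2 by (simp add: dq_def)
  have "integrable lebesgue (\<lambda>x. \<bar>w x\<bar> powr p)"
    by (rule Bochner_Integration.integrable_bound[of _
          "\<lambda>x. (2 * C) powr p * (\<bar>u x\<bar> powr p + \<bar>v x\<bar> powr p)"])
       (use uv p C 1 in \<open>auto intro!: AE_I2 abs_powr_dominated\<close>)
  moreover have "integrable (gmeas s p) (\<lambda>z. \<bar>dq w z\<bar> powr p)"
    by (rule Bochner_Integration.integrable_bound[of _
          "\<lambda>z. (2 * C) powr p * (\<bar>dq u z\<bar> powr p + \<bar>dq v z\<bar> powr p)"])
       (use uv p C 3 in \<open>auto intro!: AE_I2 abs_powr_dominated\<close>)
  moreover have "AE x in lebesgue. x \<notin> \<Omega> \<longrightarrow> w x = 0"
    using uv(1)[THEN conjunct2, THEN conjunct2, THEN conjunct2]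
          uv(2)[THEN conjunct2, THEN conjunct2, THEN conjunct2]
  proof eventually_elim
    case (elim x)
    then show ?case using 1[of x] by auto
  qed
  ultimately show ?thesis by (simp add: frac_sobolev0_iff)
qed

lemma frac_sobolev0_add_scaled:
  assumes p: "p > 1" and u: "u \<in> frac_sobolev0 s p \<Omega>" and v: "v \<in> frac_sobolev0 s p \<Omega>"
  shows "(\<lambda>x. u x + c * v x) \<in> frac_sobolev0 s p \<Omega>"
proof (rule frac_sobolev0_dominated[OF p u v, where C = "1 + \<bar>c\<bar>"])
  note [measurable] = u[THEN frac_sobolev0_measurable] v[THEN frac_sobolev0_measurable]
  show "(\<lambda>x. u x + c * v x) \<in> borel_measurable lebesgue" by measurable
  have *: "\<bar>a + c * b\<bar> \<le> (1 + \<bar>c\<bar>) * (\<bar>a\<bar> + \<bar>b\<bar>)" for a b :: real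
  proof -
    have "\<bar>a + c * b\<bar> \<le> \<bar>a\<bar> + \<bar>c\<bar> * \<bar>b\<bar>" by (metis abs_mult abs_triangle_ineq)
    also have "\<dots> \<le> (1 + \<bar>c\<bar>) * (\<bar>a\<bar> + \<bar>b\<bar>)" by (simp add: algebra_simps)
    finally show ?thesis .
  qed
  show "\<bar>u x + c * v x\<bar> \<le> (1 + \<bar>c\<bar>) * (\<bar>u x\<bar> + \<bar>v x\<bar>)" for x by (rule *)
  show "\<bar>u x + c * v x - (u y + c * v y)\<bar> \<le> (1 + \<bar>c\<bar>) * (\<bar>u x - u y\<bar> + \<bar>v x - v y\<bar>)" for x y
    using *[of "u x - u y" "v x - v y"] by (simp add: algebra_simps)
qed simp

lemma frac_sobolev0_lipschitz_image:
  assumes p: "p > 1" and u: "u \<in> frac_sobolev0 s p \<Omega>"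
    and T: "T 0 = 0" "\<And>a b. \<bar>T a - T b\<bar> \<le> C * \<bar>a - b :: real\<bar>"
  shows "(\<lambda>x. T (u x)) \<in> frac_sobolev0 s p \<Omega>"
proof (rule frac_sobolev0_dominated[OF p u u, where C = "max C 0"])
  note [measurable] = u[THEN frac_sobolev0_measurable]
  have "\<bar>T a - T b\<bar> \<le> max C 0 * \<bar>a - b\<bar>" for a b
    using T(2)[of a b] mult_right_mono[of C "max C 0" "\<bar>a - b\<bar>"] by simp
  then have "(max C 0)-lipschitz_on UNIV T"
    by (simp add: lipschitz_on_def dist_real_def)
  then have "continuous_on UNIV T" by (rule lipschitz_on_continuous_on)
  then have [measurable]: "T \<in> borel_measurable borel"
    by (rule borel_measurable_continuous_onI)
  show "(\<lambda>x. T (u x)) \<in> borel_measurable lebesgue" by measurable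
  have *: "\<bar>T a - T b\<bar> \<le> max C 0 * (\<bar>a - b\<bar> + \<bar>a - b\<bar>)" for a b
  proof -
    have "C * \<bar>a - b\<bar> \<le> max C 0 * (\<bar>a - b\<bar> + \<bar>a - b\<bar>)"
      by (intro mult_mono) auto
    then show ?thesis using T(2)[of a b] by linarith
  qed
  show "\<bar>T (u x)\<bar> \<le> max C 0 * (\<bar>u x\<bar> + \<bar>u x\<bar>)" for x
    using *[of "u x" 0] T(1) by simp
  show "\<bar>T (u x) - T (u y)\<bar> \<le> max C 0 * (\<bar>u x - u y\<bar> + \<bar>u x - u y\<bar>)" for x y
    by (rule *)
qed simp

lemma frac_sobolev0_min:
  assumes p: "p > 1" and u: "u \<in> frac_sobolev0 s p \<Omega>" and v: "v \<in> frac_sobolev0 s p \<Omega>"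
  shows "(\<lambda>x. min (u x) (v x)) \<in> frac_sobolev0 s p \<Omega>"
  using u[THEN frac_sobolev0_measurable] v[THEN frac_sobolev0_measurable]
  by (intro frac_sobolev0_dominated[OF p u v, where C = 1]) auto

lemma frac_sobolev0_max:
  assumes p: "p > 1" and u: "u \<in> frac_sobolev0 s p \<Omega>" and v: "v \<in> frac_sobolev0 s p \<Omega>"
  shows "(\<lambda>x. max (u x) (v x)) \<in> frac_sobolev0 s p \<Omega>"
  using u[THEN frac_sobolev0_measurable] v[THEN frac_sobolev0_measurable]
  by (intro frac_sobolev0_dominated[OF p u v, where C = 1]) auto

lemma integrable_jp_dq:
  assumes p: "p > 1" and u: "u \<in> frac_sobolev0 s p \<Omega>" and v: "v \<in> frac_sobolev0 s p \<Omega>"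
  shows "integrable (gmeas s p) (\<lambda>z. jp p (dq u z) * dq v z)"
proof (rule Bochner_Integration.integrable_bound)
  note [measurable] = u[THEN frac_sobolev0_measurable] v[THEN frac_sobolev0_measurable]
  show "integrable (gmeas s p) (\<lambda>z. \<bar>dq u z\<bar> powr p + \<bar>dq v z\<bar> powr p)"
    using u v by (auto simp: frac_sobolev0_iff)
  show "(\<lambda>z. jp p (dq u z) * dq v z) \<in> borel_measurable (gmeas s p)"
    by measurable
  show "AE z in gmeas s p. norm (jp p (dq u z) * dq v z) \<le> norm (\<bar>dq u z\<bar> powr p + \<bar>dq v z\<bar> powr p)"
    using abs_jp_mult_le[OF p] by (auto simp: abs_mult)
qed

text \<open>This replaces compactness in the existence of minimisers, and it allows competitors to
  be cut at a barrier.\<close>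

lemma genergy_submodular:
  assumes p: "p > 1" and u: "u \<in> frac_sobolev0 s p \<Omega>" and v: "v \<in> frac_sobolev0 s p \<Omega>"
  shows "genergy s p (\<lambda>x. min (u x) (v x)) + genergy s p (\<lambda>x. max (u x) (v x))
           \<le> genergy s p u + genergy s p v"
proof -
  note [simp] = frac_sobolev0_energy_integrable[OF u] frac_sobolev0_energy_integrable[OF v]
    frac_sobolev0_energy_integrable[OF frac_sobolev0_min[OF p u v]]
    frac_sobolev0_energy_integrable[OF frac_sobolev0_max[OF p u v]]
  have *: "\<bar>dq (\<lambda>x. min (u x) (v x)) z\<bar> powr p + \<bar>dq (\<lambda>x. max (u x) (v x)) z\<bar> powr p
      \<le> \<bar>dq u z\<bar> powr p + \<bar>dq v z\<bar> powr p" for z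
    unfolding dq_def by (rule abs_powr_submodular[OF p])
  have "(\<integral>z. \<bar>dq (\<lambda>x. min (u x) (v x)) z\<bar> powr p + \<bar>dq (\<lambda>x. max (u x) (v x)) z\<bar> powr p \<partial>gmeas s p)
      \<le> (\<integral>z. \<bar>dq u z\<bar> powr p + \<bar>dq v z\<bar> powr p \<partial>gmeas s p)"
    by (intro integral_mono *) auto
  then show ?thesis by (simp add: genergy_def)
qed

section \<open>Faber-Krahn inequality, comparison and maximum principles\<close>

text \<open>Among all pairs keep only \<open>x\<close> in \<open>A\<close> and \<open>y\<close> in \<open>ball x R - A\<close>, where \<open>R\<close> is chosen
  so that the ball has twice the measure of \<open>A\<close>.\<close>

lemma faber_krahn:
  fixes s p :: real and w :: "'a::euclidean_space \<Rightarrow> real"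
  defines "N \<equiv> real DIM('a)"
  assumes sp: "s * p > 0"
    and w: "w \<in> borel_measurable lebesgue" and int: "integrable lebesgue (\<lambda>x. \<bar>w x\<bar> powr p)"
      "integrable (gmeas s p) (\<lambda>z. \<bar>dq w z\<bar> powr p)"
    and A: "A \<in> lmeasurable" and w0: "AE x in lebesgue. x \<notin> A \<longrightarrow> w x = 0"
  shows "(\<integral>x. \<bar>w x\<bar> powr p \<partial>lebesgue)
     \<le> (2 / unit_ball_vol N) powr ((N + s * p) / N) * measure lebesgue A powr (s * p / N) * genergy s p w"
proof (cases "measure lebesgue A = 0")
  case True
  then have "A \<in> null_sets lebesgue"
    using A by (intro null_setsI) (auto simp: emeasure_eq_measure2)
  then have "AE x in lebesgue. x \<notin> A" by (rule AE_not_in)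
  with w0 have "AE x in lebesgue. \<bar>w x\<bar> powr p = 0" by eventually_elim simp
  then have "(\<integral>x. \<bar>w x\<bar> powr p \<partial>lebesgue) = 0"
    by (subst integral_cong_AE[where g = "\<lambda>x. 0"]) (use w in auto)
  then show ?thesis using genergy_nonneg[of s p w] by simp
next
  case False
  define V where "V = unit_ball_vol N"
  define e where "e = N + s * p"
  have N: "N > 0" by (simp add: N_def)
  have V: "V > 0" using N by (simp add: V_def)
  have e: "e > 0" using N sp by (simp add: e_def)
  define m where "m = measure lebesgue A"
  have m: "m > 0" using False by (simp add: m_def zero_less_measure_iff)
  have eA: "emeasure lebesgue A = ennreal m"
    using A by (simp add: m_def emeasure_eq_measure2)
  define R where "R = (2 * m / V) powr (1 / N)"
  have R: "R > 0" using m V by (simp add: R_def)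
  have RN: "V * R ^ DIM('a) = 2 * m"
  proof -
    have "R ^ DIM('a) = R powr N" using R by (simp add: powr_realpow N_def)
    also have "\<dots> = 2 * m / V" using N m V by (simp add: R_def powr_powr)
    finally show ?thesis using V by simp
  qed
  \<comment> \<open>Tonelli is applied to Borel functions: \<open>w'\<close> stands in for
    \<open>w\<close>, and its nonvanishing set \<open>B\<close>, of measure at most
    \<open>m\<close>, stands in for \<open>A\<close>.\<close>
  obtain w' where w': "w' \<in> borel_measurable lborel" "AE x in lborel. w x = w' x"
    using completion_ex_borel_measurable_real[of w lborel] w by blast
  have [measurable]: "w' \<in> borel_measurable borel" using w' by simp
  have ae: "AE x in lebesgue. w x = w' x" using w'(2) by (rule AE_completion)
  define B where "B = {x. w' x \<noteq> 0}"
  have B [measurable]: "B \<in> sets borel" unfolding B_def by measurable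
  have "AE x in lebesgue. x \<in> B \<longrightarrow> x \<in> A"
    using ae w0 by eventually_elim (auto simp: B_def)
  then have "emeasure lebesgue B \<le> emeasure lebesgue A"
    using A B by (intro emeasure_mono_AE) auto
  then have eB: "emeasure lborel B \<le> ennreal m"
    using eA B by simp
  have ball: "emeasure lborel (ball x R - B) \<ge> ennreal m" for x
  proof -
    have "ennreal (2 * m) = emeasure lborel (ball x R)"
      using R RN by (simp add: emeasure_ball V_def N_def)
    also have "\<dots> \<le> emeasure lborel ((ball x R - B) \<union> B)"
      using B by (intro emeasure_mono) auto
    also have "\<dots> \<le> emeasure lborel (ball x R - B) + emeasure lborel B"
      using B by (intro emeasure_subadditive) auto
    also have "\<dots> \<le> emeasure lborel (ball x R - B) + ennreal m"
      using eB by (intro add_left_mono)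
    finally have "ennreal m + ennreal m \<le> emeasure lborel (ball x R - B) + ennreal m"
      using m by (simp flip: ennreal_plus)
    then show ?thesis by (simp add: ennreal_add_left_cancel_le add.commute)
  qed
  define k :: "'a \<times> 'a \<Rightarrow> ennreal" where
    "k = (\<lambda>z. ennreal (\<bar>w' (fst z) - w' (snd z)\<bar> powr p / norm (fst z - snd z) powr e))"
  have k: "k \<in> borel_measurable (borel \<Otimes>\<^sub>M borel)" unfolding k_def by measurable
  have ae2: "AE z in lebesgue. w (fst z) = w' (fst z)" "AE z in lebesgue. w (snd z) = w' (snd z)"
    by (rule AE_lebesgue_fst_snd[OF ae])+
  have "ennreal (m / R powr e) * (\<integral>\<^sup>+x. ennreal (\<bar>w x\<bar> powr p) \<partial>lebesgue)
      = ennreal (m / R powr e) * (\<integral>\<^sup>+x. ennreal (\<bar>w' x\<bar> powr p) \<partial>lebesgue)"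
    by (intro arg_cong2[where f = "(*)"] refl nn_integral_cong_AE) (use ae in auto)
  also have "\<dots> = (\<integral>\<^sup>+x. ennreal (m / R powr e) * ennreal (\<bar>w' x\<bar> powr p) \<partial>lborel)"
    by (simp add: nn_integral_completion nn_integral_cmult)
  also have "\<dots> \<le> (\<integral>\<^sup>+x. \<integral>\<^sup>+y. ennreal (\<bar>w' x\<bar> powr p / R powr e) * indicator (ball x R - B) y
                     \<partial>lborel \<partial>lborel)"
  proof (rule nn_integral_mono)
    fix x
    have "ennreal (m / R powr e) * ennreal (\<bar>w' x\<bar> powr p)
        = ennreal (\<bar>w' x\<bar> powr p / R powr e) * ennreal m"
      using m by (simp flip: ennreal_mult)
    also have "\<dots> \<le> ennreal (\<bar>w' x\<bar> powr p / R powr e) * emeasure lborel (ball x R - B)"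
      by (intro mult_left_mono ball) simp
    also have "\<dots> = (\<integral>\<^sup>+y. ennreal (\<bar>w' x\<bar> powr p / R powr e) * indicator (ball x R - B) y \<partial>lborel)"
      by (simp add: nn_integral_cmult_indicator)
    finally show "ennreal (m / R powr e) * ennreal (\<bar>w' x\<bar> powr p) \<le> \<dots>" .
  qed
  also have "\<dots> \<le> (\<integral>\<^sup>+x. \<integral>\<^sup>+y. k (x, y) \<partial>lborel \<partial>lborel)"
  proof (intro nn_integral_mono)
    fix x y
    show "ennreal (\<bar>w' x\<bar> powr p / R powr e) * indicator (ball x R - B) y \<le> k (x, y)"
    proof (cases "y \<in> ball x R - B \<and> w' x \<noteq> 0")
      case True
      then have "w' y = 0" "x \<noteq> y" "norm (x - y) < R"
        by (auto simp: B_def dist_norm)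
      moreover have "\<bar>w' x\<bar> powr p / R powr e \<le> \<bar>w' x\<bar> powr p / norm (x - y) powr e"
        using \<open>norm (x - y) < R\<close> \<open>x \<noteq> y\<close> e R
        by (intro divide_left_mono powr_mono2 mult_pos_pos) auto
      ultimately show ?thesis
        using True by (simp add: k_def ennreal_leI)
    qed (auto simp: indicator_def)
  qed
  also have "\<dots> = (\<integral>\<^sup>+z. k z \<partial>(lborel \<Otimes>\<^sub>M lborel))"
    by (rule lborel.nn_integral_fst) (use k in simp)
  also have "\<dots> = (\<integral>\<^sup>+z. k z \<partial>lebesgue)"
    by (simp add: lborel_prod nn_integral_completion)
  also have "\<dots> = gagliardo_energy s p w"
    unfolding gagliardo_energy_def k_def e_def N_def
    by (intro nn_integral_cong_AE) (use ae2 in \<open>eventually_elim, auto\<close>)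
  also have "\<dots> = ennreal (genergy s p w)"
    unfolding gagliardo_energy_eq[OF w] genergy_def
    using int(2) by (intro nn_integral_eq_integral) auto
  also have "(\<integral>\<^sup>+x. ennreal (\<bar>w x\<bar> powr p) \<partial>lebesgue) = ennreal (\<integral>x. \<bar>w x\<bar> powr p \<partial>lebesgue)"
    using int(1) by (intro nn_integral_eq_integral) auto
  finally have "m / R powr e * (\<integral>x. \<bar>w x\<bar> powr p \<partial>lebesgue) \<le> genergy s p w"
    using m genergy_nonneg[of s p w] by (simp flip: ennreal_mult)
  then have "(\<integral>x. \<bar>w x\<bar> powr p \<partial>lebesgue) \<le> R powr e / m * genergy s p w"
    using m R by (simp add: field_simps)
  \<comment> \<open>\<open>R powr N\<close> is a multiple of \<open>m\<close>, so after division by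
    \<open>m\<close> the exponent \<open>e / N - 1 = s * p / N\<close> remains.\<close>
  also have "R powr e / m = (2 / V) powr (e / N) * m powr (s * p / N)"
  proof -
    have "R powr e = (2 / V) powr (e / N) * m powr (e / N)"
      using m V by (simp add: R_def powr_powr powr_mult[symmetric])
    moreover have "m powr (e / N) = m powr (s * p / N) * m"
    proof -
      have "e / N = s * p / N + 1" using N by (simp add: e_def N_def field_simps)
      then show ?thesis using m by (simp add: powr_add)
    qed
    ultimately show ?thesis using m by simp
  qed
  finally show ?thesis by (simp add: m_def V_def e_def)
qed
text \<open>A Poincare inequality, namely Faber-Krahn on the whole of \<open>\<Omega>\<close>,
  bounds the norm in \<open>L^p\<close> by the energy.\<close>

lemma frac_sobolev0_energy_eq_0:
  assumes p: "p > 1" and s: "s > 0" and \<Omega>: "\<Omega> \<in> lmeasurable"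
    and w: "w \<in> frac_sobolev0 s p \<Omega>" and E: "genergy s p w = 0"
  shows "AE x in lebesgue. w x = 0"
proof -
  have w': "w \<in> borel_measurable lebesgue" "integrable lebesgue (\<lambda>x. \<bar>w x\<bar> powr p)"
    "integrable (gmeas s p) (\<lambda>z. \<bar>dq w z\<bar> powr p)" "AE x in lebesgue. x \<notin> \<Omega> \<longrightarrow> w x = 0"
    using w by (auto simp: frac_sobolev0_iff)
  have "s * p > 0" using p s by simp
  then have "(\<integral>x. \<bar>w x\<bar> powr p \<partial>lebesgue) \<le> 0"
    using faber_krahn[OF _ w'(1-3) \<Omega> w'(4)] E by simp
  then have "(\<integral>x. \<bar>w x\<bar> powr p \<partial>lebesgue) = 0"
    by (simp add: antisym)
  then have "AE x in lebesgue. \<bar>w x\<bar> powr p = 0"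
    using w'(2) by (subst (asm) integral_nonneg_eq_0_iff_AE) auto
  then show ?thesis by eventually_elim simp
qed

section \<open>Comparison and maximum principles\<close>

lemma frac_p_laplacian_eq0:
  assumes "u \<in> frac_sobolev0 s p \<Omega>" "v \<in> frac_sobolev0 s p \<Omega>"
  shows "frac_p_laplacian s p u v = (\<integral>z. jp p (dq u z) * dq v z \<partial>gmeas s p)"
  using assms by (intro frac_p_laplacian_eq frac_sobolev0_measurable)

text \<open>The test function is a nondecreasing function of \<open>a - b\<close>, so the difference
  of the two forms has a nonnegative integrand; when it vanishes, strict monotonicity of
  \<open>jp\<close> forces \<open>v\<close> to have zero energy. The cut at 1 keeps the test
  function bounded, as the later comparison with a concave image demands.\<close>

lemma weak_comparison:
  fixes a b :: "'a::euclidean_space \<Rightarrow> real"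
  defines "v \<equiv> \<lambda>x. max 0 (min 1 (a x - b x))"
  assumes p: "p > 1" and s: "s > 0" and \<Omega>: "\<Omega> \<in> lmeasurable"
    and a: "a \<in> frac_sobolev0 s p \<Omega>" and b: "b \<in> frac_sobolev0 s p \<Omega>"
    and le: "frac_p_laplacian s p a v \<le> frac_p_laplacian s p b v"
  shows "AE x in lebesgue. a x \<le> b x"
proof -
  have "(\<lambda>x. a x + (-1) * b x) \<in> frac_sobolev0 s p \<Omega>"
    by (rule frac_sobolev0_add_scaled[OF p a b])
  then have "(\<lambda>x. max 0 (min 1 (a x + (-1) * b x))) \<in> frac_sobolev0 s p \<Omega>"
    by (rule frac_sobolev0_lipschitz_image[OF p, where C = 1]) auto
  then have v: "v \<in> frac_sobolev0 s p \<Omega>" by (simp add: v_def)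
  define D where "D z = (jp p (dq a z) - jp p (dq b z)) * dq v z" for z
  have D_eq: "D z = jp p (dq a z) * dq v z - jp p (dq b z) * dq v z" for z
    by (simp add: D_def algebra_simps)
  have D_int: "integrable (gmeas s p) D"
    unfolding D_eq using integrable_jp_dq[OF p a v] integrable_jp_dq[OF p b v] by simp
  have D_nonneg: "0 \<le> D z" and D_0: "D z = 0 \<Longrightarrow> dq v z = 0" for z
  proof -
    have *: "dq v z \<ge> 0" if "dq b z \<le> dq a z"
      using that by (auto simp: dq_def v_def)
    have **: "dq v z \<le> 0" if "dq a z \<le> dq b z"
      using that by (auto simp: dq_def v_def)
    have ***: "jp p (dq a z) = jp p (dq b z) \<Longrightarrow> dq a z = dq b z"
      using jp_strict_mono[OF p] by (metis linorder_neqE_linordered_idom order_less_irrefl)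
    show "0 \<le> D z"
      using * ** jp_mono[OF p, of "dq a z" "dq b z"] jp_mono[OF p, of "dq b z" "dq a z"]
      by (cases "dq b z \<le> dq a z") (auto simp: D_def mult_nonneg_nonneg mult_nonpos_nonpos)
    show "dq v z = 0" if "D z = 0"
      using that * ** *** by (auto simp: D_def)
  qed
  have "(\<integral>z. D z \<partial>gmeas s p) \<le> 0"
    using le integrable_jp_dq[OF p a v] integrable_jp_dq[OF p b v]
    by (simp add: D_eq frac_p_laplacian_eq0[OF a v] frac_p_laplacian_eq0[OF b v])
  moreover have "0 \<le> (\<integral>z. D z \<partial>gmeas s p)"
    using D_nonneg by simp
  ultimately have "(\<integral>z. D z \<partial>gmeas s p) = 0" by simp
  then have "AE z in gmeas s p. D z = 0"
    using D_int D_nonneg by (subst (asm) integral_nonneg_eq_0_iff_AE) auto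
  then have "AE z in gmeas s p. \<bar>dq v z\<bar> powr p = 0"
    by eventually_elim (simp add: D_0)
  then have "genergy s p v = 0"
    unfolding genergy_def using frac_sobolev0_energy_integrable[OF v]
    by (subst integral_nonneg_eq_0_iff_AE) auto
  then have "AE x in lebesgue. v x = 0"
    by (rule frac_sobolev0_energy_eq_0[OF p s \<Omega> v])
  then show ?thesis
    by eventually_elim (auto simp: v_def max_def min_def split: if_splits)
qed

text \<open>Test with \<open>\<eta>\<close> times a cut-off of \<open>u\<close> that decreases to the indicator of \<open>u = 0\<close>. Pairs with
  equal values of \<open>u\<close> contribute nothing, and on the others the cut-off at the larger value tends
  to \<open>0\<close>.\<close>

lemma strong_maximum_principle:
  fixes u \<eta> h :: "'a::euclidean_space \<Rightarrow> real"
  assumes p: "p > 1" and u: "u \<in> frac_sobolev0 s p \<Omega>" and u0: "AE x in lebesgue. 0 \<le> u x"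
    and \<eta>: "\<eta> \<in> frac_sobolev0 s p \<Omega>" "AE x in lebesgue. x \<in> \<Omega> \<longrightarrow> 0 < \<eta> x"
    and h: "AE x in lebesgue. x \<in> \<Omega> \<longrightarrow> 0 < h x"
    and int: "\<And>v. v \<in> frac_sobolev0 s p \<Omega> \<Longrightarrow> set_integrable lebesgue \<Omega> (\<lambda>x. h x * v x)"
    and eq: "\<And>v. v \<in> frac_sobolev0 s p \<Omega> \<Longrightarrow> AE x in lebesgue. 0 \<le> v x \<Longrightarrow>
        frac_p_laplacian s p u v = (LINT x:\<Omega>|lebesgue. h x * v x)"
    and \<Omega>: "\<Omega> \<in> lmeasurable"
  shows "AE x in lebesgue. x \<in> \<Omega> \<longrightarrow> 0 < u x"
proof -
  define y where "y = (\<lambda>x. max 0 (min 1 (\<eta> x)))"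
  have y: "y \<in> frac_sobolev0 s p \<Omega>"
    unfolding y_def by (rule frac_sobolev0_lipschitz_image[OF p \<eta>(1), where C = 1]) auto
  have y01: "0 \<le> y x" "y x \<le> 1" for x by (auto simp: y_def)
  \<comment> \<open>\<open>g n\<close> is 1 for \<open>t \<le> 0\<close> and, for
    \<open>n > 0\<close>, vanishes from \<open>1 / n\<close> on. \<open>g 0\<close> is constantly 1,
    so that \<open>v 0 = y\<close> gives the integrability of \<open>h * y\<close>.\<close>
  define g where "g n t = max 0 (1 - real n * max 0 t)" for n t
  have g01: "0 \<le> g n t" "g n t \<le> 1" for n t by (auto simp: g_def)
  have g_lip: "\<bar>g n a - g n b\<bar> \<le> real n * \<bar>a - b\<bar>" for n a b
  proof -
    have "\<bar>g n a - g n b\<bar> \<le> \<bar>real n * max 0 a - real n * max 0 b\<bar>"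
    proof -
      have "\<bar>max 0 (1 - c) - max 0 (1 - d)\<bar> \<le> \<bar>c - d\<bar>" for c d :: real by auto
      then show ?thesis unfolding g_def by blast
    qed
    also have "\<dots> = real n * \<bar>max 0 a - max 0 b\<bar>"
      by (simp flip: right_diff_distrib add: abs_mult)
    also have "\<dots> \<le> real n * \<bar>a - b\<bar>" by (intro mult_left_mono) auto
    finally show ?thesis .
  qed
  have g_anti: "g n b \<le> g n a" if "a \<le> b" for n a b
  proof -
    have "real n * max 0 a \<le> real n * max 0 b"
      using that by (intro mult_left_mono) auto
    then show ?thesis unfolding g_def by (intro max.mono) auto
  qed
  have [measurable]: "g n \<in> borel_measurable borel" for n unfolding g_def by measurable
  note [measurable] = u[THEN frac_sobolev0_measurable] y[THEN frac_sobolev0_measurable]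
  define v where "v n x = g n (u x) * y x" for n x
  have v: "v n \<in> frac_sobolev0 s p \<Omega>" for n
  proof (rule frac_sobolev0_dominated[OF p u y, where C = "real n + 1"])
    show "v n \<in> borel_measurable lebesgue" unfolding v_def by measurable
    show "\<bar>v n x\<bar> \<le> (real n + 1) * (\<bar>u x\<bar> + \<bar>y x\<bar>)" for x
    proof -
      have "\<bar>v n x\<bar> \<le> \<bar>y x\<bar>"
        using g01[of n "u x"] y01[of x] by (simp add: v_def abs_mult mult_left_le_one_le)
      also have "\<dots> \<le> (real n + 1) * (\<bar>u x\<bar> + \<bar>y x\<bar>)"
        by (simp add: algebra_simps)
      finally show ?thesis .
    qed
    show "\<bar>v n x - v n x'\<bar> \<le> (real n + 1) * (\<bar>u x - u x'\<bar> + \<bar>y x - y x'\<bar>)" for x x'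
    proof -
      have "v n x - v n x' = g n (u x) * (y x - y x') + y x' * (g n (u x) - g n (u x'))"
        by (simp add: v_def algebra_simps)
      then have "\<bar>v n x - v n x'\<bar> \<le> \<bar>g n (u x)\<bar> * \<bar>y x - y x'\<bar> + \<bar>y x'\<bar> * \<bar>g n (u x) - g n (u x')\<bar>"
        by (metis abs_mult abs_triangle_ineq)
      also have "\<dots> \<le> 1 * \<bar>y x - y x'\<bar> + 1 * (real n * \<bar>u x - u x'\<bar>)"
        using g01[of n "u x"] y01[of x'] by (intro add_mono mult_mono g_lip) auto
      also have "\<dots> \<le> (real n + 1) * (\<bar>u x - u x'\<bar> + \<bar>y x - y x'\<bar>)"
        by (simp add: algebra_simps)
      finally show ?thesis .
    qed
  qed simp
  \<comment> \<open>The minimum is the cut-off at the larger value of \<open>u\<close>, because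
    \<open>g n\<close> is nonincreasing.\<close>
  define R where "R n z = \<bar>jp p (dq u z) * dq y z\<bar> * min (g n (u (fst z))) (g n (u (snd z)))" for n z
  have R_meas: "R n \<in> borel_measurable (gmeas s p)" for n
  proof -
    have "(\<lambda>z. min (g n (u (fst z))) (g n (u (snd z)))) \<in> borel_measurable lebesgue"
      by (intro borel_measurable_min borel_measurable_lebesgue_fst_snd) measurable
    moreover have "(\<lambda>z. \<bar>jp p (dq u z) * dq y z\<bar>) \<in> borel_measurable lebesgue" by measurable
    ultimately show ?thesis unfolding R_def by simp
  qed
  have R_bound: "\<bar>R n z\<bar> \<le> \<bar>jp p (dq u z) * dq y z\<bar>" for n z
    using g01[of n] by (auto simp: R_def abs_mult min_def mult_left_le)
  have v_le_R: "jp p (dq u z) * dq (v n) z \<le> R n z" for n z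
  proof -
    \<comment> \<open>Replacing the cut-off \<open>g n b\<close> in front of
      \<open>d \<ge> 0\<close> by the smaller \<open>g n a\<close> can only enlarge the difference;
      the factor \<open>jp p (a - b)\<close> is nonnegative.\<close>
    have *: "jp p (a - b) * (g n a * c - g n b * d) \<le> \<bar>jp p (a - b) * (c - d)\<bar> * g n a"
      if "b \<le> a" "0 \<le> c" "0 \<le> d" for a b c d
    proof -
      have j: "0 \<le> jp p (a - b)" using that by (simp add: jp_nonneg_iff)
      have "g n a * c - g n b * d \<le> g n a * (c - d)"
        using mult_right_mono[OF g_anti[OF \<open>b \<le> a\<close>, of n] \<open>0 \<le> d\<close>] by (simp add: algebra_simps)
      also have "\<dots> \<le> g n a * \<bar>c - d\<bar>" using g01 by (intro mult_left_mono) auto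
      finally have "jp p (a - b) * (g n a * c - g n b * d) \<le> jp p (a - b) * (g n a * \<bar>c - d\<bar>)"
        using j by (rule mult_left_mono)
      then show ?thesis using j by (simp add: abs_mult mult_ac)
    qed
    have **: "min (g n a) (g n b) = g n a" if "b \<le> a" for a b
      using g_anti[OF that] by (simp add: min_def)
    obtain x x' where z: "z = (x, x')" by (cases z)
    show ?thesis
    proof (cases "u x' \<le> u x")
      case True
      then show ?thesis
        using *[OF True y01(1)[of x] y01(1)[of x']] by (simp add: R_def z dq_def v_def **)
    next
      case False
      then have "u x \<le> u x'" by simp
      then show ?thesis
        using *[OF \<open>u x \<le> u x'\<close> y01(1)[of x'] y01(1)[of x]] **[of "u x" "u x'"]
          jp_minus[of p "u x' - u x"]
        by (simp add: R_def z dq_def v_def min.commute abs_mult abs_minus_commute algebra_simps)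
    qed
  qed
  have R_lim: "(\<lambda>n. \<integral>z. R n z \<partial>gmeas s p) \<longlonglongrightarrow> (\<integral>z. 0 \<partial>(gmeas s p :: ('a \<times> 'a) measure))"
  proof (rule integral_dominated_convergence[where f = "\<lambda>_. 0" and s = R
        and w = "\<lambda>z. \<bar>jp p (dq u z) * dq y z\<bar>"])
    show "integrable (gmeas s p) (\<lambda>z. \<bar>jp p (dq u z) * dq y z\<bar>)"
      using integrable_jp_dq[OF p u y] by simp
    show "AE z in gmeas s p. (\<lambda>n. R n z) \<longlonglongrightarrow> 0"
      using AE_gmeas[OF u0]
    proof eventually_elim
      case (elim z)
      show ?case
      proof (cases "dq u z = 0")
        case True
        then show ?thesis by (simp add: R_def)
      next
        case False
        define t where "t = max (u (fst z)) (u (snd z))"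
        have t: "t > 0" using False elim by (auto simp: dq_def t_def max_def)
        obtain n0 where n0: "real n0 > 1 / t" using reals_Archimedean2 by blast
        have "R n z = 0" if "n \<ge> n0" for n
        proof -
          have "real n > 1 / t" using n0 that by (meson less_le_trans of_nat_le_iff)
          then have "real n * t > 1" using t by (simp add: field_simps)
          then have "g n t = 0" using t by (auto simp: g_def)
          then have "min (g n (u (fst z))) (g n (u (snd z))) = 0"
            using g01(1)[of n "u (fst z)"] g01(1)[of n "u (snd z)"]
            by (auto simp: t_def max_def min_def split: if_splits)
          then show ?thesis by (simp add: R_def)
        qed
        then have "eventually (\<lambda>n. R n z = 0) sequentially"
          by (auto simp: eventually_sequentially)
        then show ?thesis by (rule tendsto_eventually)
      qed
    qed
  qed (use R_meas R_bound in auto)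
  \<comment> \<open>\<open>D\<close> lies below every \<open>h * v n\<close>, so its integral is at
    most the limit 0 of the integrals of \<open>R n\<close>; the set where \<open>u\<close> vanishes
    is therefore null in \<open>\<Omega>\<close>.\<close>
  define D where "D x = h x * (if u x \<le> 0 then y x else 0)" for x
  have "set_integrable lebesgue \<Omega> (\<lambda>x. h x * v 0 x)" by (rule int[OF v])
  moreover have hy: "h x * v 0 x = h x * y x" for x by (simp add: v_def g_def)
  ultimately have hy_int: "set_integrable lebesgue \<Omega> (\<lambda>x. h x * y x)" by simp
  have D_alt: "indicator \<Omega> x *\<^sub>R D x = (indicator \<Omega> x *\<^sub>R (h x * y x)) * indicator {x. u x \<le> 0} x" for x
    by (simp add: D_def indicator_def)
  have "{x \<in> space lebesgue. u x \<le> 0} \<in> sets lebesgue" by measurable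
  then have u_le_0: "{x. u x \<le> 0} \<in> sets lebesgue" by simp
  have D_int: "set_integrable lebesgue \<Omega> D"
    unfolding set_integrable_def D_alt
    by (rule integrable_real_mult_indicator)
       (use hy_int u_le_0 in \<open>auto simp: set_integrable_def\<close>)
  have D_le: "(LINT x:\<Omega>|lebesgue. D x) \<le> (\<integral>z. R n z \<partial>gmeas s p)" for n
  proof -
    have "(LINT x:\<Omega>|lebesgue. D x) \<le> (LINT x:\<Omega>|lebesgue. h x * v n x)"
      unfolding set_lebesgue_integral_def
    proof (rule integral_mono_AE)
      show "AE x in lebesgue. indicator \<Omega> x *\<^sub>R D x \<le> indicator \<Omega> x *\<^sub>R (h x * v n x)"
        using h
      proof eventually_elim
        case (elim x)
        have "(if u x \<le> 0 then y x else 0) \<le> v n x"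
          using g01[of n "u x"] y01[of x] by (auto simp: v_def g_def)
        then show ?case using elim by (auto simp: D_def indicator_def intro: mult_left_mono)
      qed
    qed (use D_int int[OF v] in \<open>auto simp: set_integrable_def\<close>)
    also have "\<dots> = frac_p_laplacian s p u (v n)"
      by (rule eq[OF v, symmetric]) (simp add: v_def g01 y01)
    also have "\<dots> = (\<integral>z. jp p (dq u z) * dq (v n) z \<partial>gmeas s p)"
      by (rule frac_p_laplacian_eq0[OF u v])
    also have "\<dots> \<le> (\<integral>z. R n z \<partial>gmeas s p)"
    proof (intro integral_mono v_le_R integrable_jp_dq[OF p u v])
      show "integrable (gmeas s p) (R n)"
        using integrable_jp_dq[OF p u y] R_meas R_bound
        by (intro Bochner_Integration.integrable_bound[OF integrable_jp_dq[OF p u y]]) auto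
    qed
    finally show ?thesis .
  qed
  have D_nonneg: "AE x in lebesgue. 0 \<le> indicator \<Omega> x *\<^sub>R D x"
    using h by eventually_elim (auto simp: D_def indicator_def y01)
  have "(LINT x:\<Omega>|lebesgue. D x) \<le> 0"
    using R_lim D_le by (intro tendsto_le[OF _ R_lim[simplified] tendsto_const]) auto
  moreover have "0 \<le> (LINT x:\<Omega>|lebesgue. D x)"
    unfolding set_lebesgue_integral_def by (rule integral_nonneg_AE[OF D_nonneg])
  ultimately have "AE x in lebesgue. indicator \<Omega> x *\<^sub>R D x = 0"
    using D_int D_nonneg unfolding set_integrable_def set_lebesgue_integral_def
    by (subst integral_nonneg_eq_0_iff_AE[symmetric]) auto
  then show ?thesis using h \<eta>(2)
  proof eventually_elim
    case (elim x)
    show ?case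
    proof
      assume x: "x \<in> \<Omega>"
      then have "y x > 0" using elim by (auto simp: y_def)
      then show "0 < u x" using elim x by (auto simp: D_def split: if_splits)
    qed
  qed
qed

section \<open>The concave transformation\<close>

lemma real_differentiableI:
  fixes f :: "real \<Rightarrow> real"
  shows "DERIV f x :> D \<Longrightarrow> f differentiable (at x)"
  by (auto simp: real_differentiable_def)

text \<open>Separation of variables gives \<open>H (\<Phi> t) = c * H t\<close>, which serves as the
  definition of \<open>\<Phi>\<close> since \<open>H\<close> is strictly increasing. Concavity is
  delivered as two increment bounds with slope \<open>\<phi>\<close>: this form survives an affine
  cut-off and passes directly through \<open>jp\<close>.\<close>

lemma concave_transform:
  fixes f :: "real \<Rightarrow> real" and p \<theta> :: real
  assumes p: "p > 1" and diff: "\<And>x. f differentiable (at x)" and mono: "mono f" and f0: "f 0 > 0"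
    and conv: "convex_on {0..} (\<lambda>t. f t powr (1 / (p - 1)))"
    and \<theta>: "0 < \<theta>" "\<theta> < 1"
  obtains \<Phi> \<phi> :: "real \<Rightarrow> real" and C :: real where
    "\<And>t. 0 \<le> t \<Longrightarrow> 0 \<le> \<Phi> t" "\<And>t. 0 \<le> t \<Longrightarrow> \<Phi> t \<le> t"
    "\<And>t. 0 \<le> t \<Longrightarrow> 0 < \<phi> t" "\<And>t. 0 \<le> t \<Longrightarrow> \<phi> t \<le> 1"
    "\<And>a b. 0 \<le> b \<Longrightarrow> b \<le> a \<Longrightarrow> \<phi> a * (a - b) \<le> \<Phi> a - \<Phi> b"
    "\<And>a b. 0 \<le> b \<Longrightarrow> b \<le> a \<Longrightarrow> \<Phi> a - \<Phi> b \<le> \<phi> b * (a - b)"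
    "\<And>t. 0 \<le> t \<Longrightarrow> \<phi> t powr (p - 1) * f t = \<theta> * f (\<Phi> t)"
    "C > 0" "\<And>t. 0 \<le> t \<Longrightarrow> f (\<Phi> t) \<le> C * (1 + t) powr (p - 1)"
proof -
  define r where "r = 1 / (p - 1)"
  have r: "r > 0" "r * (p - 1) = 1" using p by (auto simp: r_def)
  define g where "g t = f t powr r" for t
  define c where "c = \<theta> powr r"
  have c: "0 < c" "c < 1"
    using \<theta> r powr_less_mono2[of r \<theta> 1] by (auto simp: c_def)
  have c_powr: "c powr (p - 1) = \<theta>" using \<theta> r by (simp add: c_def powr_powr)
  have f_pos: "f t > 0" if "t \<ge> 0" for t
    using f0 monoD[OF mono that] by simp
  have g_pos: "g t > 0" if "t \<ge> 0" for t
    using f_pos[OF that] by (simp add: g_def)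
  have g_powr: "g t powr (p - 1) = f t" if "t \<ge> 0" for t
    using f_pos[OF that] r by (simp add: g_def powr_powr)
  have g_mono: "g a \<le> g b" if "0 \<le> a" "a \<le> b" for a b
    using that f_pos[of a] r monoD[OF mono \<open>a \<le> b\<close>] by (auto simp: g_def intro!: powr_mono2)
  define g' where "g' t = deriv g t" for t
  have g_deriv: "DERIV g t :> g' t" if "t \<ge> 0" for t
  proof -
    obtain D where D: "DERIV f t :> D" using diff[of t] by (auto simp: real_differentiable_def)
    have "DERIV g t :> r * f t powr (r - 1) * D"
      unfolding g_def using D f_pos[OF that] by (auto intro!: derivative_eq_intros)
    then have "g differentiable (at t)" by (auto simp: real_differentiable_def)
    then show ?thesis
      by (simp add: g'_def DERIV_deriv_iff_real_differentiable)
  qed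
  have g_conv: "convex_on {0..} g" using conv by (simp add: g_def[abs_def] r_def)
  have tangent: "g' x * (y - x) \<le> g y - g x" if "x > 0" "y \<ge> 0" for x y
    by (rule convex_on_imp_above_tangent[OF g_conv])
       (use that g_deriv[of x] in \<open>auto intro: has_field_derivative_at_within simp: interior_real_atLeast\<close>)
  have g'_nonneg: "g' x \<ge> 0" if "x > 0" for x
  proof -
    have "0 \<le> g' x * x" using tangent[of x 0] g_mono[of 0 x] that by simp
    then show ?thesis using that by (simp add: zero_le_mult_iff)
  qed
  have g'_mono: "g' x \<le> g' y" if "0 < x" "x \<le> y" for x y
  proof (cases "x = y")
    case False
    have "g' x * (y - x) \<le> g' y * (y - x)"
      using tangent[of x y] tangent[of y x] that by (simp add: algebra_simps)
    then show ?thesis using False that by simp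
  qed simp
  \<comment> \<open>\<open>g\<close> is controlled only on the half-line; the constant extension to
    the left makes the integrand continuous on the whole line.\<close>
  define q where "q t = 1 / g (max 0 t)" for t
  have q: "q t = 1 / g t" if "t \<ge> 0" for t using that by (simp add: q_def)
  have g_cont: "continuous_on {0..} g"
    using g_deriv by (intro continuous_at_imp_continuous_on) (auto intro: DERIV_isCont)
  have q_cont: "continuous_on UNIV q"
    unfolding q_def
    by (intro continuous_intros continuous_on_compose2[OF g_cont])
       (use g_pos in \<open>auto simp: less_imp_neq[symmetric]\<close>)
  define H where "H t = integral {0..t} q" for t
  have H0: "H 0 = 0" by (simp add: H_def)
  have H_deriv_within: "(H has_real_derivative q t) (at t within {0..b})" if "0 \<le> t" "t \<le> b" for t b
    unfolding H_def
    by (rule integral_has_real_derivative) (use q_cont that in \<open>auto intro: continuous_on_subset\<close>)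
  have H_deriv: "DERIV H t :> 1 / g t" if "t > 0" for t
  proof -
    have "(H has_real_derivative q t) (at t within {0..t+1})"
      using that by (intro H_deriv_within) auto
    then show ?thesis
      using that by (subst (asm) at_within_interior) (auto simp: q)
  qed
  have H_cont: "continuous_on {0..b} H" for b
    unfolding continuous_on_eq_continuous_within
    by (intro ballI DERIV_continuous[OF H_deriv_within]) auto
  have H_diff: "\<exists>z. a < z \<and> z < b \<and> H b - H a = (b - a) / g z" if "0 \<le> a" "a < b" for a b
  proof -
    have "\<exists>l z. a < z \<and> z < b \<and> DERIV H z :> l \<and> H b - H a = (b - a) * l"
      by (rule MVT[OF \<open>a < b\<close>])
         (use that in \<open>auto intro: continuous_on_subset[OF H_cont[of b]] H_deriv[THEN real_differentiableI]\<close>)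
    then obtain l z where z: "a < z" "z < b" "DERIV H z :> l" "H b - H a = (b - a) * l" by blast
    moreover have "l = 1 / g z" using z that by (intro DERIV_unique[OF z(3) H_deriv]) auto
    ultimately show ?thesis by auto
  qed
  have H_less: "H a < H b" if "0 \<le> a" "a < b" for a b
  proof -
    from H_diff[OF that] obtain z where z: "a < z" "z < b" "H b - H a = (b - a) / g z" by blast
    have "0 < (b - a) / g z" using that z g_pos[of z] by simp
    then show ?thesis using z by simp
  qed
  have H_inj: "inj_on H {0..}"
    by (intro inj_onI) (metis H_less atLeast_iff linorder_neqE_linordered_idom order_less_irrefl)
  have H_ivt: "\<exists>x. 0 \<le> x \<and> x \<le> b \<and> H x = y" if "0 \<le> b" "0 \<le> y" "y \<le> H b" for b y
    by (rule IVT') (use that H0 H_cont in auto)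
  define \<Psi> where "\<Psi> = inv_into {0..} H"
  have \<Psi>H: "\<Psi> (H x) = x" if "0 \<le> x" for x
    using that H_inj by (simp add: \<Psi>_def inv_into_f_f)
  have H\<Psi>: "H (\<Psi> y) = y" if "0 \<le> b" "0 \<le> y" "y \<le> H b" for b y
    using H_ivt[OF that] \<Psi>H by auto
  define \<Phi> where "\<Phi> t = \<Psi> (c * H t)" for t
  have H_nonneg: "0 \<le> H t" if "0 \<le> t" for t using that H_less[of 0 t] H0 by (cases "t = 0") auto
  have cH: "0 \<le> c * H t" "c * H t \<le> H t" if "0 \<le> t" for t
    using H_nonneg[OF that] c by (auto simp: mult_left_le_one_le)
  have "0 \<le> \<Phi> t \<and> \<Phi> t \<le> t \<and> H (\<Phi> t) = c * H t" if "0 \<le> t" for t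
    using H_ivt[OF that cH[OF that]] \<Psi>H by (metis \<Phi>_def)
  then have \<Phi>_ex: "0 \<le> \<Phi> t" "\<Phi> t \<le> t" and H\<Phi>: "H (\<Phi> t) = c * H t" if "0 \<le> t" for t
    using that by auto
  have \<Phi>_pos: "0 < \<Phi> t" if "0 < t" for t
  proof -
    have "H (\<Phi> t) > 0" using that c H_less[of 0 t] by (simp add: H\<Phi> H0)
    then show ?thesis using \<Phi>_ex(1)[of t] that H0 by (cases "\<Phi> t = 0") auto
  qed
  define \<phi> where "\<phi> t = c * g (\<Phi> t) / g t" for t
  have \<Phi>_deriv: "DERIV \<Phi> t :> \<phi> t" if "0 < t" for t
  proof -
    define x where "x = \<Phi> t"
    have x: "0 < x" "H x = c * H t" using \<Phi>_pos H\<Phi> that by (auto simp: x_def)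
    have Ht: "0 < H t" using H_less[of 0 t] that H0 by simp
    have "isCont \<Psi> (H x)"
    proof (rule isCont_inverse_function[where f = H and x = x and d = "x / 2"])
      fix z assume "\<bar>z - x\<bar> \<le> x / 2"
      then have "z > 0" using x by (auto simp: abs_if split: if_splits)
      then show "\<Psi> (H z) = z" "isCont H z"
        by (auto intro: \<Psi>H DERIV_isCont[OF H_deriv])
    qed (use x in auto)
    then have cont: "isCont \<Psi> (c * H t)" using x by simp
    have "DERIV \<Psi> (c * H t) :> inverse (1 / g x)"
    proof (rule DERIV_inverse_function[where a = 0 and b = "H t"])
      show "DERIV H (\<Psi> (c * H t)) :> 1 / g x"
        using H_deriv[OF x(1)] by (simp add: x_def \<Phi>_def)
      show "1 / g x \<noteq> 0" using g_pos[of x] x by simp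
      show "0 < c * H t" "c * H t < H t" using c Ht by auto
      show "H (\<Psi> y) = y" if "0 < y" "y < H t" for y
        using that \<open>0 < t\<close> by (intro H\<Psi>[of t]) auto
    qed (rule cont)
    then have "DERIV (\<lambda>t. \<Psi> (c * H t)) t :> inverse (1 / g x) * (c * (1 / g t))"
      using H_deriv[OF that] by (intro DERIV_chain2[where f = \<Psi>] DERIV_cmult)
    then show ?thesis by (simp add: \<Phi>_def[abs_def] \<phi>_def x_def mult.commute)
  qed
  have \<phi>_pos: "0 < \<phi> t" if "0 \<le> t" for t
    using that c g_pos[of t] g_pos[of "\<Phi> t"] \<Phi>_ex[of t] by (simp add: \<phi>_def)
  have \<phi>_le: "\<phi> t \<le> c" if "0 \<le> t" for t
    using that c g_pos[of t] g_mono[of "\<Phi> t" t] \<Phi>_ex[of t] by (simp add: \<phi>_def field_simps)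
  have \<phi>_le1: "\<phi> t \<le> 1" if "0 \<le> t" for t using \<phi>_le[OF that] c by simp
  have \<Phi>_0: "\<Phi> 0 = 0" using \<Phi>_ex[of 0] by simp
  have \<phi>_0: "\<phi> 0 = c" using g_pos[of 0] by (simp add: \<phi>_def \<Phi>_0)
  have \<phi>_anti: "\<phi> a \<le> \<phi> b" if "0 \<le> b" "b \<le> a" for a b
  proof (cases "b = 0")
    \<comment> \<open>The derivative of \<open>\<Phi>\<close> is available only at positive
      arguments, so the endpoint is treated through \<open>\<phi> 0 = c\<close>, the largest value
      that \<open>\<phi>\<close> can take.\<close>
    case True
    then show ?thesis using \<phi>_le[of a] that by (simp add: \<phi>_0)
  next
    case False
    show ?thesis
    proof (rule DERIV_nonpos_imp_nonincreasing[OF \<open>b \<le> a\<close>])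
      fix t assume "b \<le> t" "t \<le> a"
      then have t: "0 < t" using False that by simp
      have gt: "g t > 0" using g_pos t by simp
      have "DERIV (\<lambda>t. c * g (\<Phi> t)) t :> c * (g' (\<Phi> t) * \<phi> t)"
        using t \<Phi>_pos[OF t] by (intro DERIV_cmult DERIV_chain2[OF g_deriv \<Phi>_deriv]) auto
      then have "DERIV (\<lambda>t. c * g (\<Phi> t) / g t) t
          :> (c * (g' (\<Phi> t) * \<phi> t) * g t - c * g (\<Phi> t) * g' t) / (g t * g t)"
        using t gt by (intro DERIV_divide g_deriv) auto
      then have D: "DERIV \<phi> t :> (c * (g' (\<Phi> t) * \<phi> t) * g t - c * g (\<Phi> t) * g' t) / (g t * g t)"
        by (simp only: \<phi>_def[abs_def])
      \<comment> \<open>The numerator of the derivative is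
        \<open>c * g (\<Phi> t) * (c * g' (\<Phi> t) - g' t)\<close>. It is nonpositive because
        \<open>c < 1\<close>, \<open>\<Phi> t \<le> t\<close>, and \<open>g'\<close> is nonnegative
        and nondecreasing by convexity.\<close>
      have "c * g' (\<Phi> t) \<le> 1 * g' (\<Phi> t)"
        using c g'_nonneg[OF \<Phi>_pos[OF t]] by (intro mult_right_mono) auto
      also have "\<dots> \<le> g' t" using g'_mono[OF \<Phi>_pos[OF t] \<Phi>_ex(2)] t by simp
      finally have "c * g' (\<Phi> t) \<le> g' t" .
      then have "(c * g (\<Phi> t)) * (c * g' (\<Phi> t)) \<le> (c * g (\<Phi> t)) * g' t"
        using c g_pos[of "\<Phi> t"] \<Phi>_pos[OF t] by (intro mult_left_mono) auto
      moreover have "\<phi> t * g t = c * g (\<Phi> t)" using gt by (simp add: \<phi>_def)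
      then have "c * (g' (\<Phi> t) * \<phi> t) * g t = (c * g (\<Phi> t)) * (c * g' (\<Phi> t))"
        by (metis (no_types, lifting) mult.assoc mult.commute)
      ultimately have "c * (g' (\<Phi> t) * \<phi> t) * g t - c * g (\<Phi> t) * g' t \<le> 0" by linarith
      then have "(c * (g' (\<Phi> t) * \<phi> t) * g t - c * g (\<Phi> t) * g' t) / (g t * g t) \<le> 0"
        using gt by (intro divide_nonpos_pos mult_pos_pos)
      with D show "\<exists>y. DERIV \<phi> t :> y \<and> y \<le> 0" by blast
    qed
  qed
  have \<Phi>_cont: "continuous_on {0..} \<Phi>"
  proof (intro continuous_on_eq_continuous_within[THEN iffD2] ballI)
    fix t :: real assume "t \<in> {0..}"
    show "continuous (at t within {0..}) \<Phi>"
    proof (cases "t = 0")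
      case True
      have "(\<Phi> \<longlongrightarrow> 0) (at 0 within {0..})"
        by (rule tendsto_sandwich[where f = "\<lambda>_. 0" and h = "\<lambda>t. t"])
           (use \<Phi>_ex in \<open>auto simp: eventually_at_filter\<close>)
      then show ?thesis using True by (simp add: continuous_within \<Phi>_0)
    next
      case False
      then show ?thesis using \<Phi>_deriv[of t] \<open>t \<in> {0..}\<close>
        by (auto intro: continuous_at_imp_continuous_at_within DERIV_isCont)
    qed
  qed
  have \<Phi>_diff: "\<exists>z. b < z \<and> z < a \<and> \<Phi> a - \<Phi> b = (a - b) * \<phi> z" if "0 \<le> b" "b < a" for a b
  proof -
    have "\<exists>l z. b < z \<and> z < a \<and> DERIV \<Phi> z :> l \<and> \<Phi> a - \<Phi> b = (a - b) * l"
      by (rule MVT[OF \<open>b < a\<close>])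
         (use that in \<open>auto intro: continuous_on_subset[OF \<Phi>_cont] \<Phi>_deriv[THEN real_differentiableI]\<close>)
    then obtain l z where z: "b < z" "z < a" "DERIV \<Phi> z :> l" "\<Phi> a - \<Phi> b = (a - b) * l" by blast
    moreover have "l = \<phi> z" using z that by (intro DERIV_unique[OF z(3) \<Phi>_deriv]) auto
    ultimately show ?thesis by auto
  qed
  have lower: "\<phi> a * (a - b) \<le> \<Phi> a - \<Phi> b" and upper: "\<Phi> a - \<Phi> b \<le> \<phi> b * (a - b)"
    if ab: "0 \<le> b" "b \<le> a" for a b
  proof -
    have "\<phi> a * (a - b) \<le> \<Phi> a - \<Phi> b \<and> \<Phi> a - \<Phi> b \<le> \<phi> b * (a - b)"
    proof (cases "a = b")
      case False
      then obtain z where z: "b < z" "z < a" "\<Phi> a - \<Phi> b = (a - b) * \<phi> z"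
        using \<Phi>_diff[of b a] ab by auto
      then show ?thesis
        using \<phi>_anti[of z a] \<phi>_anti[of b z] ab
        by (auto simp: mult.commute[of "a - b"] intro!: mult_right_mono)
    qed simp
    then show "\<phi> a * (a - b) \<le> \<Phi> a - \<Phi> b" "\<Phi> a - \<Phi> b \<le> \<phi> b * (a - b)" by auto
  qed
  have eq: "\<phi> t powr (p - 1) * f t = \<theta> * f (\<Phi> t)" if "0 \<le> t" for t
  proof -
    have "\<phi> t powr (p - 1) * g t powr (p - 1) = (\<phi> t * g t) powr (p - 1)"
      using \<phi>_pos[OF that] g_pos[OF that] by (simp add: powr_mult)
    also have "\<phi> t * g t = c * g (\<Phi> t)" using g_pos[OF that] by (simp add: \<phi>_def)
    also have "\<dots> powr (p - 1) = \<theta> * f (\<Phi> t)"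
      using c g_pos[of "\<Phi> t"] \<Phi>_ex[OF that] by (simp add: powr_mult c_powr g_powr)
    finally show ?thesis using that by (simp add: g_powr)
  qed
  \<comment> \<open>The first summand serves \<open>t \<le> 1\<close>, where
    \<open>\<Phi> t \<le> 1\<close>; the second comes from the mean value theorem for
    \<open>H\<close> between \<open>\<Phi> t\<close> and \<open>t\<close> when
    \<open>t > 1\<close>.\<close>
  define K where "K = g 1 + 1 / ((1 - c) * H 1)"
  have H1: "H 1 > 0" using H_less[of 0 1] H0 by simp
  have K: "K > 0" using g_pos[of 1] H1 c by (auto simp: K_def intro!: add_pos_pos)
  have growth: "g (\<Phi> t) \<le> K * (1 + t)" if "0 \<le> t" for t
  proof (cases "t \<le> 1")
    case True
    have "g (\<Phi> t) \<le> g 1" using \<Phi>_ex[OF that] True by (intro g_mono) auto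
    also have "\<dots> \<le> K" using H1 c by (simp add: K_def)
    also have "\<dots> \<le> K * (1 + t)" using K that by simp
    finally show ?thesis .
  next
    case False
    then have Ht: "H 1 \<le> H t" using H_less[of 1 t] by simp
    have "c * H t < 1 * H t" using c Ht H1 by (intro mult_strict_right_mono) auto
    then have "\<Phi> t \<noteq> t" using H\<Phi>[OF that] by auto
    then have lt: "\<Phi> t < t" using \<Phi>_ex[OF that] by simp
    have "0 \<le> \<Phi> t" by (rule \<Phi>_ex[OF that])
    from H_diff[OF this lt] obtain z
      where z: "\<Phi> t < z" "z < t" "H t - H (\<Phi> t) = (t - \<Phi> t) / g z" by blast
    have gz: "0 < g (\<Phi> t)" "g (\<Phi> t) \<le> g z"
      using z \<Phi>_ex[OF that] by (auto intro: g_mono g_pos)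
    have "(1 - c) * H 1 \<le> (1 - c) * H t" using Ht c by (intro mult_left_mono) auto
    also have "\<dots> = (t - \<Phi> t) / g z" using z(3) H\<Phi>[OF that] by (simp add: algebra_simps)
    also have "\<dots> \<le> (t - \<Phi> t) / g (\<Phi> t)"
      using gz lt by (intro divide_left_mono mult_pos_pos) auto
    also have "\<dots> \<le> t / g (\<Phi> t)" using gz \<Phi>_ex[OF that] by (intro divide_right_mono) auto
    finally have "g (\<Phi> t) * ((1 - c) * H 1) \<le> t"
      using gz by (simp add: field_simps)
    then have "g (\<Phi> t) \<le> 1 / ((1 - c) * H 1) * t"
      using c H1 by (simp add: field_simps)
    also have "\<dots> \<le> K * (1 + t)"
      using c H1 that g_pos[of 1] by (intro mult_mono) (auto simp: K_def)
    finally show ?thesis .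
  qed
  have growth': "f (\<Phi> t) \<le> K powr (p - 1) * (1 + t) powr (p - 1)" if "0 \<le> t" for t
  proof -
    have "f (\<Phi> t) = g (\<Phi> t) powr (p - 1)" using \<Phi>_ex[OF that] by (simp add: g_powr)
    also have "\<dots> \<le> (K * (1 + t)) powr (p - 1)"
      using growth[OF that] g_pos[of "\<Phi> t"] \<Phi>_ex[OF that] p by (intro powr_mono2) auto
    finally show ?thesis using K that by (simp add: powr_mult)
  qed
  show thesis
    by (rule that[of \<Phi> \<phi> "K powr (p - 1)"])
       (use \<Phi>_ex \<phi>_pos \<phi>_le1 lower upper eq growth' K in auto)
qed

section \<open>Minimisers and the Euler-Lagrange equation\<close>

text \<open>Confining competitors to the order interval between 0 and \<open>U\<close> supplies one
  integrable majorant for all potential terms. Boundedness from below and passage to pointwise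
  limits both rest on it.\<close>

locale truncated_functional =
  fixes s p :: real and \<Omega> :: "'a::euclidean_space set"
    and U B :: "'a \<Rightarrow> real" and G :: "'a \<Rightarrow> real \<Rightarrow> real"
  assumes p: "p > 1"
    and U: "U \<in> frac_sobolev0 s p \<Omega>" "\<And>x. 0 \<le> U x"
    and B: "integrable lebesgue B"
    and G_bound: "\<And>x t. 0 \<le> t \<Longrightarrow> t \<le> U x \<Longrightarrow> \<bar>G x t\<bar> \<le> B x"
    and G_meas: "\<And>v. v \<in> borel_measurable lebesgue \<Longrightarrow> (\<lambda>x. G x (v x)) \<in> borel_measurable lebesgue"
    and G_cont: "\<And>x t. isCont (G x) t"
begin

definition K where "K = {v \<in> frac_sobolev0 s p \<Omega>. \<forall>x. 0 \<le> v x \<and> v x \<le> U x}"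

text \<open>The energy carries no factor \<open>1 / p\<close>; the potential used later therefore
  contains the factor \<open>p * l'\<close>.\<close>

definition fnl where "fnl v = genergy s p v - (\<integral>x. G x (v x) \<partial>lebesgue)"

lemma K_D:
  assumes "v \<in> K"
  shows "v \<in> frac_sobolev0 s p \<Omega>" "v \<in> borel_measurable lebesgue" "0 \<le> v x" "v x \<le> U x"
  using assms by (auto simp: K_def frac_sobolev0_measurable)

lemma integrable_G:
  assumes "v \<in> K" shows "integrable lebesgue (\<lambda>x. G x (v x))"
  using K_D[OF assms] G_bound
  by (intro Bochner_Integration.integrable_bound[OF B] G_meas AE_I2)
     (auto intro: order_trans[OF _ abs_ge_self])

lemma integral_G_le:
  assumes "v \<in> K" shows "(\<integral>x. G x (v x) \<partial>lebesgue) \<le> (\<integral>x. B x \<partial>lebesgue)"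
  using K_D[OF assms] G_bound
  by (intro integral_mono integrable_G assms B) (meson abs_le_D1)

lemma K_nonempty: "U \<in> K" using U by (simp add: K_def)

lemma fnl_bdd_below: "bdd_below (fnl ` K)"
proof (rule bdd_belowI2)
  fix v assume "v \<in> K"
  then show "- (\<integral>x. B x \<partial>lebesgue) \<le> fnl v"
    using integral_G_le[of v] genergy_nonneg[of s p v] by (simp add: fnl_def)
qed

text \<open>Pointwise convergence suffices: Fatou for the energy, dominated convergence for the
  potential term.\<close>

lemma fnl_lower_semicontinuous:
  assumes y: "\<And>k. y k \<in> K" and lim: "\<And>x. (\<lambda>k. y k x) \<longlonglongrightarrow> w x" and M: "\<And>k. fnl (y k) \<le> M"
  shows "w \<in> K" "fnl w \<le> M"
proof -
  note [measurable] = K_D(2)[OF y]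
  have [measurable]: "w \<in> borel_measurable lebesgue"
    by (rule borel_measurable_LIMSEQ_real[OF lim]) measurable
  have w: "0 \<le> w x" "w x \<le> U x" for x
    using LIMSEQ_le_const[OF lim] LIMSEQ_le_const2[OF lim] K_D(3,4)[OF y] by blast+
  note U' = U(1)[unfolded frac_sobolev0_iff]
  have wp: "integrable lebesgue (\<lambda>x. \<bar>w x\<bar> powr p)"
  proof (rule Bochner_Integration.integrable_bound)
    show "integrable lebesgue (\<lambda>x. \<bar>U x\<bar> powr p)" using U' by simp
    show "AE x in lebesgue. norm (\<bar>w x\<bar> powr p) \<le> norm (\<bar>U x\<bar> powr p)"
      using w p U(2) by (auto intro!: AE_I2 powr_mono2)
  qed measurable
  have w0: "AE x in lebesgue. x \<notin> \<Omega> \<longrightarrow> w x = 0"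
    using U'[THEN conjunct2, THEN conjunct2, THEN conjunct2]
    by eventually_elim (metis w antisym)
  have Glim: "(\<lambda>k. \<integral>x. G x (y k x) \<partial>lebesgue) \<longlonglongrightarrow> (\<integral>x. G x (w x) \<partial>lebesgue)"
  proof (rule integral_dominated_convergence[OF _ _ B])
    show "(\<lambda>x. G x (w x)) \<in> borel_measurable lebesgue" by (rule G_meas) measurable
    show "(\<lambda>x. G x (y k x)) \<in> borel_measurable lebesgue" for k by (rule G_meas) measurable
    show "AE x in lebesgue. (\<lambda>k. G x (y k x)) \<longlonglongrightarrow> G x (w x)"
      by (intro AE_I2 isCont_tendsto_compose[OF G_cont] lim)
    show "AE x in lebesgue. norm (G x (y k x)) \<le> B x" for k
      using G_bound K_D(3,4)[OF y] by auto
  qed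
  define c where "c k = M + (\<integral>x. G x (y k x) \<partial>lebesgue)" for k
  have E_le: "genergy s p (y k) \<le> c k" for k
    using M[of k] by (simp add: fnl_def c_def)
  have clim: "c \<longlonglongrightarrow> M + (\<integral>x. G x (w x) \<partial>lebesgue)"
    unfolding c_def by (intro tendsto_intros Glim)
  have c_nonneg: "0 \<le> c k" for k using E_le[of k] genergy_nonneg[of s p "y k"] by simp
  have ptw: "(\<lambda>k. ennreal (\<bar>dq (y k) z\<bar> powr p)) \<longlonglongrightarrow> ennreal (\<bar>dq w z\<bar> powr p)" for z
  proof -
    have "(\<lambda>k. dq (y k) z) \<longlonglongrightarrow> dq w z" unfolding dq_def by (intro tendsto_intros lim)
    then have "(\<lambda>k. \<bar>dq (y k) z\<bar> powr p) \<longlonglongrightarrow> \<bar>dq w z\<bar> powr p"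
      by (rule isCont_tendsto_compose[OF DERIV_isCont[OF has_real_derivative_abs_powr[OF p]]])
    then show ?thesis by (rule tendsto_ennrealI)
  qed
  have "(\<integral>\<^sup>+z. ennreal (\<bar>dq w z\<bar> powr p) \<partial>gmeas s p)
      = (\<integral>\<^sup>+z. liminf (\<lambda>k. ennreal (\<bar>dq (y k) z\<bar> powr p)) \<partial>gmeas s p)"
    by (intro nn_integral_cong lim_imp_Liminf[symmetric] ptw) simp
  also have "\<dots> \<le> liminf (\<lambda>k. \<integral>\<^sup>+z. ennreal (\<bar>dq (y k) z\<bar> powr p) \<partial>gmeas s p)"
    by (rule nn_integral_liminf) measurable
  also have "\<dots> = liminf (\<lambda>k. ennreal (genergy s p (y k)))"
    unfolding genergy_def
    by (intro arg_cong[where f = liminf] ext nn_integral_eq_integral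
          frac_sobolev0_energy_integrable[OF K_D(1)[OF y]]) auto
  also have "\<dots> \<le> liminf (\<lambda>k. ennreal (c k))"
    by (intro Liminf_mono always_eventually allI ennreal_leI E_le)
  also have "\<dots> = ennreal (M + (\<integral>x. G x (w x) \<partial>lebesgue))"
    by (intro lim_imp_Liminf tendsto_ennrealI clim) simp
  finally have le: "(\<integral>\<^sup>+z. ennreal (\<bar>dq w z\<bar> powr p) \<partial>gmeas s p) \<le> ennreal (M + (\<integral>x. G x (w x) \<partial>lebesgue))" .
  have wE: "integrable (gmeas s p) (\<lambda>z. \<bar>dq w z\<bar> powr p)"
  proof (rule integrableI_bounded)
    show "(\<integral>\<^sup>+z. ennreal (norm (\<bar>dq w z\<bar> powr p)) \<partial>gmeas s p) < \<infinity>"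
      using le by (simp add: le_less_trans)
  qed measurable
  show "w \<in> K" unfolding K_def frac_sobolev0_iff using w wp wE w0 by auto
  have "ennreal (genergy s p w) \<le> ennreal (M + (\<integral>x. G x (w x) \<partial>lebesgue))"
    using le wE by (subst (asm) nn_integral_eq_integral) (auto simp: genergy_def)
  moreover have "0 \<le> M + (\<integral>x. G x (w x) \<partial>lebesgue)"
    using LIMSEQ_le_const[OF clim] c_nonneg by blast
  ultimately show "fnl w \<le> M" by (simp add: fnl_def)
qed

lemma fnl_submodular:
  assumes v: "v \<in> K" and w: "w \<in> K"
  shows "(\<lambda>x. max (v x) (w x)) \<in> K" "(\<lambda>x. min (v x) (w x)) \<in> K"
    "fnl (\<lambda>x. min (v x) (w x)) + fnl (\<lambda>x. max (v x) (w x)) \<le> fnl v + fnl w"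
proof -
  show mx: "(\<lambda>x. max (v x) (w x)) \<in> K" and mn: "(\<lambda>x. min (v x) (w x)) \<in> K"
    using v w frac_sobolev0_max[OF p, of v s \<Omega> w] frac_sobolev0_min[OF p, of v s \<Omega> w]
    by (auto simp: K_def le_max_iff_disj min_le_iff_disj)
  have "(\<integral>x. G x (min (v x) (w x)) \<partial>lebesgue) + (\<integral>x. G x (max (v x) (w x)) \<partial>lebesgue)
      = (\<integral>x. G x (min (v x) (w x)) + G x (max (v x) (w x)) \<partial>lebesgue)"
    by (intro Bochner_Integration.integral_add[symmetric] integrable_G[OF mn] integrable_G[OF mx])
  also have "\<dots> = (\<integral>x. G x (v x) + G x (w x) \<partial>lebesgue)"
    by (intro Bochner_Integration.integral_cong) (auto simp: min_def max_def)
  also have "\<dots> = (\<integral>x. G x (v x) \<partial>lebesgue) + (\<integral>x. G x (w x) \<partial>lebesgue)"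
    by (intro Bochner_Integration.integral_add integrable_G v w)
  finally show "fnl (\<lambda>x. min (v x) (w x)) + fnl (\<lambda>x. max (v x) (w x)) \<le> fnl v + fnl w"
    using genergy_submodular[OF p K_D(1)[OF v] K_D(1)[OF w]] by (simp add: fnl_def)
qed

text \<open>Submodularity replaces weak compactness: the upper limit of a minimising sequence with
  summable errors is itself a minimiser.\<close>

lemma minimizer_exists: "\<exists>w\<in>K. \<forall>v\<in>K. fnl w \<le> fnl v"
proof -
  define m where "m = (INF v\<in>K. fnl v)"
  have m_le: "m \<le> fnl v" if "v \<in> K" for v
    unfolding m_def by (rule cINF_lower[OF fnl_bdd_below that])
  have "\<exists>v\<in>K. fnl v < m + (1/2) ^ n" for n :: nat
    unfolding m_def using K_nonempty fnl_bdd_below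
    by (subst cINF_less_iff[symmetric]) (auto simp: m_def)
  then obtain v where v: "\<And>n. v n \<in> K" "\<And>n. fnl (v n) < m + (1/2) ^ n" by metis
  \<comment> \<open>\<open>y n k\<close> is the maximum of \<open>v n, ..., v (n + k)\<close>, so
    that its limit in \<open>k\<close> is the supremum of a tail.\<close>
  define y where "y n = rec_nat (v n) (\<lambda>k z x. max (z x) (v (n + Suc k) x))" for n
  have y0: "y n 0 = v n" and ySuc: "y n (Suc k) = (\<lambda>x. max (y n k x) (v (n + Suc k) x))" for n k
    by (simp_all add: y_def)
  \<comment> \<open>Adjoining a further function costs at most its own excess over \<open>m\<close>:
    submodularity applies, and the minimum has value at least \<open>m\<close>. The factor
    \<open>2 - (1/2) ^ k\<close> is the partial geometric sum of these errors.\<close>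
  have yK: "y n k \<in> K" and y_le: "fnl (y n k) \<le> m + (2 - (1/2) ^ k) * (1/2) ^ n" for n k
  proof -
    have "y n k \<in> K \<and> fnl (y n k) \<le> m + (2 - (1/2) ^ k) * (1/2) ^ n"
    proof (induction k)
      case 0
      then show ?case using v(1)[of n] v(2)[of n] by (simp add: y0)
    next
      case (Suc k)
      note sub = fnl_submodular[OF Suc[THEN conjunct1] v(1)[of "n + Suc k"]]
      have "fnl (y n (Suc k)) \<le> fnl (y n k) + fnl (v (n + Suc k)) - m"
        using sub(3) m_le[OF sub(2)] by (simp add: ySuc)
      also have "\<dots> \<le> m + (2 - (1/2) ^ k) * (1/2) ^ n + (1/2) ^ (n + Suc k)"
        using Suc v(2)[of "n + Suc k"] by simp
      also have "\<dots> = m + (2 - (1/2) ^ Suc k) * (1/2) ^ n"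
        by (simp add: power_add algebra_simps)
      finally show ?case using sub(1) by (simp add: ySuc)
    qed
    then show "y n k \<in> K" "fnl (y n k) \<le> m + (2 - (1/2) ^ k) * (1/2) ^ n" by auto
  qed
  have y_inc: "incseq (\<lambda>k. y n k x)" for n x
    by (rule incseq_SucI) (simp add: ySuc)
  have y_conv: "\<exists>l. (\<lambda>k. y n k x) \<longlonglongrightarrow> l" for n x
  proof -
    have "\<forall>k. y n k x \<le> U x" using K_D(4)[OF yK] by blast
    then obtain L where "(\<lambda>k. y n k x) \<longlonglongrightarrow> L" by (rule incseq_convergent[OF y_inc])
    then show ?thesis ..
  qed
  then obtain W where W: "\<And>n x. (\<lambda>k. y n k x) \<longlonglongrightarrow> W n x" by metis
  have y_le2: "fnl (y n k) \<le> m + 2 * (1/2) ^ n" for n k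
  proof -
    have "(2 - (1/2) ^ k) * (1/2) ^ n \<le> 2 * (1/2::real) ^ n" by (intro mult_right_mono) auto
    then show ?thesis using y_le[of n k] by linarith
  qed
  have WK: "W n \<in> K" and W_le: "fnl (W n) \<le> m + 2 * (1/2) ^ n" for n
    using fnl_lower_semicontinuous[of "y n" "W n", OF yK W y_le2] by blast+
  \<comment> \<open>Dropping the first function can only lower the maximum, so the suprema
    \<open>W n\<close> decrease in \<open>n\<close> and their limit is the upper limit of the
    sequence.\<close>
  have y_shift: "y (Suc n) k x \<le> y n (Suc k) x" for n k x
    by (induction k) (auto simp: ySuc y0 intro: max.coboundedI1 max.coboundedI2)
  have W_dec: "W (Suc n) x \<le> W n x" for n x
    by (rule LIMSEQ_le[OF W LIMSEQ_Suc[OF W]]) (use y_shift in auto)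
  have "\<exists>l. (\<lambda>n. W n x) \<longlonglongrightarrow> l" for x
  proof -
    have "decseq (\<lambda>n. W n x)" by (rule decseq_SucI) (rule W_dec)
    moreover have "\<forall>n. 0 \<le> W n x" using K_D(3)[OF WK] by blast
    ultimately obtain L where "(\<lambda>n. W n x) \<longlonglongrightarrow> L" by (rule decseq_convergent)
    then show ?thesis ..
  qed
  then obtain w where w: "\<And>x. (\<lambda>n. W n x) \<longlonglongrightarrow> w x" by metis
  have bound: "w \<in> K" "fnl w \<le> m + 2 * (1/2) ^ n" for n
  proof -
    have "fnl (W (k + n)) \<le> m + 2 * (1/2) ^ n" for k
    proof -
      have "(1/2::real) ^ (k + n) \<le> (1/2) ^ n" by (rule power_decreasing) auto
      then show ?thesis using W_le[of "k + n"] by linarith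
    qed
    from fnl_lower_semicontinuous[of "\<lambda>k. W (k + n)" w, OF WK LIMSEQ_ignore_initial_segment[OF w] this]
    show "w \<in> K" "fnl w \<le> m + 2 * (1/2) ^ n" by auto
  qed
  have "fnl w \<le> m"
  proof (rule LIMSEQ_le_const)
    show "(\<lambda>n. m + 2 * (1/2) ^ n) \<longlonglongrightarrow> m"
      by (auto intro!: tendsto_eq_intros)
  qed (use bound in auto)
  then show ?thesis using bound(1) m_le by (intro bexI[of _ w]) (auto intro: order_trans)
qed

end

section \<open>First variation of the functional\<close>

lemma DERIV_0_sequence:
  fixes h :: "real \<Rightarrow> real"
  assumes "DERIV h 0 :> D"
  shows "(\<lambda>n. (h (1 / real (Suc n)) - h 0) * real (Suc n)) \<longlonglongrightarrow> D"
proof -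
  have "((\<lambda>t. (h t - h 0) / (t - 0)) \<longlongrightarrow> D) (at 0)"
    using assms by (simp add: has_field_derivative_iff)
  moreover have "filterlim (\<lambda>n. 1 / real (Suc n)) (at 0) sequentially"
    using LIMSEQ_inverse_real_of_nat
    by (auto simp: filterlim_at inverse_eq_divide intro!: always_eventually)
  ultimately have "(\<lambda>n. (h (1 / real (Suc n)) - h 0) / (1 / real (Suc n) - 0)) \<longlonglongrightarrow> D"
    by (rule filterlim_compose)
  then show ?thesis by simp
qed

text \<open>A majorant for the difference quotients that is uniform in \<open>t\<close>. From below
  the quotient is bounded by the tangent at \<open>a\<close>, from above by the chord from
  \<open>a\<close> to \<open>a + d\<close>.\<close>

lemma abs_powr_quotient_bound:
  fixes a d t :: real
  assumes p: "p > 1" and t: "0 < t" "t \<le> 1"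
  shows "\<bar>(\<bar>a + t * d\<bar> powr p - \<bar>a\<bar> powr p) / t\<bar>
     \<le> p * \<bar>jp p a * d\<bar> + (\<bar>a + d\<bar> powr p + \<bar>a\<bar> powr p)"
proof -
  let ?c = "a + t * d"
  have quot: "q \<le> (X - A) / t" if "A + p * j * (a + t * d - a) \<le> X" "q = p * (j * d)"
    for X A j q :: real
    using that t by (simp add: field_simps)
  have lower: "p * (jp p a * d) \<le> (\<bar>?c\<bar> powr p - \<bar>a\<bar> powr p) / t"
    by (rule quot[OF abs_powr_tangent[OF p, of a ?c] refl])
  \<comment> \<open>The chord bound: tangents at the intermediate point, evaluated at both ends with
    weights \<open>1 - t\<close> and \<open>t\<close>; their slope terms cancel in the sum.\<close>
  have 1: "(1 - t) * (\<bar>?c\<bar> powr p + p * jp p ?c * (a - ?c)) \<le> (1 - t) * \<bar>a\<bar> powr p"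
    using abs_powr_tangent[OF p, of ?c a] t by (intro mult_left_mono) auto
  have 2: "t * (\<bar>?c\<bar> powr p + p * jp p ?c * (a + d - ?c)) \<le> t * \<bar>a + d\<bar> powr p"
    using abs_powr_tangent[OF p, of ?c "a + d"] t by (intro mult_left_mono) auto
  have convex: "X = (1 - t) * (X + q * (a - (a + t * d))) + t * (X + q * (a + d - (a + t * d)))"
    for X q :: real by algebra
  have quot2: "(X - A) / t \<le> D - A" if "X \<le> (1 - t) * A + t * D" for X A D :: real
    using that t by (simp add: field_simps)
  have "(\<bar>?c\<bar> powr p - \<bar>a\<bar> powr p) / t \<le> \<bar>a + d\<bar> powr p - \<bar>a\<bar> powr p"
    by (rule quot2) (subst convex[where q = "p * jp p ?c"], rule add_mono[OF 1 2])
  moreover have "- (p * \<bar>jp p a * d\<bar>) \<le> p * (jp p a * d)"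
    using p mult_left_mono[of "- \<bar>jp p a * d\<bar>" "jp p a * d" p] by simp
  moreover have "0 \<le> p * \<bar>jp p a * d\<bar>" "0 \<le> \<bar>a + d\<bar> powr p" "0 \<le> \<bar>a\<bar> powr p" using p by auto
  ultimately show ?thesis using lower unfolding abs_le_iff by linarith
qed

text \<open>Along \<open>t = 1 / (n + 1)\<close> minimality orders the difference quotients of
  energy and potential, and dominated convergence passes to the derivatives. The inequality for
  \<open>v\<close> and for \<open>- v\<close> gives the equation for test functions of any
  sign.\<close>

lemma euler_lagrange:
  fixes w :: "'a::euclidean_space \<Rightarrow> real"
  assumes p: "p > 1" and w: "w \<in> frac_sobolev0 s p \<Omega>" and v: "v \<in> frac_sobolev0 s p \<Omega>"
    and G_int: "\<And>v. v \<in> frac_sobolev0 s p \<Omega> \<Longrightarrow> integrable lebesgue (\<lambda>x. G x (v x))"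
    and G_deriv: "\<And>x t. DERIV (G x) t :> k x t"
    and G_lip: "\<And>x a b. \<bar>G x a - G x b\<bar> \<le> B x * \<bar>a - b\<bar>"
    and B_int: "\<And>v. v \<in> frac_sobolev0 s p \<Omega> \<Longrightarrow> integrable lebesgue (\<lambda>x. B x * \<bar>v x\<bar>)"
    and k_meas: "(\<lambda>x. k x (w x)) \<in> borel_measurable lebesgue"
    and min: "\<And>v. v \<in> frac_sobolev0 s p \<Omega> \<Longrightarrow>
       genergy s p w - (\<integral>x. G x (w x) \<partial>lebesgue) \<le> genergy s p v - (\<integral>x. G x (v x) \<partial>lebesgue)"
  shows "p * frac_p_laplacian s p w v = (\<integral>x. k x (w x) * v x \<partial>lebesgue)"
proof -
  have ge: "(\<integral>x. k x (w x) * v x \<partial>lebesgue) \<le> p * (\<integral>z. jp p (dq w z) * dq v z \<partial>gmeas s p)"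
    if v: "v \<in> frac_sobolev0 s p \<Omega>" for v
  proof -
    note [measurable] = w[THEN frac_sobolev0_measurable] v[THEN frac_sobolev0_measurable]
    note [simp] = frac_sobolev0_energy_integrable[OF w]
    define t where "t n = 1 / real (Suc n)" for n
    have t: "0 < t n" "t n \<le> 1" for n by (auto simp: t_def)
    have wv: "(\<lambda>x. w x + c * v x) \<in> frac_sobolev0 s p \<Omega>" for c
      by (rule frac_sobolev0_add_scaled[OF p w v])
    have dq_wv: "dq (\<lambda>x. w x + c * v x) z = dq w z + c * dq v z" for c z
      by (simp add: dq_def algebra_simps)
    note wv_int = frac_sobolev0_energy_integrable[OF wv, unfolded dq_wv]
    define X where "X n z = (\<bar>dq w z + t n * dq v z\<bar> powr p - \<bar>dq w z\<bar> powr p) / t n" for n z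
    define Y where "Y n x = (G x (w x + t n * v x) - G x (w x)) / t n" for n x
    have X_int: "(\<integral>z. X n z \<partial>gmeas s p) = (genergy s p (\<lambda>x. w x + t n * v x) - genergy s p w) / t n" for n
      using wv_int[of "t n"] by (simp add: X_def genergy_def dq_wv)
    have Y_int: "(\<integral>x. Y n x \<partial>lebesgue)
        = ((\<integral>x. G x (w x + t n * v x) \<partial>lebesgue) - (\<integral>x. G x (w x) \<partial>lebesgue)) / t n" for n
      using G_int[OF w] G_int[OF wv[of "t n"]] by (simp add: Y_def)
    have XY: "(\<integral>x. Y n x \<partial>lebesgue) \<le> (\<integral>z. X n z \<partial>gmeas s p)" for n
      unfolding X_int Y_int using min[OF wv[of "t n"]] t[of n]
      by (intro divide_right_mono) auto
    have X_lim: "(\<lambda>n. \<integral>z. X n z \<partial>gmeas s p) \<longlonglongrightarrow> (\<integral>z. p * (jp p (dq w z) * dq v z) \<partial>gmeas s p)"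
    proof (rule integral_dominated_convergence[where
          w = "\<lambda>z. p * \<bar>jp p (dq w z) * dq v z\<bar> + (\<bar>dq w z + 1 * dq v z\<bar> powr p + \<bar>dq w z\<bar> powr p)"])
      show "integrable (gmeas s p) (\<lambda>z. p * \<bar>jp p (dq w z) * dq v z\<bar>
          + (\<bar>dq w z + 1 * dq v z\<bar> powr p + \<bar>dq w z\<bar> powr p))"
        using integrable_jp_dq[OF p w v] wv_int[of 1]
        by (intro Bochner_Integration.integrable_add integrable_mult_right integrable_abs) auto
      show "AE z in gmeas s p. norm (X n z) \<le> p * \<bar>jp p (dq w z) * dq v z\<bar>
          + (\<bar>dq w z + 1 * dq v z\<bar> powr p + \<bar>dq w z\<bar> powr p)" for n
        using abs_powr_quotient_bound[OF p t[of n]] by (auto simp: X_def)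
      show "AE z in gmeas s p. (\<lambda>n. X n z) \<longlonglongrightarrow> p * (jp p (dq w z) * dq v z)"
      proof (rule AE_I2)
        fix z
        have "DERIV (\<lambda>t. \<bar>dq w z + t * dq v z\<bar> powr p) 0 :> (p * jp p (dq w z + 0 * dq v z)) * dq v z"
          by (rule DERIV_chain2[OF has_real_derivative_abs_powr[OF p]])
             (auto intro!: derivative_eq_intros)
        from DERIV_0_sequence[OF this] show "(\<lambda>n. X n z) \<longlonglongrightarrow> p * (jp p (dq w z) * dq v z)"
          by (simp add: X_def t_def mult_ac)
      qed
      show "X n \<in> borel_measurable (gmeas s p)" for n
        unfolding X_def by measurable
    qed measurable
    have Y_lim: "(\<lambda>n. \<integral>x. Y n x \<partial>lebesgue) \<longlonglongrightarrow> (\<integral>x. k x (w x) * v x \<partial>lebesgue)"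
    proof (rule integral_dominated_convergence[OF _ _ B_int[OF v]])
      show "AE x in lebesgue. norm (Y n x) \<le> B x * \<bar>v x\<bar>" for n
      proof (rule AE_I2)
        fix x
        have "\<bar>Y n x\<bar> \<le> B x * \<bar>t n * v x\<bar> / t n"
          using G_lip[of x "w x + t n * v x" "w x"] t[of n]
          by (simp add: Y_def divide_right_mono)
        then show "norm (Y n x) \<le> B x * \<bar>v x\<bar>" using t[of n] by (simp add: abs_mult)
      qed
      show "AE x in lebesgue. (\<lambda>n. Y n x) \<longlonglongrightarrow> k x (w x) * v x"
      proof (rule AE_I2)
        fix x
        have "DERIV (\<lambda>t. G x (w x + t * v x)) 0 :> k x (w x + 0 * v x) * v x"
          by (rule DERIV_chain2[OF G_deriv]) (auto intro!: derivative_eq_intros)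
        from DERIV_0_sequence[OF this] show "(\<lambda>n. Y n x) \<longlonglongrightarrow> k x (w x) * v x"
          by (simp add: Y_def t_def mult_ac)
      qed
      show "(\<lambda>x. k x (w x) * v x) \<in> borel_measurable lebesgue" using k_meas by measurable
      show "Y n \<in> borel_measurable lebesgue" for n
        unfolding Y_def using G_int[OF w] G_int[OF wv[of "t n"]] by simp
    qed
    have "(\<integral>x. k x (w x) * v x \<partial>lebesgue) \<le> (\<integral>z. p * (jp p (dq w z) * dq v z) \<partial>gmeas s p)"
      by (rule LIMSEQ_le[OF Y_lim X_lim]) (use XY in auto)
    then show ?thesis by simp
  qed
  \<comment> \<open>The negative is reached as \<open>v + (-2) * v\<close> by the closure under
    scaled sums.\<close>
  have "(\<lambda>x. 0 + (-1) * v x) \<in> frac_sobolev0 s p \<Omega>"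
    using frac_sobolev0_add_scaled[OF p v v, of "-2"] by simp
  then have mv: "(\<lambda>x. - v x) \<in> frac_sobolev0 s p \<Omega>" by simp
  have "dq (\<lambda>x. - v x) z = - dq v z" for z by (simp add: dq_def)
  with ge[OF mv] have "p * (\<integral>z. jp p (dq w z) * dq v z \<partial>gmeas s p) \<le> (\<integral>x. k x (w x) * v x \<partial>lebesgue)"
    by simp
  with ge[OF v] show ?thesis by (simp add: frac_p_laplacian_eq0[OF w v])
qed

section \<open>Concave images of solutions\<close>

text \<open>For each argument one of the two integrals defining \<open>F\<close> runs over an empty
  or degenerate interval, which covers both signs by one formula.\<close>

lemma monotone_primitive:
  fixes h :: "real \<Rightarrow> real"
  assumes cont: "continuous_on UNIV h" and mono: "mono h"
  obtains F where "F 0 = 0"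
    "\<And>t t'. t \<le> t' \<Longrightarrow> h t * (t' - t) \<le> F t' - F t"
    "\<And>t t'. t \<le> t' \<Longrightarrow> F t' - F t \<le> h t' * (t' - t)"
proof -
  define F where "F t = integral {0..t} h - integral {t..0} h" for t
  have int: "h integrable_on {a..b}" for a b
    by (intro integrable_continuous_real continuous_on_subset[OF cont]) auto
  have diff: "F t' - F t = integral {t..t'} h" if "t \<le> t'" for t t'
  proof -
    consider "0 \<le> t" | "t \<le> 0" "0 \<le> t'" | "t' \<le> 0" by linarith
    then show ?thesis
    proof cases
      case 1
      then have "integral {0..t} h + integral {t..t'} h = integral {0..t'} h"
        by (intro Henstock_Kurzweil_Integration.integral_combine int that)
      moreover have "integral {t..0} h = 0" "integral {t'..0} h = 0"
        using 1 that by (cases "t = 0"; cases "t' = 0"; simp)+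
      ultimately show ?thesis by (simp add: F_def)
    next
      case 2
      then have "integral {t..0} h + integral {0..t'} h = integral {t..t'} h"
        by (intro Henstock_Kurzweil_Integration.integral_combine int)
      moreover have "integral {0..t} h = 0" "integral {t'..0} h = 0"
        using 2 by (cases "t = 0"; cases "t' = 0"; simp)+
      ultimately show ?thesis by (simp add: F_def)
    next
      case 3
      then have "integral {t..t'} h + integral {t'..0} h = integral {t..0} h"
        by (intro Henstock_Kurzweil_Integration.integral_combine int that)
      moreover have "integral {0..t} h = 0" "integral {0..t'} h = 0"
        using 3 that by (cases "t = 0"; cases "t' = 0"; simp)+
      ultimately show ?thesis by (simp add: F_def)
    qed
  qed
  show thesis
  proof (rule that[of F])
    show "F 0 = 0" by (simp add: F_def)
    fix t t' :: real assume t: "t \<le> t'"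
    have "integral {t..t'} (\<lambda>_. h t) \<le> integral {t..t'} h"
      by (intro integral_le int) (auto intro: monoD[OF mono])
    then show "h t * (t' - t) \<le> F t' - F t" using t by (simp add: diff mult.commute)
    have "integral {t..t'} h \<le> integral {t..t'} (\<lambda>_. h t')"
      by (intro integral_le int) (auto intro: monoD[OF mono])
    then show "F t' - F t \<le> h t' * (t' - t)" using t by (simp add: diff mult.commute)
  qed
qed

text \<open>The two increment bounds squeeze the difference quotient between \<open>k y\<close> and
  \<open>k t\<close>.\<close>

lemma DERIV_sandwich:
  fixes G k :: "real \<Rightarrow> real"
  assumes cont: "isCont k t"
    and lower: "\<And>a b. a \<le> b \<Longrightarrow> k a * (b - a) \<le> G b - G a"
    and upper: "\<And>a b. a \<le> b \<Longrightarrow> G b - G a \<le> k b * (b - a)"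
  shows "DERIV G t :> k t"
  unfolding has_field_derivative_iff
proof (rule LIM_zero_cancel, rule Lim_null_comparison)
  show "((\<lambda>y. \<bar>k y - k t\<bar>) \<longlongrightarrow> 0) (at t)"
    using tendsto_rabs[OF LIM_zero[OF cont[unfolded isCont_def]]] by simp
  have "\<bar>(G y - G t) / (y - t) - k t\<bar> \<le> \<bar>k y - k t\<bar>" if "y \<noteq> t" for y
  proof (cases "t < y")
    case True
    then have "k t \<le> (G y - G t) / (y - t)" "(G y - G t) / (y - t) \<le> k y"
      using lower[of t y] upper[of t y] by (auto simp: pos_le_divide_eq pos_divide_le_eq)
    then show ?thesis by linarith
  next
    case False
    then have y: "y < t" using that by simp
    have "(G y - G t) / (y - t) = (G t - G y) / (t - y)"
      by (metis minus_diff_eq minus_divide_divide)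
    moreover have "k y \<le> (G t - G y) / (t - y)" "(G t - G y) / (t - y) \<le> k t"
      using lower[of y t] upper[of y t] y by (auto simp: pos_le_divide_eq pos_divide_le_eq)
    ultimately show ?thesis by linarith
  qed
  then show "\<forall>\<^sub>F y in at t. norm ((G y - G t) / (y - t) - k t) \<le> \<bar>k y - k t\<bar>"
    by (auto simp: eventually_at_filter)
qed

text \<open>Freezing the nonlinearity above \<open>b\<close> makes its primitive Lipschitz with
  constant \<open>h b\<close>. The truncation level will vary with the point, hence the
  measurability clause with \<open>\<beta>\<close>.\<close>

lemma truncated_primitive:
  fixes h :: "real \<Rightarrow> real"
  assumes cont: "continuous_on UNIV h" and mono: "mono h" and pos: "\<And>t. 0 < h t"
  obtains G :: "real \<Rightarrow> real \<Rightarrow> real" where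
    "\<And>b. 0 \<le> b \<Longrightarrow> G b 0 = 0"
    "\<And>b t. DERIV (G b) t :> h (min b t)"
    "\<And>b a c. a \<le> c \<Longrightarrow> G b a \<le> G b c"
    "\<And>b a c. \<bar>G b a - G b c\<bar> \<le> h b * \<bar>a - c\<bar>"
    "\<And>M \<beta> v. \<beta> \<in> borel_measurable M \<Longrightarrow> v \<in> borel_measurable M \<Longrightarrow>
       (\<lambda>x. G (\<beta> x) (v x)) \<in> borel_measurable (M :: 'b measure)"
proof -
  obtain F where F0: "F 0 = 0"
    and Fl: "\<And>t t'. t \<le> t' \<Longrightarrow> h t * (t' - t) \<le> F t' - F t"
    and Fu: "\<And>t t'. t \<le> t' \<Longrightarrow> F t' - F t \<le> h t' * (t' - t)"
    using monotone_primitive[OF cont mono] by metis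
  have F_mono: "F a \<le> F c" if "a \<le> c" for a c
  proof -
    have "0 \<le> h a * (c - a)" using that pos[of a] by simp
    then show ?thesis using Fl[OF that] by linarith
  qed
  have [measurable]: "F \<in> borel_measurable borel" "h \<in> borel_measurable borel"
    using F_mono mono by (auto intro!: borel_measurable_mono monoI)
  \<comment> \<open>The primitive continues affinely beyond \<open>b\<close>; writing all levels
    through the single function \<open>F\<close> makes measurability in both arguments
    immediate.\<close>
  define G where "G b t = F (min b t) + h b * max 0 (t - b)" for b t
  have lower: "h (min b a) * (c - a) \<le> G b c - G b a"
    and upper: "G b c - G b a \<le> h (min b c) * (c - a)" if "a \<le> c" for a b c
  proof -
    have "h (min b a) * (c - a) \<le> G b c - G b a \<and> G b c - G b a \<le> h (min b c) * (c - a)"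
    proof -
      consider "c \<le> b" | "b \<le> a" | "a \<le> b" "b \<le> c" by linarith
      then show ?thesis
      proof cases
        case 1
        then show ?thesis using that Fl[OF that] Fu[OF that] by (simp add: G_def min_def)
      next
        case 2
        then show ?thesis using that by (auto simp: G_def min_def max_def algebra_simps)
      next
        case 3
        have "h a * (c - b) \<le> h b * (c - b)"
          using 3 monoD[OF mono, of a b] by (intro mult_right_mono) auto
        then show ?thesis using 3 Fl[OF 3(1)] Fu[OF 3(1)]
          by (auto simp: G_def min_def max_def algebra_simps)
      qed
    qed
    then show "h (min b a) * (c - a) \<le> G b c - G b a" "G b c - G b a \<le> h (min b c) * (c - a)"
      by auto
  qed
  have G_mono: "G b a \<le> G b c" if "a \<le> c" for a b c
  proof -
    have "0 \<le> h (min b a) * (c - a)" using that pos[of "min b a"] by simp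
    then show ?thesis using lower[OF that, of b] by linarith
  qed
  have lip: "\<bar>G b c - G b a\<bar> \<le> h b * \<bar>c - a\<bar>" if "a \<le> c" for a b c
  proof -
    have "h (min b c) * (c - a) \<le> h b * (c - a)"
      using that by (intro mult_right_mono monoD[OF mono]) auto
    then show ?thesis using that upper[OF that, of b] G_mono[OF that, of b] by simp
  qed
  show thesis
  proof (rule that[of G])
    show "G b 0 = 0" if "0 \<le> b" for b using that F0 by (simp add: G_def)
    have "continuous_on UNIV (\<lambda>t. h (min b t))" for b
      by (intro continuous_on_compose2[OF cont] continuous_on_min continuous_on_const
            continuous_on_id) auto
    then have "isCont (\<lambda>t. h (min b t)) t" for b t
      by (simp add: continuous_on_eq_continuous_at)
    then show "DERIV (G b) t :> h (min b t)" for b t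
      by (rule DERIV_sandwich[where k = "\<lambda>t. h (min b t)"]) (rule lower upper, assumption)+
    show "\<bar>G b a - G b c\<bar> \<le> h b * \<bar>a - c\<bar>" for b a c
    proof (cases "a \<le> c")
      case True
      then show ?thesis using lip[of a c b] by (simp add: abs_minus_commute)
    next
      case False
      then show ?thesis using lip[of c a b] by simp
    qed
    show "(\<lambda>x. G (\<beta> x) (v x)) \<in> borel_measurable M"
      if [measurable]: "\<beta> \<in> borel_measurable M" "v \<in> borel_measurable M"
      for M :: "'b measure" and \<beta> v
      unfolding G_def by measurable
  qed (rule G_mono)
qed

text \<open>A nonlocal Kato inequality. For \<open>a \<ge> b\<close> the lower increment bound is
  weighted with the test value at \<open>a\<close> and the upper one with the test value at
  \<open>b\<close>; the inequality thus holds pair by pair. Boundedness of \<open>v\<close> and the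
  Lipschitz condition make the product with the power of \<open>\<phi>\<close> an admissible test
  function.\<close>

lemma concave_comparison:
  fixes u v :: "'a::euclidean_space \<Rightarrow> real" and \<Phi> \<phi> :: "real \<Rightarrow> real"
  assumes p: "p > 1" and u: "u \<in> frac_sobolev0 s p \<Omega>" and u0: "\<And>x. 0 \<le> u x"
    and v: "v \<in> frac_sobolev0 s p \<Omega>" "\<And>x. 0 \<le> v x" "\<And>x. v x \<le> 1"
    and \<Phi>0: "\<Phi> 0 = 0" and \<phi>: "\<And>t. 0 \<le> t \<Longrightarrow> 0 < \<phi> t" "\<And>t. 0 \<le> t \<Longrightarrow> \<phi> t \<le> 1"
    and lower: "\<And>a b. 0 \<le> b \<Longrightarrow> b \<le> a \<Longrightarrow> \<phi> a * (a - b) \<le> \<Phi> a - \<Phi> b"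
    and upper: "\<And>a b. 0 \<le> b \<Longrightarrow> b \<le> a \<Longrightarrow> \<Phi> a - \<Phi> b \<le> \<phi> b * (a - b)"
    and lip: "\<And>a b. 0 \<le> a \<Longrightarrow> 0 \<le> b \<Longrightarrow>
       \<bar>\<phi> a powr (p - 1) - \<phi> b powr (p - 1)\<bar> \<le> L * \<bar>a - b\<bar>"
  shows "(\<lambda>x. \<Phi> (u x)) \<in> frac_sobolev0 s p \<Omega>"
    "(\<lambda>x. \<phi> (u x) powr (p - 1) * v x) \<in> frac_sobolev0 s p \<Omega>"
    "frac_p_laplacian s p u (\<lambda>x. \<phi> (u x) powr (p - 1) * v x)
       \<le> frac_p_laplacian s p (\<lambda>x. \<Phi> (u x)) v"
proof -
  note [measurable] = u[THEN frac_sobolev0_measurable] v(1)[THEN frac_sobolev0_measurable]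
  have \<Phi>_diff: "0 \<le> \<Phi> a - \<Phi> b" "\<Phi> a - \<Phi> b \<le> a - b" if "0 \<le> b" "b \<le> a" for a b
  proof -
    have "0 \<le> \<phi> a * (a - b)" using that \<phi>(1)[of a] by simp
    then show "0 \<le> \<Phi> a - \<Phi> b" using lower[OF that] by linarith
    have "\<phi> b * (a - b) \<le> 1 * (a - b)" using that \<phi>(2)[of b] by (intro mult_right_mono) auto
    then show "\<Phi> a - \<Phi> b \<le> a - b" using upper[OF that] by simp
  qed
  have \<Phi>_lip: "\<bar>\<Phi> (max 0 a) - \<Phi> (max 0 b)\<bar> \<le> 1 * \<bar>a - b\<bar>" for a b
  proof -
    have *: "0 \<le> \<Phi> (max 0 d) - \<Phi> (max 0 c) \<and> \<Phi> (max 0 d) - \<Phi> (max 0 c) \<le> d - c"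
      if "c \<le> d" for c d
    proof -
      have "max 0 c \<le> max 0 d" "max 0 d - max 0 c \<le> d - c" using that by auto
      then show ?thesis using \<Phi>_diff[of "max 0 c" "max 0 d"] by linarith
    qed
    show ?thesis using *[of a b] *[of b a] by (cases "a \<le> b") auto
  qed
  have "(\<lambda>x. \<Phi> (max 0 (u x))) \<in> frac_sobolev0 s p \<Omega>"
    by (rule frac_sobolev0_lipschitz_image[OF p u _ \<Phi>_lip]) (simp add: \<Phi>0)
  then show \<Phi>u: "(\<lambda>x. \<Phi> (u x)) \<in> frac_sobolev0 s p \<Omega>" by (simp add: u0)
  \<comment> \<open>Extension by a constant to negative arguments turns the Lipschitz condition on
    the half-line into a global one.\<close>
  define \<psi> where "\<psi> t = \<phi> (max 0 t) powr (p - 1)" for t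
  define M where "M = max L 0"
  have M: "M \<ge> 0" by (simp add: M_def)
  have \<psi>_lip: "\<bar>\<psi> a - \<psi> b\<bar> \<le> M * \<bar>a - b\<bar>" for a b
  proof -
    have "\<bar>\<psi> a - \<psi> b\<bar> \<le> L * \<bar>max 0 a - max 0 b\<bar>" unfolding \<psi>_def by (rule lip) auto
    also have "\<dots> \<le> M * \<bar>a - b\<bar>" by (intro mult_mono) (auto simp: M_def)
    finally show ?thesis .
  qed
  have \<psi>01: "0 \<le> \<psi> t" "\<psi> t \<le> 1" for t
    using \<phi>[of "max 0 t"] p by (auto simp: \<psi>_def powr_le1)
  have "M-lipschitz_on UNIV \<psi>"
    using M \<psi>_lip by (auto simp: lipschitz_on_def dist_real_def)
  then have [measurable]: "\<psi> \<in> borel_measurable borel"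
    by (intro borel_measurable_continuous_onI lipschitz_on_continuous_on)
  have eq: "\<phi> (u x) powr (p - 1) * v x = \<psi> (u x) * v x" for x by (simp add: \<psi>_def u0)
  have "(\<lambda>x. \<psi> (u x) * v x) \<in> frac_sobolev0 s p \<Omega>"
  proof (rule frac_sobolev0_dominated[OF p u v(1), where C = "M + 1"])
    show "\<bar>\<psi> (u x) * v x\<bar> \<le> (M + 1) * (\<bar>u x\<bar> + \<bar>v x\<bar>)" for x
    proof -
      have "\<bar>\<psi> (u x) * v x\<bar> \<le> \<bar>v x\<bar>"
        using \<psi>01[of "u x"] by (simp add: abs_mult mult_left_le_one_le)
      also have "\<dots> \<le> (M + 1) * (\<bar>u x\<bar> + \<bar>v x\<bar>)" using M by (simp add: algebra_simps)
      finally show ?thesis .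
    qed
    show "\<bar>\<psi> (u x) * v x - \<psi> (u y) * v y\<bar> \<le> (M + 1) * (\<bar>u x - u y\<bar> + \<bar>v x - v y\<bar>)" for x y
    proof -
      have "\<psi> (u x) * v x - \<psi> (u y) * v y = \<psi> (u x) * (v x - v y) + v y * (\<psi> (u x) - \<psi> (u y))"
        by (simp add: algebra_simps)
      then have "\<bar>\<psi> (u x) * v x - \<psi> (u y) * v y\<bar>
          \<le> \<bar>\<psi> (u x)\<bar> * \<bar>v x - v y\<bar> + \<bar>v y\<bar> * \<bar>\<psi> (u x) - \<psi> (u y)\<bar>"
        by (metis abs_mult abs_triangle_ineq)
      also have "\<dots> \<le> 1 * \<bar>v x - v y\<bar> + 1 * (M * \<bar>u x - u y\<bar>)"
        using \<psi>01[of "u x"] v(2,3)[of y] by (intro add_mono mult_mono \<psi>_lip) auto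
      also have "\<dots> \<le> (M + 1) * (\<bar>u x - u y\<bar> + \<bar>v x - v y\<bar>)"
        using M by (simp add: algebra_simps)
      finally show ?thesis .
    qed
  qed (use M in \<open>measurable, simp\<close>)
  then show \<psi>v: "(\<lambda>x. \<phi> (u x) powr (p - 1) * v x) \<in> frac_sobolev0 s p \<Omega>" by (simp add: eq)
  have ptw: "jp p (a - b) * (\<phi> a powr (p - 1) * c - \<phi> b powr (p - 1) * d) \<le> jp p (\<Phi> a - \<Phi> b) * (c - d)"
    if ab: "0 \<le> b" "b \<le> a" and cd: "0 \<le> c" "0 \<le> d" for a b c d
  proof -
    have scale: "(r * (a - b)) powr (p - 1) = jp p (a - b) * r powr (p - 1)" if "0 < r" for r
      using that ab by (simp add: jp_of_nonneg powr_mult)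
    have 1: "jp p (a - b) * \<phi> a powr (p - 1) \<le> jp p (\<Phi> a - \<Phi> b)"
      using jp_mono[OF p lower[OF ab]] ab \<phi>(1)[of a] scale[of "\<phi> a"] by (simp add: jp_of_nonneg)
    have 2: "jp p (\<Phi> a - \<Phi> b) \<le> jp p (a - b) * \<phi> b powr (p - 1)"
      using jp_mono[OF p upper[OF ab]] ab \<phi>(1)[of b] scale[of "\<phi> b"] by (simp add: jp_of_nonneg)
    show ?thesis
      using mult_right_mono[OF 1 cd(1)] mult_right_mono[OF 2 cd(2)] by (simp add: algebra_simps)
  qed
  have "(\<integral>z. jp p (dq u z) * dq (\<lambda>x. \<phi> (u x) powr (p - 1) * v x) z \<partial>gmeas s p)
      \<le> (\<integral>z. jp p (dq (\<lambda>x. \<Phi> (u x)) z) * dq v z \<partial>gmeas s p)"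
  proof (intro integral_mono integrable_jp_dq[OF p u \<psi>v] integrable_jp_dq[OF p \<Phi>u v(1)])
    fix z :: "'a \<times> 'a"
    obtain x y where z: "z = (x, y)" by (cases z)
    show "jp p (dq u z) * dq (\<lambda>x. \<phi> (u x) powr (p - 1) * v x) z
        \<le> jp p (dq (\<lambda>x. \<Phi> (u x)) z) * dq v z"
    proof (cases "u y \<le> u x")
      case True
      then show ?thesis using ptw[OF u0 True v(2) v(2), of x y] by (simp add: z dq_def)
    next
      case False
      then have le: "u x \<le> u y" by simp
      have "jp p (u x - u y) = - jp p (u y - u x)" "jp p (\<Phi> (u x) - \<Phi> (u y)) = - jp p (\<Phi> (u y) - \<Phi> (u x))"
        using jp_minus[of p "u y - u x"] jp_minus[of p "\<Phi> (u y) - \<Phi> (u x)"] by auto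
      then show ?thesis using ptw[OF u0 le v(2) v(2), of y x]
        by (simp add: z dq_def algebra_simps)
    qed
  qed
  then show "frac_p_laplacian s p u (\<lambda>x. \<phi> (u x) powr (p - 1) * v x)
       \<le> frac_p_laplacian s p (\<lambda>x. \<Phi> (u x)) v"
    by (simp add: frac_p_laplacian_eq0[OF u \<psi>v] frac_p_laplacian_eq0[OF \<Phi>u v(1)])
qed

text \<open>Affine continuation beyond \<open>k\<close> with slope \<open>\<phi> k\<close> preserves
  both bounds. For \<open>b \<le> k \<le> a\<close> the increment is split at \<open>k\<close>, and
  \<open>\<phi> k \<le> \<phi> b\<close> follows from the bounds themselves.\<close>

lemma concave_cutoff:
  fixes \<Phi> \<phi> :: "real \<Rightarrow> real"
  assumes k: "0 \<le> k"
    and lower: "\<And>a b. 0 \<le> b \<Longrightarrow> b \<le> a \<Longrightarrow> \<phi> a * (a - b) \<le> \<Phi> a - \<Phi> b"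
    and upper: "\<And>a b. 0 \<le> b \<Longrightarrow> b \<le> a \<Longrightarrow> \<Phi> a - \<Phi> b \<le> \<phi> b * (a - b)"
  defines "\<Phi>k \<equiv> \<lambda>t. \<Phi> (min t k) + \<phi> k * max 0 (t - k)"
  assumes ab: "0 \<le> b" "b \<le> a"
  shows "\<phi> (min a k) * (a - b) \<le> \<Phi>k a - \<Phi>k b" "\<Phi>k a - \<Phi>k b \<le> \<phi> (min b k) * (a - b)"
proof -
  have "\<phi> (min a k) * (a - b) \<le> \<Phi>k a - \<Phi>k b \<and> \<Phi>k a - \<Phi>k b \<le> \<phi> (min b k) * (a - b)"
  proof -
    consider "a \<le> k" | "k \<le> b" | "b \<le> k" "k \<le> a" by linarith
    then show ?thesis
    proof cases
      case 1
      then show ?thesis using lower[OF ab] upper[OF ab] ab by (simp add: \<Phi>k_def)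
    next
      case 2
      then show ?thesis using ab by (simp add: \<Phi>k_def min_absorb2 max_absorb2 algebra_simps)
    next
      case 3
      have "\<phi> k * (a - k) \<le> \<phi> b * (a - k)"
      proof (cases "b = k")
        case False
        have "\<phi> k * (k - b) \<le> \<phi> b * (k - b)" using lower[OF ab(1) 3(1)] upper[OF ab(1) 3(1)] by linarith
        then have "\<phi> k \<le> \<phi> b" using False 3 by simp
        then show ?thesis using 3 by (intro mult_right_mono) auto
      qed simp
      then show ?thesis using lower[OF ab(1) 3(1)] upper[OF ab(1) 3(1)] 3
        by (auto simp: \<Phi>k_def min_def max_def algebra_simps)
    qed
  qed
  then show "\<phi> (min a k) * (a - b) \<le> \<Phi>k a - \<Phi>k b" "\<Phi>k a - \<Phi>k b \<le> \<phi> (min b k) * (a - b)"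
    by auto
qed

lemma genergy_mono:
  assumes "u \<in> frac_sobolev0 s p \<Omega>" "v \<in> frac_sobolev0 s p \<Omega>" "p > 1"
    and "\<And>x y. \<bar>u x - u y\<bar> \<le> \<bar>v x - v y\<bar>"
  shows "genergy s p u \<le> genergy s p v"
  unfolding genergy_def
  using assms by (intro integral_mono frac_sobolev0_energy_integrable powr_mono2) (auto simp: dq_def)

text \<open>Solutions are nonnegative only almost everywhere, whereas the transformation is applied
  at every point; a change on a null set repairs this.\<close>

lemma nonneg_representative:
  assumes p: "p > 1" and sol: "weak_solution s p \<Omega> f l u"
  shows "weak_solution s p \<Omega> f l (\<lambda>x. max 0 (u x))"
proof -
  let ?U = "\<lambda>x. max 0 (u x)"
  have u: "u \<in> frac_sobolev0 s p \<Omega>" and pos: "AE x in lebesgue. x \<in> \<Omega> \<longrightarrow> u x > 0"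
    using sol by (auto simp: weak_solution_def)
  have U: "?U \<in> frac_sobolev0 s p \<Omega>"
    by (rule frac_sobolev0_lipschitz_image[OF p u, where C = 1]) auto
  have "AE x in lebesgue. x \<notin> \<Omega> \<longrightarrow> u x = 0" using u by (simp add: frac_sobolev0_iff)
  then have eq: "AE x in lebesgue. ?U x = u x" using pos by eventually_elim (auto simp: max_def)
  note [measurable] = u[THEN frac_sobolev0_measurable] U[THEN frac_sobolev0_measurable]
  have lap: "frac_p_laplacian s p ?U v = frac_p_laplacian s p u v" if v: "v \<in> frac_sobolev0 s p \<Omega>" for v
  proof -
    note [measurable] = v[THEN frac_sobolev0_measurable]
    show ?thesis
      unfolding frac_p_laplacian_eq0[OF U v] frac_p_laplacian_eq0[OF u v]
    proof (rule integral_cong_AE)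
      show "AE z in gmeas s p. jp p (dq ?U z) * dq v z = jp p (dq u z) * dq v z"
        using AE_gmeas[OF eq] by eventually_elim (simp add: dq_def)
    qed measurable
  qed
  have int: "set_integrable lebesgue \<Omega> (\<lambda>x. f (?U x) * v x) \<and>
      (LINT x:\<Omega>|lebesgue. f (?U x) * v x) = (LINT x:\<Omega>|lebesgue. f (u x) * v x)"
    if i: "set_integrable lebesgue \<Omega> (\<lambda>x. f (u x) * v x)" for v
  proof -
    have ae: "AE x in lebesgue. indicator \<Omega> x *\<^sub>R (f (u x) * v x) = indicator \<Omega> x *\<^sub>R (f (?U x) * v x)"
      using eq by eventually_elim simp
    have m: "(\<lambda>x. indicator \<Omega> x *\<^sub>R (f (u x) * v x)) \<in> borel_measurable lebesgue"
      using i by (auto simp: set_integrable_def)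
    have m': "(\<lambda>x. indicator \<Omega> x *\<^sub>R (f (?U x) * v x)) \<in> borel_measurable lebesgue"
      by (rule borel_measurable_AE[OF m ae])
    show ?thesis
      using i integrable_cong_AE[OF m m' ae] integral_cong_AE[OF m m' ae]
      by (simp add: set_integrable_def set_lebesgue_integral_def)
  qed
  have "in_frac_sobolev0_dual s p \<Omega> (\<lambda>x. f (u x))" using sol by (simp add: weak_solution_def)
  then obtain C where "\<forall>v\<in>frac_sobolev0 s p \<Omega>. set_integrable lebesgue \<Omega> (\<lambda>x. f (u x) * v x) \<and>
      \<bar>LINT x:\<Omega>|lebesgue. f (u x) * v x\<bar> \<le> C * gagliardo_seminorm s p v"
    by (auto simp: in_frac_sobolev0_dual_def)
  note C = this[rule_format]
  have "in_frac_sobolev0_dual s p \<Omega> (\<lambda>x. f (?U x))"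
    unfolding in_frac_sobolev0_dual_def
    by (rule exI[of _ C]) (use C int in auto)
  moreover have "AE x in lebesgue. x \<in> \<Omega> \<longrightarrow> ?U x > 0"
    using pos by eventually_elim auto
  moreover have "frac_p_laplacian s p ?U v = l * (LINT x:\<Omega>|lebesgue. f (?U x) * v x)"
    if v: "v \<in> frac_sobolev0 s p \<Omega>" "AE x in lebesgue. v x \<ge> 0" for v
    using sol v int[OF conjunct1[OF C[OF v(1)]]] lap[OF v(1)] by (simp add: weak_solution_def)
  ultimately show ?thesis using U by (simp add: weak_solution_def)
qed

text \<open>Minimising under \<open>0 \<le> v \<le> u\<close> could spoil the Euler-Lagrange
  equation. It does not, because \<open>u\<close> is a barrier: cutting any competitor to this
  interval does not raise the functional. The ceiling is \<open>u\<close>, not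
  \<open>\<beta>\<close>, since the equation for \<open>u\<close> accepts every nonnegative test
  function, including the possibly unbounded excess over \<open>u\<close>.\<close>

lemma minimizer_below_solution:
  fixes u \<beta> :: "'a::euclidean_space \<Rightarrow> real" and G :: "real \<Rightarrow> real \<Rightarrow> real"
  assumes p: "p > 1" and s: "s > 0" and \<Omega>: "\<Omega> \<in> sets lebesgue"
    and h: "mono h" "\<And>t. 0 < h t"
    and G0: "\<And>b. 0 \<le> b \<Longrightarrow> G b 0 = 0"
    and G_deriv: "\<And>b t. DERIV (G b) t :> h (min b t)"
    and G_mono: "\<And>b a c. a \<le> c \<Longrightarrow> G b a \<le> G b c"
    and G_lip: "\<And>b a c. \<bar>G b a - G b c\<bar> \<le> h b * \<bar>a - c\<bar>"
    and G_meas: "\<And>v. v \<in> borel_measurable lebesgue \<Longrightarrow> (\<lambda>x. G (\<beta> x) (v x)) \<in> borel_measurable lebesgue"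
    and u: "u \<in> frac_sobolev0 s p \<Omega>" "\<And>x. 0 \<le> u x"
    and int: "\<And>v. v \<in> frac_sobolev0 s p \<Omega> \<Longrightarrow> set_integrable lebesgue \<Omega> (\<lambda>x. h (u x) * v x)"
    and eq: "\<And>v. v \<in> frac_sobolev0 s p \<Omega> \<Longrightarrow> (\<And>x. 0 \<le> v x) \<Longrightarrow>
        frac_p_laplacian s p u v = l * (LINT x:\<Omega>|lebesgue. h (u x) * v x)"
    and l: "0 < l'" "l' \<le> l"
    and \<beta>: "\<beta> \<in> borel_measurable lebesgue" "\<And>x. 0 \<le> \<beta> x" "\<And>x. \<beta> x \<le> u x"
  obtains w where "w \<in> frac_sobolev0 s p \<Omega>" "\<And>x. 0 \<le> w x" "\<And>x. w x \<le> u x"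
    "\<And>v. v \<in> frac_sobolev0 s p \<Omega> \<Longrightarrow>
       frac_p_laplacian s p w v = l' * (LINT x:\<Omega>|lebesgue. h (min (\<beta> x) (w x)) * v x)"
proof -
  note [measurable] = u(1)[THEN frac_sobolev0_measurable] \<Omega> \<beta>(1)
  have [measurable]: "h \<in> borel_measurable borel" using h by (intro borel_measurable_mono)
  \<comment> \<open>\<open>B\<close> is the Lipschitz constant of the truncated potential and
    \<open>H\<close> is \<open>p\<close> times the right-hand side of the equation for
    \<open>u\<close>. The order \<open>B \<le> H\<close> is what makes \<open>u\<close> a
    barrier.\<close>
  define B where "B x = indicator \<Omega> x * (p * l') * h (\<beta> x)" for x
  define H where "H x = indicator \<Omega> x * (p * l) * h (u x)" for x
  have pl: "0 < p * l'" "p * l' \<le> p * l" using p l by auto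
  have B_le_H: "0 \<le> B x" "B x \<le> H x" for x
    using pl h(2)[of "\<beta> x"] monoD[OF h(1) \<beta>(3)[of x]]
    by (auto simp: B_def H_def indicator_def intro!: mult_mono)
  have H_int: "integrable lebesgue (\<lambda>x. H x * v x)" if v: "v \<in> frac_sobolev0 s p \<Omega>" for v
  proof -
    have "integrable lebesgue (\<lambda>x. (p * l) * (indicator \<Omega> x *\<^sub>R (h (u x) * v x)))"
      using int[OF v] by (intro integrable_mult_right) (simp add: set_integrable_def)
    then show ?thesis by (simp add: H_def mult_ac)
  qed
  have B_int: "integrable lebesgue (\<lambda>x. B x * v x)" if v: "v \<in> frac_sobolev0 s p \<Omega>" for v
  proof (rule Bochner_Integration.integrable_bound[OF H_int[OF v]])
    note [measurable] = v[THEN frac_sobolev0_measurable]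
    show "(\<lambda>x. B x * v x) \<in> borel_measurable lebesgue" unfolding B_def by measurable
    show "AE x in lebesgue. norm (B x * v x) \<le> norm (H x * v x)"
    proof (rule AE_I2)
      fix x
      have "\<bar>B x\<bar> * \<bar>v x\<bar> \<le> \<bar>H x\<bar> * \<bar>v x\<bar>"
        using B_le_H[of x] by (intro mult_right_mono) auto
      then show "norm (B x * v x) \<le> norm (H x * v x)" by (simp add: abs_mult)
    qed
  qed
  define g where "g x t = indicator \<Omega> x * (p * l') * G (\<beta> x) t" for x t
  have ind: "0 \<le> indicator \<Omega> x * (p * l')" for x using pl by (simp add: indicator_def)
  have g_deriv: "DERIV (g x) t :> indicator \<Omega> x * (p * l') * h (min (\<beta> x) t)" for x t
    unfolding g_def by (intro DERIV_cmult G_deriv)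
  have g_mono: "g x a \<le> g x c" if "a \<le> c" for x a c
    unfolding g_def by (intro mult_left_mono G_mono that ind)
  have g_lip: "\<bar>g x a - g x c\<bar> \<le> B x * \<bar>a - c\<bar>" for x a c
  proof -
    have "\<bar>g x a - g x c\<bar> = indicator \<Omega> x * (p * l') * \<bar>G (\<beta> x) a - G (\<beta> x) c\<bar>"
      unfolding g_def right_diff_distrib[symmetric] abs_mult using p l by simp
    also have "\<dots> \<le> indicator \<Omega> x * (p * l') * (h (\<beta> x) * \<bar>a - c\<bar>)"
      by (intro mult_left_mono G_lip ind)
    finally show ?thesis by (simp add: B_def mult.assoc)
  qed
  have g0: "g x 0 = 0" for x using G0[OF \<beta>(2)] by (simp add: g_def)
  have g_meas: "(\<lambda>x. g x (v x)) \<in> borel_measurable lebesgue" if "v \<in> borel_measurable lebesgue" for v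
    unfolding g_def using G_meas[OF that] by measurable
  have g_int: "integrable lebesgue (\<lambda>x. g x (v x))" if v: "v \<in> frac_sobolev0 s p \<Omega>" for v
  proof (rule Bochner_Integration.integrable_bound[OF B_int[OF v]])
    show "AE x in lebesgue. norm (g x (v x)) \<le> norm (B x * v x)"
      using g_lip[of _ _ 0] B_le_H(1) by (auto simp: g0 abs_mult)
  qed (rule g_meas[OF frac_sobolev0_measurable[OF v]])
  interpret truncated_functional s p \<Omega> u "\<lambda>x. B x * u x" g
  proof
    show "\<bar>g x t\<bar> \<le> B x * u x" if "0 \<le> t" "t \<le> u x" for x t
    proof -
      have "\<bar>g x t\<bar> \<le> B x * t" using g_lip[of x t 0] that by (simp add: g0)
      also have "\<dots> \<le> B x * u x" using that B_le_H(1) by (intro mult_left_mono) auto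
      finally show ?thesis .
    qed
    show "isCont (g x) t" for x t by (rule DERIV_isCont[OF g_deriv])
  qed (use p u B_int[OF u(1)] g_meas in auto)
  obtain w where wK: "w \<in> K" and wmin: "\<And>v. v \<in> K \<Longrightarrow> fnl w \<le> fnl v"
    using minimizer_exists by blast
  note w = K_D[OF wK]
  have below: "\<exists>v'\<in>K. fnl v' \<le> fnl v" if v: "v \<in> frac_sobolev0 s p \<Omega>" for v
  proof -
    define a where "a x = max 0 (v x)" for x
    have a: "a \<in> frac_sobolev0 s p \<Omega>"
      unfolding a_def by (rule frac_sobolev0_lipschitz_image[OF p v, where C = 1]) auto
    have "genergy s p a \<le> genergy s p v"
      by (rule genergy_mono[OF a v p]) (auto simp: a_def)
    moreover have "(\<integral>x. g x (v x) \<partial>lebesgue) \<le> (\<integral>x. g x (a x) \<partial>lebesgue)"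
      by (intro integral_mono g_int a v g_mono) (simp add: a_def)
    ultimately have fa: "fnl a \<le> fnl v" by (simp add: fnl_def)
    \<comment> \<open>With \<open>e\<close> the excess over \<open>u\<close>, these satisfy
      \<open>a = c + e\<close> and \<open>d = u + e\<close>.\<close>
    define c where "c x = min (a x) (u x)" for x
    define d where "d x = max (a x) (u x)" for x
    define e where "e x = max 0 (a x + (-1) * u x)" for x
    have c: "c \<in> frac_sobolev0 s p \<Omega>" unfolding c_def by (rule frac_sobolev0_min[OF p a u(1)])
    have d: "d \<in> frac_sobolev0 s p \<Omega>" unfolding d_def by (rule frac_sobolev0_max[OF p a u(1)])
    have e: "e \<in> frac_sobolev0 s p \<Omega>"
      unfolding e_def
      by (rule frac_sobolev0_lipschitz_image[OF p frac_sobolev0_add_scaled[OF p a u(1)], where C = 1]) auto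
    have cK: "c \<in> K" using c u(2) by (auto simp: K_def c_def a_def)
    have sub: "genergy s p c + genergy s p d \<le> genergy s p a + genergy s p u"
      unfolding c_def d_def by (rule genergy_submodular[OF p a u(1)])
    \<comment> \<open>The tangent inequality from \<open>u\<close> to \<open>d\<close> shows that
      the energy of \<open>d\<close> exceeds that of \<open>u\<close> by at least the integral of
      \<open>H * e\<close>; by submodularity, replacing \<open>a\<close> by \<open>c\<close> lowers
      the energy by at least that much.\<close>
    have "(\<integral>z. \<bar>dq u z\<bar> powr p + p * (jp p (dq u z) * dq e z) \<partial>gmeas s p)
        \<le> (\<integral>z. \<bar>dq d z\<bar> powr p \<partial>gmeas s p)"
    proof (intro integral_mono Bochner_Integration.integrable_add integrable_mult_right
        frac_sobolev0_energy_integrable[OF u(1)] frac_sobolev0_energy_integrable[OF d]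
        integrable_jp_dq[OF p u(1) e])
      fix z :: "'a \<times> 'a"
      have "dq e z = dq d z - dq u z" by (simp add: dq_def e_def d_def max_def)
      then show "\<bar>dq u z\<bar> powr p + p * (jp p (dq u z) * dq e z) \<le> \<bar>dq d z\<bar> powr p"
        using abs_powr_tangent[OF p, of "dq u z" "dq d z"] by (simp add: mult.assoc)
    qed
    then have "genergy s p u + p * frac_p_laplacian s p u e \<le> genergy s p d"
      using frac_sobolev0_energy_integrable[OF u(1)] integrable_jp_dq[OF p u(1) e]
      by (simp add: genergy_def frac_p_laplacian_eq0[OF u(1) e])
    moreover have "p * frac_p_laplacian s p u e = (\<integral>x. H x * e x \<partial>lebesgue)"
    proof -
      have "frac_p_laplacian s p u e = l * (LINT x:\<Omega>|lebesgue. h (u x) * e x)"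
        by (rule eq[OF e]) (simp add: e_def)
      then have "p * frac_p_laplacian s p u e
          = (\<integral>x. (p * l) * (indicator \<Omega> x *\<^sub>R (h (u x) * e x)) \<partial>lebesgue)"
        by (simp add: set_lebesgue_integral_def)
      also have "\<dots> = (\<integral>x. H x * e x \<partial>lebesgue)"
        by (intro Bochner_Integration.integral_cong) (auto simp: H_def)
      finally show ?thesis .
    qed
    \<comment> \<open>The loss in the potential term is at most \<open>B * e \<le> H * e\<close>,
      which the gain in energy compensates.\<close>
    moreover have "(\<integral>x. g x (a x) \<partial>lebesgue) \<le> (\<integral>x. g x (c x) + H x * e x \<partial>lebesgue)"
    proof (intro integral_mono Bochner_Integration.integrable_add g_int a c H_int e)
      fix x
      have ac: "\<bar>a x - c x\<bar> = e x" by (simp add: e_def c_def min_def max_def)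
      have "g x (a x) - g x (c x) \<le> B x * e x" using g_lip[of x "a x" "c x"] ac by simp
      also have "\<dots> \<le> H x * e x" using B_le_H[of x] ac by (intro mult_right_mono) auto
      finally show "g x (a x) \<le> g x (c x) + H x * e x" by simp
    qed
    then have "(\<integral>x. g x (a x) \<partial>lebesgue) \<le> (\<integral>x. g x (c x) \<partial>lebesgue) + (\<integral>x. H x * e x \<partial>lebesgue)"
      using g_int[OF c] H_int[OF e] by simp
    ultimately have "fnl c \<le> fnl a" using sub by (simp add: fnl_def)
    with fa cK show ?thesis by (intro bexI[of _ c]) auto
  qed
  show thesis
  proof (rule that[OF w(1) w(3) w(4)])
    fix v assume v: "v \<in> frac_sobolev0 s p \<Omega>"
    note [measurable] = w(2) v[THEN frac_sobolev0_measurable]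
    have "p * frac_p_laplacian s p w v
        = (\<integral>x. (indicator \<Omega> x * (p * l') * h (min (\<beta> x) (w x))) * v x \<partial>lebesgue)"
    proof (rule euler_lagrange[OF p w(1) v g_int g_deriv g_lip])
      show "integrable lebesgue (\<lambda>x. B x * \<bar>v x\<bar>)" if "v \<in> frac_sobolev0 s p \<Omega>" for v
        by (rule B_int) (rule frac_sobolev0_lipschitz_image[OF p that, where C = 1], auto)
      show "genergy s p w - (\<integral>x. g x (w x) \<partial>lebesgue) \<le> genergy s p v - (\<integral>x. g x (v x) \<partial>lebesgue)"
        if "v \<in> frac_sobolev0 s p \<Omega>" for v
        using below[OF that] wmin unfolding fnl_def by (meson order_trans)
    qed measurable
    also have "\<dots> = (\<integral>x. (p * l') * (indicator \<Omega> x *\<^sub>R (h (min (\<beta> x) (w x)) * v x)) \<partial>lebesgue)"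
      by (intro Bochner_Integration.integral_cong) auto
    also have "\<dots> = p * (l' * (LINT x:\<Omega>|lebesgue. h (min (\<beta> x) (w x)) * v x))"
      by (simp add: set_lebesgue_integral_def)
    finally show "frac_p_laplacian s p w v = l' * (LINT x:\<Omega>|lebesgue. h (min (\<beta> x) (w x)) * v x)"
      using p by simp
  qed
qed

section \<open>A solution below the supersolution\<close>

lemma C1_lipschitz_on_interval:
  fixes f :: "real \<Rightarrow> real"
  assumes "f C1_differentiable_on UNIV"
  obtains L where "\<And>x y. x \<in> {a..b} \<Longrightarrow> y \<in> {a..b} \<Longrightarrow> \<bar>f x - f y\<bar> \<le> L * \<bar>x - y\<bar>"
proof -
  obtain D where D: "\<And>x. (f has_vector_derivative D x) (at x)" "continuous_on UNIV D"
    using assms by (auto simp: C1_differentiable_on_def)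
  have "bounded (D ` {a..b})"
    by (intro compact_imp_bounded compact_continuous_image continuous_on_subset[OF D(2)]) auto
  then obtain L where L: "\<forall>x\<in>{a..b}. norm (D x) \<le> L" unfolding bounded_iff by blast
  show thesis
  proof (rule that[of L])
    fix x y assume xy: "x \<in> {a..b}" "y \<in> {a..b}"
    have "norm (f x - f y) \<le> L * norm (x - y)"
    proof (rule field_differentiable_bound[where S = "{a..b}" and f' = D])
      show "(f has_field_derivative D z) (at z within {a..b})" for z
        using D(1)[of z]
        by (auto simp: has_real_derivative_iff_has_vector_derivative intro: has_vector_derivative_at_within)
    qed (use L xy in auto)
    then show "\<bar>f x - f y\<bar> \<le> L * \<bar>x - y\<bar>" by simp
  qed
qed

lemma set_integrable_dominated:
  assumes "set_integrable lebesgue \<Omega> (\<lambda>x. g x * v x :: real)" and [measurable]: "\<Omega> \<in> sets lebesgue"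
    "q \<in> borel_measurable lebesgue" "v \<in> borel_measurable lebesgue"
    and q: "\<And>x. 0 \<le> q x" "\<And>x. q x \<le> g x"
  shows "set_integrable lebesgue \<Omega> (\<lambda>x. q x * v x)"
  unfolding set_integrable_def
proof (rule Bochner_Integration.integrable_bound)
  show "integrable lebesgue (\<lambda>x. indicator \<Omega> x *\<^sub>R (g x * v x))"
    using assms(1) by (simp add: set_integrable_def)
  show "AE x in lebesgue. norm (indicator \<Omega> x *\<^sub>R (q x * v x)) \<le> norm (indicator \<Omega> x *\<^sub>R (g x * v x))"
  proof (rule AE_I2)
    fix x
    have "\<bar>q x\<bar> * \<bar>v x\<bar> \<le> \<bar>g x\<bar> * \<bar>v x\<bar>"
      using q(1)[of x] q(2)[of x] by (intro mult_right_mono) auto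
    then show "norm (indicator \<Omega> x *\<^sub>R (q x * v x)) \<le> norm (indicator \<Omega> x *\<^sub>R (g x * v x))"
      by (simp add: abs_mult indicator_def)
  qed
qed measurable

text \<open>The minimiser solves the problem with the nonlinearity frozen above
  \<open>\<Phi>(u)\<close>. Comparison with the supersolution places it below
  \<open>\<Phi>(u)\<close>, so the freezing is not felt and the growth bound of
  \<open>f(\<Phi>(u))\<close> is inherited.\<close>

lemma solution_below_concave_image:
  fixes f :: "real \<Rightarrow> real" and u :: "'a::euclidean_space \<Rightarrow> real"
  assumes p: "p > 1" and s: "s > 0" and \<Omega>: "\<Omega> \<in> lmeasurable"
    and C1: "f C1_differentiable_on UNIV" and mono: "mono f" and f0: "f 0 > 0"
    and conv: "convex_on {0..} (\<lambda>t. f t powr (1 / (p - 1)))"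
    and sol: "weak_solution s p \<Omega> f l u" and u0: "\<And>x. 0 \<le> u x"
    and l: "0 < l'" "l' < l"
  obtains w C where "weak_solution s p \<Omega> f l' w" "\<And>x. 0 \<le> w x" "C > 0"
    "AE x in lebesgue. f (w x) \<le> C * (1 + u x) powr (p - 1)"
proof -
  have diff: "f differentiable (at x)" for x
    using C1 by (auto simp: C1_differentiable_on_def intro: differentiableI_vector)
  have f_cont: "continuous_on UNIV f"
    using diff by (intro continuous_at_imp_continuous_on) (auto intro: differentiable_imp_continuous_within)
  have f_pos: "f t > 0" if "t \<ge> 0" for t using f0 monoD[OF mono that] by simp
  define \<theta> where "\<theta> = l' / l"
  have \<theta>: "0 < \<theta>" "\<theta> < 1" "l * \<theta> = l'" using l by (auto simp: \<theta>_def)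
  obtain \<Phi> \<phi> C where \<Phi>: "\<And>t. 0 \<le> t \<Longrightarrow> 0 \<le> \<Phi> t" "\<And>t. 0 \<le> t \<Longrightarrow> \<Phi> t \<le> t"
    and \<phi>: "\<And>t. 0 \<le> t \<Longrightarrow> 0 < \<phi> t" "\<And>t. 0 \<le> t \<Longrightarrow> \<phi> t \<le> 1"
    and lower: "\<And>a b. 0 \<le> b \<Longrightarrow> b \<le> a \<Longrightarrow> \<phi> a * (a - b) \<le> \<Phi> a - \<Phi> b"
    and upper: "\<And>a b. 0 \<le> b \<Longrightarrow> b \<le> a \<Longrightarrow> \<Phi> a - \<Phi> b \<le> \<phi> b * (a - b)"
    and \<phi>_eq: "\<And>t. 0 \<le> t \<Longrightarrow> \<phi> t powr (p - 1) * f t = \<theta> * f (\<Phi> t)"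
    and C: "C > 0" "\<And>t. 0 \<le> t \<Longrightarrow> f (\<Phi> t) \<le> C * (1 + t) powr (p - 1)"
    by (rule concave_transform[OF p diff mono f0 conv \<theta>(1,2)]) (rule that, assumption+)
  have \<Phi>_mono: "\<Phi> b \<le> \<Phi> a" if "0 \<le> b" "b \<le> a" for a b
  proof -
    have "0 \<le> \<phi> a * (a - b)" using that \<phi>(1)[of a] by simp
    then show ?thesis using lower[OF that] by linarith
  qed
  have \<phi>_anti: "\<phi> a \<le> \<phi> b" if "0 \<le> b" "b \<le> a" for a b
  proof (cases "a = b")
    case False
    have "\<phi> a * (a - b) \<le> \<phi> b * (a - b)" using lower[OF that] upper[OF that] by linarith
    then show ?thesis using False that by simp
  qed simp
  have \<Phi>_lip: "\<bar>\<Phi> a - \<Phi> b\<bar> \<le> \<bar>a - b\<bar>" if "0 \<le> a" "0 \<le> b" for a b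
  proof -
    have *: "\<Phi> a - \<Phi> b \<le> a - b" if "0 \<le> b" "b \<le> a" for a b
    proof -
      have "\<phi> b * (a - b) \<le> 1 * (a - b)" using that \<phi>(2)[of b] by (intro mult_right_mono) auto
      then show ?thesis using upper[OF that] by simp
    qed
    show ?thesis
      using *[of a b] *[of b a] \<Phi>_mono[of a b] \<Phi>_mono[of b a] that by (cases "a \<le> b") auto
  qed
  have u: "u \<in> frac_sobolev0 s p \<Omega>" and u_pos: "AE x in lebesgue. x \<in> \<Omega> \<longrightarrow> u x > 0"
    using sol by (auto simp: weak_solution_def)
  have "in_frac_sobolev0_dual s p \<Omega> (\<lambda>x. f (u x))" using sol by (simp add: weak_solution_def)
  then obtain K where "\<forall>v\<in>frac_sobolev0 s p \<Omega>. set_integrable lebesgue \<Omega> (\<lambda>x. f (u x) * v x) \<and>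
      \<bar>LINT x:\<Omega>|lebesgue. f (u x) * v x\<bar> \<le> K * gagliardo_seminorm s p v"
    by (auto simp: in_frac_sobolev0_dual_def)
  note dual = this[rule_format]
  have eq: "frac_p_laplacian s p u v = l * (LINT x:\<Omega>|lebesgue. f (u x) * v x)"
    if "v \<in> frac_sobolev0 s p \<Omega>" "\<And>x. 0 \<le> v x" for v
    using sol that by (simp add: weak_solution_def)
  \<comment> \<open>\<open>f\<close> may fail to be positive at negative arguments; \<open>h\<close>
    is positive everywhere and agrees with \<open>f\<close> at the nonnegative values that
    occur.\<close>
  define h where "h t = f (max 0 t)" for t
  have h_nonneg: "h t = f t" if "0 \<le> t" for t using that by (simp add: h_def)
  have h_mono: "mono h" unfolding h_def by (intro monoI monoD[OF mono]) auto
  have h_pos: "0 < h t" for t unfolding h_def by (rule f_pos) simp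
  have h_cont: "continuous_on UNIV h"
    unfolding h_def by (intro continuous_on_compose2[OF f_cont] continuous_intros) auto
  obtain G :: "real \<Rightarrow> real \<Rightarrow> real" where G: "\<And>b. 0 \<le> b \<Longrightarrow> G b 0 = 0"
    "\<And>b t. DERIV (G b) t :> h (min b t)"
    "\<And>b a c. a \<le> c \<Longrightarrow> G b a \<le> G b c"
    "\<And>b a c. \<bar>G b a - G b c\<bar> \<le> h b * \<bar>a - c\<bar>"
    "\<And>\<beta> v. \<beta> \<in> borel_measurable (lebesgue :: 'a measure) \<Longrightarrow> v \<in> borel_measurable lebesgue \<Longrightarrow>
       (\<lambda>x. G (\<beta> x) (v x)) \<in> borel_measurable (lebesgue :: 'a measure)"
    by (rule truncated_primitive[OF h_cont h_mono h_pos, where 'b = 'a]) blast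
  have [measurable]: "f \<in> borel_measurable borel" "h \<in> borel_measurable borel"
    using mono h_mono by (auto intro: borel_measurable_mono)
  have [measurable]: "(\<lambda>t. \<Phi> (max 0 t)) \<in> borel_measurable borel"
    by (intro borel_measurable_mono monoI \<Phi>_mono) auto
  note [measurable] = u[THEN frac_sobolev0_measurable]
  have \<Omega>m [measurable]: "\<Omega> \<in> sets lebesgue" using \<Omega> by (rule fmeasurableD)
  define \<beta> where "\<beta> x = \<Phi> (u x)" for x
  have \<beta>_alt: "\<beta> = (\<lambda>x. \<Phi> (max 0 (u x)))" by (simp add: \<beta>_def u0 fun_eq_iff)
  have \<beta>_meas [measurable]: "\<beta> \<in> borel_measurable lebesgue" unfolding \<beta>_alt by measurable
  have \<beta>: "0 \<le> \<beta> x" "\<beta> x \<le> u x" for x using \<Phi>[OF u0] by (auto simp: \<beta>_def)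
  obtain w where w: "w \<in> frac_sobolev0 s p \<Omega>" "\<And>x. 0 \<le> w x" "\<And>x. w x \<le> u x"
    and w_eq: "\<And>v. v \<in> frac_sobolev0 s p \<Omega> \<Longrightarrow>
       frac_p_laplacian s p w v = l' * (LINT x:\<Omega>|lebesgue. h (min (\<beta> x) (w x)) * v x)"
  proof (rule minimizer_below_solution[OF p s \<Omega>m h_mono h_pos G(1-4) G(5)[OF \<beta>_meas] u u0])
    show "set_integrable lebesgue \<Omega> (\<lambda>x. h (u x) * v x)" if "v \<in> frac_sobolev0 s p \<Omega>" for v
      using dual[OF that] by (simp add: h_nonneg u0)
    show "frac_p_laplacian s p u v = l * (LINT x:\<Omega>|lebesgue. h (u x) * v x)"
      if "v \<in> frac_sobolev0 s p \<Omega>" "\<And>x. 0 \<le> v x" for v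
      using eq[OF that] by (simp add: h_nonneg u0)
  qed (use l \<beta> \<beta>_meas in auto)
  note [measurable] = w(1)[THEN frac_sobolev0_measurable]
  have le_cutoff: "AE x in lebesgue. w x \<le> \<Phi> (min (u x) (real k)) + \<phi> (real k) * max 0 (u x - real k)" for k
  proof -
    \<comment> \<open>Beyond \<open>k\<close> continue \<open>\<Phi>\<close> linearly: then the power of its derivative is Lipschitz, as needed
       for an admissible test function.\<close>
    define \<Phi>k where "\<Phi>k t = \<Phi> (min t (real k)) + \<phi> (real k) * max 0 (t - real k)" for t
    define \<phi>k where "\<phi>k t = \<phi> (min t (real k))" for t
    have cutoff: "\<phi>k a * (a - b) \<le> \<Phi>k a - \<Phi>k b" "\<Phi>k a - \<Phi>k b \<le> \<phi>k b * (a - b)"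
      if "0 \<le> b" "b \<le> a" for a b
      unfolding \<Phi>k_def \<phi>k_def using lower upper that
      by (intro concave_cutoff[where k = "real k" and \<Phi> = \<Phi> and \<phi> = \<phi>]; simp)+
    define v where "v x = max 0 (min 1 (w x - \<Phi>k (u x)))" for x
    obtain Lf where Lf: "\<And>x y. x \<in> {0..real k} \<Longrightarrow> y \<in> {0..real k} \<Longrightarrow> \<bar>f x - f y\<bar> \<le> Lf * \<bar>x - y\<bar>"
      using C1_lipschitz_on_interval[OF C1] by blast
    define L where "L = max Lf 0"
    have L: "0 \<le> L" "\<bar>f x - f y\<bar> \<le> L * \<bar>x - y\<bar>" if "x \<in> {0..real k}" "y \<in> {0..real k}" for x y
      using Lf[OF that] mult_right_mono[of Lf L "\<bar>x - y\<bar>"] by (auto simp: L_def)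
    \<comment> \<open>This exhibits the power of \<open>\<phi>\<close> as a quotient with
      denominator at least \<open>f 0\<close>, Lipschitz on bounded intervals because
      \<open>f\<close> is.\<close>
    have \<phi>_powr: "\<phi> t powr (p - 1) = \<theta> * f (\<Phi> t) / f t" if "0 \<le> t" for t
      using \<phi>_eq[OF that] f_pos[OF that] by (simp add: field_simps)
    have lip: "\<bar>\<phi>k a powr (p - 1) - \<phi>k b powr (p - 1)\<bar> \<le> 2 * L / f 0 * \<bar>a - b\<bar>"
      if ab: "0 \<le> a" "0 \<le> b" for a b
    proof -
      define x where "x = min a (real k)"
      define y where "y = min b (real k)"
      have x: "x \<in> {0..real k}" "0 \<le> x" "\<Phi> x \<in> {0..real k}"
        using ab \<Phi>[of x] by (auto simp: x_def)
      have y: "y \<in> {0..real k}" "0 \<le> y" "\<Phi> y \<in> {0..real k}"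
        using ab \<Phi>[of y] by (auto simp: y_def)
      have xy: "\<bar>x - y\<bar> \<le> \<bar>a - b\<bar>" by (auto simp: x_def y_def)
      have fx: "f 0 \<le> f x" and fy: "0 < f y" using monoD[OF mono x(2)] f_pos[OF y(2)] by auto
      have r: "0 \<le> f (\<Phi> y) / f y" "f (\<Phi> y) / f y \<le> 1"
        using fy f_pos[of "\<Phi> y"] monoD[OF mono, of "\<Phi> y" y] \<Phi>[OF y(2)] by auto
      \<comment> \<open>Since \<open>f (\<Phi> y) / f y\<close> is at most 1, numerator and
        denominator each contribute one Lipschitz bound, whence the factor 2.\<close>
      have "f (\<Phi> x) / f x - f (\<Phi> y) / f y
          = ((f (\<Phi> x) - f (\<Phi> y)) + f (\<Phi> y) / f y * (f y - f x)) / f x"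
        using fx fy f0 by (simp add: field_simps)
      also have "\<bar>\<dots>\<bar> \<le> (L * \<bar>x - y\<bar> + 1 * (L * \<bar>x - y\<bar>)) / f 0"
        unfolding abs_divide
      proof (rule frac_le)
        have "\<bar>f (\<Phi> x) - f (\<Phi> y)\<bar> \<le> L * \<bar>x - y\<bar>"
          using L(2)[OF x(3) y(3)] mult_left_mono[OF \<Phi>_lip[OF x(2) y(2)] L(1)[OF x(1) y(1)]] by linarith
        moreover have "\<bar>f (\<Phi> y) / f y * (f y - f x)\<bar> \<le> 1 * (L * \<bar>x - y\<bar>)"
          unfolding abs_mult using r L(2)[OF y(1) x(1)]
          by (intro mult_mono) (auto simp: abs_minus_commute)
        ultimately show "\<bar>f (\<Phi> x) - f (\<Phi> y) + f (\<Phi> y) / f y * (f y - f x)\<bar>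
            \<le> L * \<bar>x - y\<bar> + 1 * (L * \<bar>x - y\<bar>)" by linarith
      qed (use fx f0 L(1)[OF x(1) y(1)] in auto)
      also have "\<dots> = 2 * L / f 0 * \<bar>x - y\<bar>" by (simp add: field_simps)
      also have "\<dots> \<le> 2 * L / f 0 * \<bar>a - b\<bar>"
        using L(1)[OF x(1) y(1)] f0 by (intro mult_left_mono xy) auto
      finally have *: "\<bar>f (\<Phi> x) / f x - f (\<Phi> y) / f y\<bar> \<le> 2 * L / f 0 * \<bar>a - b\<bar>" .
      have "\<phi>k a powr (p - 1) - \<phi>k b powr (p - 1) = \<theta> * (f (\<Phi> x) / f x - f (\<Phi> y) / f y)"
        using \<phi>_powr[OF x(2)] \<phi>_powr[OF y(2)] by (simp add: \<phi>k_def x_def y_def right_diff_distrib)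
      then have "\<bar>\<phi>k a powr (p - 1) - \<phi>k b powr (p - 1)\<bar> = \<theta> * \<bar>f (\<Phi> x) / f x - f (\<Phi> y) / f y\<bar>"
        using \<theta> by (simp add: abs_mult)
      also have "\<dots> \<le> 1 * \<bar>f (\<Phi> x) / f x - f (\<Phi> y) / f y\<bar>"
        using \<theta> by (intro mult_right_mono) auto
      finally show ?thesis using * by simp
    qed
    have \<Phi>0: "\<Phi> 0 = 0" using \<Phi>[of 0] by simp
    have \<Phi>k0: "\<Phi>k 0 = 0" by (simp add: \<Phi>k_def \<Phi>0)
    have \<phi>k01: "0 < \<phi>k t" "\<phi>k t \<le> 1" if "0 \<le> t" for t using \<phi> that by (auto simp: \<phi>k_def)
    have zero_in: "(\<lambda>_. 0) \<in> frac_sobolev0 s p \<Omega>"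
      using frac_sobolev0_lipschitz_image[OF p u, of "\<lambda>_. 0" 0] by simp
    have cc: "(\<lambda>x. \<Phi>k (u x)) \<in> frac_sobolev0 s p \<Omega>"
        "(\<lambda>x. \<phi>k (u x) powr (p - 1) * v x) \<in> frac_sobolev0 s p \<Omega>"
        "frac_p_laplacian s p u (\<lambda>x. \<phi>k (u x) powr (p - 1) * v x)
           \<le> frac_p_laplacian s p (\<lambda>x. \<Phi>k (u x)) v"
      if "v \<in> frac_sobolev0 s p \<Omega>" "\<And>x. 0 \<le> v x" "\<And>x. v x \<le> 1" for v
      by (rule concave_comparison(1)[OF p u u0 that \<Phi>k0 \<phi>k01 cutoff lip]
            concave_comparison(2)[OF p u u0 that \<Phi>k0 \<phi>k01 cutoff lip]
            concave_comparison(3)[OF p u u0 that \<Phi>k0 \<phi>k01 cutoff lip], assumption+)+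
    have \<Phi>ku: "(\<lambda>x. \<Phi>k (u x)) \<in> frac_sobolev0 s p \<Omega>"
      by (rule cc(1)[OF zero_in]) auto
    have "(\<lambda>x. max 0 (min 1 (w x + (-1) * \<Phi>k (u x)))) \<in> frac_sobolev0 s p \<Omega>"
      by (rule frac_sobolev0_lipschitz_image[OF p frac_sobolev0_add_scaled[OF p w(1) \<Phi>ku], where C = 1]) auto
    then have v: "v \<in> frac_sobolev0 s p \<Omega>" by (simp add: v_def[abs_def])
    have v01: "0 \<le> v x" "v x \<le> 1" for x by (auto simp: v_def)
    note [measurable] = v[THEN frac_sobolev0_measurable]
    note cc = cc(2,3)[OF v v01]
    have int1: "set_integrable lebesgue \<Omega> (\<lambda>x. h (min (\<beta> x) (w x)) * v x)"
    proof (rule set_integrable_dominated[OF conjunct1[OF dual[OF v]]])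
      show "h (min (\<beta> x) (w x)) \<le> f (u x)" for x
        using monoD[OF h_mono, of "min (\<beta> x) (w x)" "u x"] w(3)[of x] by (simp add: h_nonneg u0 min.coboundedI2)
      show "0 \<le> h (min (\<beta> x) (w x))" for x using h_pos by (rule less_imp_le)
    qed measurable
    have "frac_p_laplacian s p w v = (LINT x:\<Omega>|lebesgue. l' * (h (min (\<beta> x) (w x)) * v x))"
      unfolding w_eq[OF v] by (rule set_integral_mult_right[symmetric])
    also have "\<dots> \<le> (LINT x:\<Omega>|lebesgue. l * (f (u x) * (\<phi>k (u x) powr (p - 1) * v x)))"
    proof (rule set_integral_mono)
      show "set_integrable lebesgue \<Omega> (\<lambda>x. l' * (h (min (\<beta> x) (w x)) * v x))"
        using int1 by simp
      show "set_integrable lebesgue \<Omega> (\<lambda>x. l * (f (u x) * (\<phi>k (u x) powr (p - 1) * v x)))"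
        using dual[OF cc(1)] by simp
      fix x
      \<comment> \<open>The differential equation for \<open>\<Phi>\<close> converts
        \<open>l' * f (\<Phi> (u x))\<close> into \<open>l * f (u x)\<close> times a power of
        \<open>\<phi>\<close>; passing to \<open>\<phi>k\<close> only enlarges it, as
        \<open>\<phi>\<close> is nonincreasing.\<close>
      have "h (min (\<beta> x) (w x)) \<le> h (\<beta> x)" by (rule monoD[OF h_mono]) simp
      then have "l' * h (min (\<beta> x) (w x)) \<le> l' * f (\<Phi> (u x))"
        using l \<beta>(1)[of x] by (intro mult_left_mono) (auto simp: \<beta>_def h_nonneg)
      also have "\<dots> = l * (f (u x) * \<phi> (u x) powr (p - 1))"
        using \<phi>_eq[OF u0[of x]] \<theta>(3) by (metis mult.assoc mult.commute)
      also have "\<dots> \<le> l * (f (u x) * \<phi>k (u x) powr (p - 1))"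
        using l f_pos[OF u0[of x]] \<phi>(1)[OF u0[of x]] p u0[of x]
        by (intro mult_left_mono powr_mono2) (auto simp: \<phi>k_def intro!: \<phi>_anti)
      finally have "l' * h (min (\<beta> x) (w x)) * v x \<le> l * (f (u x) * \<phi>k (u x) powr (p - 1)) * v x"
        using v01(1) by (rule mult_right_mono)
      then show "l' * (h (min (\<beta> x) (w x)) * v x) \<le> l * (f (u x) * (\<phi>k (u x) powr (p - 1) * v x))"
        by (simp add: mult.assoc)
    qed
    also have "\<dots> = frac_p_laplacian s p u (\<lambda>x. \<phi>k (u x) powr (p - 1) * v x)"
      using eq[OF cc(1)] v01 by (simp add: set_integral_mult_right)
    also have "\<dots> \<le> frac_p_laplacian s p (\<lambda>x. \<Phi>k (u x)) v" by (rule cc(2))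
    finally have "AE x in lebesgue. w x \<le> \<Phi>k (u x)"
      unfolding v_def[abs_def] by (rule weak_comparison[OF p s \<Omega> w(1) \<Phi>ku])
    then show ?thesis by (simp add: \<Phi>k_def)
  qed
  \<comment> \<open>Countably many cut-offs share one exceptional null set, and at a given point any
    \<open>k \<ge> u x\<close> makes the cut-off invisible.\<close>
  have "AE x in lebesgue. \<forall>k. w x \<le> \<Phi> (min (u x) (real k)) + \<phi> (real k) * max 0 (u x - real k)"
    using le_cutoff by (simp add: AE_all_countable)
  then have w_le: "AE x in lebesgue. w x \<le> \<beta> x"
  proof eventually_elim
    case (elim x)
    obtain k where "u x \<le> real k" using real_arch_simple by blast
    then show ?case using elim[rule_format, of k] by (simp add: \<beta>_def)
  qed
  have w_eq': "frac_p_laplacian s p w v = l' * (LINT x:\<Omega>|lebesgue. f (w x) * v x)"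
    if v: "v \<in> frac_sobolev0 s p \<Omega>" for v
  proof -
    note [measurable] = v[THEN frac_sobolev0_measurable]
    have "(LINT x:\<Omega>|lebesgue. h (min (\<beta> x) (w x)) * v x) = (LINT x:\<Omega>|lebesgue. f (w x) * v x)"
      unfolding set_lebesgue_integral_def
      by (rule integral_cong_AE) (use w_le in \<open>measurable, eventually_elim, simp add: h_nonneg w(2)\<close>)
    then show ?thesis using w_eq[OF v] by simp
  qed
  have fw_int: "set_integrable lebesgue \<Omega> (\<lambda>x. f (w x) * v x)" if v: "v \<in> frac_sobolev0 s p \<Omega>" for v
    by (rule set_integrable_dominated[OF conjunct1[OF dual[OF v]]])
       (use frac_sobolev0_measurable[OF v] w f_pos in \<open>auto intro: less_imp_le monoD[OF mono]\<close>)
  have fw_dual: "in_frac_sobolev0_dual s p \<Omega> (\<lambda>x. f (w x))"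
    unfolding in_frac_sobolev0_dual_def
  proof (intro exI ballI conjI)
    fix v assume v: "v \<in> frac_sobolev0 s p \<Omega>"
    show "set_integrable lebesgue \<Omega> (\<lambda>x. f (w x) * v x)" by (rule fw_int[OF v])
    \<comment> \<open>By \<open>f (w x) \<le> f (u x)\<close> the dual bound for \<open>f(u)\<close>
      is used with \<open>\<bar>v\<bar>\<close>, whose seminorm is no larger than that of
      \<open>v\<close>. The sign of \<open>K\<close> is unknown, hence
      \<open>\<bar>K\<bar>\<close>.\<close>
    have av: "(\<lambda>x. \<bar>v x\<bar>) \<in> frac_sobolev0 s p \<Omega>"
      by (rule frac_sobolev0_lipschitz_image[OF p v, where C = 1]) auto
    have "\<bar>LINT x:\<Omega>|lebesgue. f (w x) * v x\<bar> \<le> (LINT x:\<Omega>|lebesgue. f (u x) * \<bar>v x\<bar>)"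
      unfolding set_lebesgue_integral_def
    proof (rule order_trans[OF integral_abs_bound integral_mono])
      show "integrable lebesgue (\<lambda>x. \<bar>indicator \<Omega> x *\<^sub>R (f (w x) * v x)\<bar>)"
        using fw_int[OF v] by (simp add: set_integrable_def)
      show "integrable lebesgue (\<lambda>x. indicator \<Omega> x *\<^sub>R (f (u x) * \<bar>v x\<bar>))"
        using dual[OF av] by (simp add: set_integrable_def)
      show "\<bar>indicator \<Omega> x *\<^sub>R (f (w x) * v x)\<bar> \<le> indicator \<Omega> x *\<^sub>R (f (u x) * \<bar>v x\<bar>)" for x
        using monoD[OF mono w(3)[of x]] f_pos[OF w(2)[of x]]
        by (auto simp: indicator_def abs_mult intro!: mult_right_mono)
    qed
    also have "\<dots> \<le> K * gagliardo_seminorm s p (\<lambda>x. \<bar>v x\<bar>)"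
      using dual[OF av] by linarith
    also have "\<dots> \<le> \<bar>K\<bar> * gagliardo_seminorm s p v"
    proof (rule mult_mono)
      show "gagliardo_seminorm s p (\<lambda>x. \<bar>v x\<bar>) \<le> gagliardo_seminorm s p v"
        unfolding gagliardo_seminorm_eq0[OF av] gagliardo_seminorm_eq0[OF v]
        using p by (intro powr_mono2 genergy_mono[OF av v] genergy_nonneg) auto
    qed (auto simp: gagliardo_seminorm_def)
    finally show "\<bar>LINT x:\<Omega>|lebesgue. f (w x) * v x\<bar> \<le> \<bar>K\<bar> * gagliardo_seminorm s p v" .
  qed
  \<comment> \<open>The given solution \<open>u\<close> serves as the strictly positive member of
    the space.\<close>
  have w_pos: "AE x in lebesgue. x \<in> \<Omega> \<longrightarrow> 0 < w x"
  proof (rule strong_maximum_principle[OF p w(1) _ u u_pos _ _ _ \<Omega>, where h = "\<lambda>x. l' * f (w x)"])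
    show "AE x in lebesgue. x \<in> \<Omega> \<longrightarrow> 0 < l' * f (w x)" using l f_pos w(2) by auto
    show "set_integrable lebesgue \<Omega> (\<lambda>x. l' * f (w x) * v x)" if "v \<in> frac_sobolev0 s p \<Omega>" for v
      using fw_int[OF that] by (simp add: mult.assoc)
    show "frac_p_laplacian s p w v = (LINT x:\<Omega>|lebesgue. l' * f (w x) * v x)"
      if "v \<in> frac_sobolev0 s p \<Omega>" for v
      using w_eq'[OF that] by (simp add: mult.assoc)
  qed (use w in auto)
  show thesis
  proof (rule that[of w C])
    show "weak_solution s p \<Omega> f l' w"
      using w w_pos fw_dual w_eq' by (simp add: weak_solution_def)
    show "AE x in lebesgue. f (w x) \<le> C * (1 + u x) powr (p - 1)"
      using w_le
    proof eventually_elim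
      case (elim x)
      have "f (w x) \<le> f (\<Phi> (u x))" using elim by (intro monoD[OF mono]) (simp add: \<beta>_def)
      also have "\<dots> \<le> C * (1 + u x) powr (p - 1)" by (rule C(2)[OF u0])
      finally show ?case .
    qed
  qed (use w C in auto)
qed

section \<open>Integrability of solutions\<close>

text \<open>De Giorgi-Stampacchia iteration: along levels increasing to a finite \<open>d\<close>
  with gaps halved at each step, the superlinear power \<open>\<theta>\<close> outweighs the factors
  lost to the shrinking gaps.\<close>

lemma stampacchia:
  fixes \<mu> :: "real \<Rightarrow> real"
  assumes p: "p > 0" and A: "A \<ge> 0" and \<theta>: "\<theta> > 1"
    and nonneg: "\<And>k. 0 \<le> \<mu> k" and anti: "\<And>j k. k \<le> j \<Longrightarrow> \<mu> j \<le> \<mu> k"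
    and rec: "\<And>j k. 0 \<le> k \<Longrightarrow> k < j \<Longrightarrow> (j - k) powr p * \<mu> j \<le> A * \<mu> k powr \<theta>"
  shows "\<exists>d>0. \<mu> d = 0"
proof -
  \<comment> \<open>The rate solves \<open>a * \<theta> = a + p\<close>: raising to the power
    \<open>\<theta>\<close> gains exactly the factor \<open>2 powr p\<close> per step that halving
    the gap costs.\<close>
  define a where "a = p / (\<theta> - 1)"
  have a: "a > 0" "a * \<theta> = a + p" using p \<theta> by (auto simp: a_def field_simps)
  \<comment> \<open>\<open>Q\<close> becomes \<open>d powr p\<close> and dominates the constant
    produced by the induction step; the summand 1 keeps it positive.\<close>
  define Q where "Q = A * 2 powr (p + a) * \<mu> 0 powr (\<theta> - 1) + 1"
  have Q: "Q > 0" using A by (simp add: Q_def add_nonneg_pos)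
  define d where "d = Q powr (1 / p)"
  have d: "d > 0" "d powr p = Q" using Q p by (auto simp: d_def powr_powr)
  define k where "k i = d * (1 - 2 powr (- real i))" for i
  have k0: "0 \<le> k i" "k i \<le> d" for i
  proof -
    have "2 powr (- real i) \<le> (1::real)" using powr_mono[of "- real i" 0 2] by simp
    then show "0 \<le> k i" "k i \<le> d" using d by (auto simp: k_def)
  qed
  have k_diff: "k (Suc i) - k i = d * 2 powr (- real (Suc i))" for i
  proof -
    have "2 powr (- real i) = 2 * 2 powr (- real (Suc i))"
      using powr_add[of 2 1 "- real (Suc i)"] by simp
    then show ?thesis by (simp add: k_def algebra_simps)
  qed
  have bound: "\<mu> (k i) \<le> \<mu> 0 * 2 powr (- real i * a)" for i
  proof (induction i)
    case 0
    then show ?case by (simp add: k_def)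
  next
    case (Suc i)
    define S where "S = 2 powr (- real (Suc i) * p)"
    have S: "S > 0" by (simp add: S_def)
    have "Q * S * \<mu> (k (Suc i)) = (k (Suc i) - k i) powr p * \<mu> (k (Suc i))"
      using d by (simp add: k_diff powr_mult S_def powr_powr)
    also have "\<dots> \<le> A * \<mu> (k i) powr \<theta>"
      using k_diff[of i] d k0(1) by (intro rec) (auto simp: algebra_simps)
    also have "\<dots> \<le> A * (\<mu> 0 * 2 powr (- real i * a)) powr \<theta>"
      using Suc A \<theta> nonneg by (intro mult_left_mono powr_mono2) auto
    also have "\<dots> = A * \<mu> 0 powr \<theta> * 2 powr (- real i * (a + p))"
      using nonneg[of 0] a(2) by (simp add: powr_mult powr_powr mult.assoc)
    also have "2 powr (- real i * (a + p)) = 2 powr (p + a) * (2 powr (- real (Suc i) * a) * S)"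
    proof -
      have e: "- real i * (a + p) = (p + a) + (- real (Suc i) * a + - real (Suc i) * p)"
        by (simp add: algebra_simps)
      show ?thesis unfolding e powr_add S_def by simp
    qed
    also have "A * \<mu> 0 powr \<theta> * (2 powr (p + a) * (2 powr (- real (Suc i) * a) * S))
        = (A * 2 powr (p + a) * \<mu> 0 powr (\<theta> - 1)) * (\<mu> 0 * 2 powr (- real (Suc i) * a) * S)"
    proof -
      have "\<mu> 0 powr \<theta> = \<mu> 0 powr (\<theta> - 1) * \<mu> 0"
        using nonneg[of 0] \<theta> by (cases "\<mu> 0 = 0") (simp_all add: powr_diff)
      then show ?thesis by (simp add: mult_ac)
    qed
    also have "\<dots> \<le> Q * (\<mu> 0 * 2 powr (- real (Suc i) * a) * S)"
      using nonneg[of 0] S by (intro mult_right_mono) (auto simp: Q_def)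
    finally show ?case using Q S by (simp add: mult_ac)
  qed
  have "(\<lambda>i. \<mu> 0 * (2 powr (- a)) ^ i) \<longlonglongrightarrow> \<mu> 0 * 0"
    using a by (intro tendsto_mult tendsto_const LIMSEQ_realpow_zero) (auto simp: powr_less_one)
  moreover have "\<mu> d \<le> \<mu> 0 * (2 powr (- a)) ^ i" for i
  proof -
    have "(2 powr (- a)) ^ i = 2 powr (- real i * a)" by (simp add: powr_power mult.commute)
    then show ?thesis using anti[OF k0(2)[of i]] bound[of i] by simp
  qed
  ultimately have "\<mu> d \<le> \<mu> 0 * 0" by (intro LIMSEQ_le_const) auto
  then show ?thesis using d nonneg[of d] by (intro exI[of _ d]) auto
qed

text \<open>For \<open>\<theta> < 1\<close> the recursion along dyadic levels yields only polynomial
  decay. The conclusion inverts it: the size \<open>m\<close> is reached at a level of order at most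
  \<open>m powr (- (1 - \<theta>) / p)\<close>.\<close>

lemma level_decay:
  fixes \<mu> :: "real \<Rightarrow> real"
  assumes p: "p > 0" and A: "A \<ge> 0" and \<theta>: "0 < \<theta>" "\<theta> < 1"
    and nonneg: "\<And>k. 0 \<le> \<mu> k" and V: "\<And>k. \<mu> k \<le> V"
    and rec: "\<And>j k. 0 \<le> k \<Longrightarrow> k < j \<Longrightarrow> (j - k) powr p * \<mu> j \<le> A * \<mu> k powr \<theta>"
  shows "\<exists>M>0. \<forall>m. 0 < m \<and> m \<le> V \<longrightarrow> (\<exists>k\<ge>1. \<mu> k \<le> m \<and> k powr p * m \<le> M * m powr \<theta>)"
proof -
  \<comment> \<open>The exponent that the recursion reproduces:
    \<open>\<sigma> * \<theta> + p = \<sigma>\<close>.\<close>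
  define \<sigma> where "\<sigma> = p / (1 - \<theta>)"
  have \<sigma>: "\<sigma> > 0" "\<sigma> * \<theta> + p = \<sigma>" "\<sigma> * (1 - \<theta>) = p"
    using p \<theta> by (auto simp: \<sigma>_def field_simps)
  \<comment> \<open>\<open>V\<close> starts the induction at level 1, the root closes the induction
    step, and 1 ensures positivity.\<close>
  define M where "M = max (max V 1) ((A * 2 powr \<sigma>) powr (1 / (1 - \<theta>)))"
  have M: "M > 0" "V \<le> M" by (auto simp: M_def)
  have MA: "A * 2 powr \<sigma> \<le> M powr (1 - \<theta>)"
  proof -
    have "A * 2 powr \<sigma> = ((A * 2 powr \<sigma>) powr (1 / (1 - \<theta>))) powr (1 - \<theta>)"
      using A \<theta> by (simp add: powr_powr)
    also have "\<dots> \<le> M powr (1 - \<theta>)"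
      using \<theta> by (intro powr_mono2) (auto simp: M_def)
    finally show ?thesis .
  qed
  have decay: "\<mu> (2 ^ j) \<le> M * 2 powr (- real j * \<sigma>)" for j
  proof (induction j)
    case 0
    then show ?case using V[of 1] M by simp
  next
    case (Suc j)
    define S where "S = 2 powr (real j * p)"
    have S: "S > 0" by (simp add: S_def)
    have "S * \<mu> (2 ^ Suc j) = (2 ^ Suc j - 2 ^ j) powr p * \<mu> (2 ^ Suc j)"
      by (simp add: S_def powr_powr[symmetric] powr_realpow)
    also have "\<dots> \<le> A * \<mu> (2 ^ j) powr \<theta>" by (rule rec) auto
    also have "\<dots> \<le> A * (M * 2 powr (- real j * \<sigma>)) powr \<theta>"
      using Suc A \<theta> nonneg by (intro mult_left_mono powr_mono2) auto
    also have "\<dots> = A * M powr \<theta> * 2 powr (- real j * (\<sigma> * \<theta>))"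
      using M by (simp add: powr_mult powr_powr mult.assoc)
    also have "2 powr (- real j * (\<sigma> * \<theta>)) = 2 powr \<sigma> * (2 powr (- real (Suc j) * \<sigma>) * S)"
    proof -
      have "\<sigma> * \<theta> = \<sigma> - p" using \<sigma>(2) by simp
      then have e: "- real j * (\<sigma> * \<theta>) = \<sigma> + (- real (Suc j) * \<sigma> + real j * p)"
        by (simp only:) (simp add: algebra_simps)
      show ?thesis unfolding e powr_add S_def by simp
    qed
    also have "A * M powr \<theta> * (2 powr \<sigma> * (2 powr (- real (Suc j) * \<sigma>) * S))
        = (A * 2 powr \<sigma>) * (M powr \<theta> * 2 powr (- real (Suc j) * \<sigma>) * S)" by simp
    also have "\<dots> \<le> M powr (1 - \<theta>) * (M powr \<theta> * 2 powr (- real (Suc j) * \<sigma>) * S)"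
      using S M by (intro mult_right_mono MA) auto
    also have "\<dots> = S * (M * 2 powr (- real (Suc j) * \<sigma>))"
    proof -
      have "M powr (1 - \<theta>) * M powr \<theta> = M" using M by (simp flip: powr_add)
      then show ?thesis by (metis (no_types, opaque_lifting) mult.assoc mult.commute)
    qed
    finally show ?case using S by simp
  qed
  define M' where "M' = (M * 2 powr \<sigma>) powr (1 - \<theta>)"
  have "\<exists>k\<ge>1. \<mu> k \<le> m \<and> k powr p * m \<le> M' * m powr \<theta>" if m: "0 < m" "m \<le> V" for m
  proof -
    have "\<exists>j. M * 2 powr (- real j * \<sigma>) \<le> m"
    proof -
      have "(\<lambda>j. M * (2 powr (- \<sigma>)) ^ j) \<longlonglongrightarrow> M * 0"
        using \<sigma> by (intro tendsto_mult tendsto_const LIMSEQ_realpow_zero) (auto simp: powr_less_one)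
      then have "eventually (\<lambda>j. M * (2 powr (- \<sigma>)) ^ j < m) sequentially"
        using m by (intro order_tendstoD(2)) auto
      then obtain j where "M * (2 powr (- \<sigma>)) ^ j < m"
        by (auto simp: eventually_sequentially)
      then show ?thesis by (intro exI[of _ j]) (simp add: powr_power mult.commute)
    qed
    \<comment> \<open>The first suitable dyadic level: failure at \<open>j - 1\<close> bounds
      \<open>2 powr (real j * \<sigma>)\<close> from above, and for \<open>j = 0\<close> the bound
      \<open>m \<le> V \<le> M\<close> takes its place.\<close>
    then obtain j where j: "M * 2 powr (- real j * \<sigma>) \<le> m"
      and least: "\<And>i. i < j \<Longrightarrow> \<not> M * 2 powr (- real i * \<sigma>) \<le> m"
      using exists_least_iff[of "\<lambda>j. M * 2 powr (- real j * \<sigma>) \<le> m"] by blast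
    have key: "2 powr (real j * \<sigma>) \<le> M * 2 powr \<sigma> / m"
    proof (cases j)
      case 0
      have "1 \<le> 2 powr \<sigma>" using \<sigma> by (simp add: ge_one_powr_ge_zero)
      then have "m * 1 \<le> M * 2 powr \<sigma>" using m M by (intro mult_mono) auto
      then show ?thesis using m 0 by (simp add: field_simps)
    next
      case (Suc i)
      have "m < M * 2 powr (- real i * \<sigma>)" using least[of i] Suc by simp
      then have "m * 2 powr (real i * \<sigma>) \<le> M * 2 powr (- real i * \<sigma>) * 2 powr (real i * \<sigma>)"
        by (intro mult_right_mono) auto
      also have "\<dots> = M" by (simp add: mult.assoc flip: powr_add)
      finally have "m * 2 powr (real i * \<sigma>) * 2 powr \<sigma> \<le> M * 2 powr \<sigma>"
        by (intro mult_right_mono) auto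
      moreover have "2 powr (real j * \<sigma>) = 2 powr (real i * \<sigma>) * 2 powr \<sigma>"
        by (simp add: Suc algebra_simps flip: powr_add)
      ultimately show ?thesis using m by (simp add: field_simps)
    qed
    have "((2::real) ^ j) powr p = (2 powr (real j * \<sigma>)) powr (1 - \<theta>)"
    proof -
      have "((2::real) ^ j) powr p = 2 powr (real j * p)"
        by (simp add: powr_powr[symmetric] powr_realpow)
      also have "real j * p = (real j * \<sigma>) * (1 - \<theta>)" using \<sigma>(3) by simp
      finally show ?thesis by (simp add: powr_powr)
    qed
    also have "\<dots> \<le> (M * 2 powr \<sigma> / m) powr (1 - \<theta>)"
      using \<theta> by (intro powr_mono2 key) auto
    also have "\<dots> = M' / m powr (1 - \<theta>)"
      using m M by (simp add: M'_def powr_divide)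
    finally have "(2 ^ j) powr p * m \<le> M' / m powr (1 - \<theta>) * m"
      using m by (intro mult_right_mono) auto
    also have "\<dots> = M' * m powr \<theta>"
      using m by (simp add: powr_diff)
    finally have "(2 ^ j) powr p * m \<le> M' * m powr \<theta>" .
    moreover have "\<mu> (2 ^ j) \<le> m" using decay[of j] j by linarith
    ultimately show ?thesis by (intro exI[of _ "2 ^ j"]) auto
  qed
  moreover have "M' > 0" using M by (simp add: M'_def)
  ultimately show ?thesis by blast
qed

text \<open>Either the left side is at most the first term, or \<open>v\<close> is bounded by a
  multiple of \<open>y\<close>. The dependence on \<open>\<epsilon>\<close> is explicit because
  \<open>\<epsilon>\<close> will depend on the measure of a level set.\<close>

lemma young_powr:
  fixes a y v \<epsilon> :: real
  assumes p: "p > 1" and pos: "a > 0" "\<epsilon> > 0" "y \<ge> 0" "v \<ge> 0"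
  shows "a * y powr (p - 1) * v \<le> \<epsilon> * v powr p + a * (a / \<epsilon>) powr (1 / (p - 1)) * y powr p"
proof -
  have split: "z powr (p - 1) * z = z powr p" if "z \<ge> 0" for z
    using jp_mult_self[of p z] jp_of_nonneg[OF that, of p] that by simp
  show ?thesis
  proof (cases "a * y powr (p - 1) \<le> \<epsilon> * v powr (p - 1)")
    case True
    have "a * y powr (p - 1) * v \<le> \<epsilon> * v powr (p - 1) * v"
      using True pos by (intro mult_right_mono)
    also have "\<dots> = \<epsilon> * v powr p" using split[OF pos(4)] by (simp add: mult.assoc)
    also have "\<dots> \<le> \<epsilon> * v powr p + a * (a / \<epsilon>) powr (1 / (p - 1)) * y powr p"
      using pos by simp
    finally show ?thesis .
  next
    case False
    then have "v powr (p - 1) \<le> a / \<epsilon> * y powr (p - 1)"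
      using pos by (simp add: field_simps)
    then have "(v powr (p - 1)) powr (1 / (p - 1)) \<le> (a / \<epsilon> * y powr (p - 1)) powr (1 / (p - 1))"
      using p by (intro powr_mono2) auto
    moreover have "(v powr (p - 1)) powr (1 / (p - 1)) = v" "(y powr (p - 1)) powr (1 / (p - 1)) = y"
      using p pos by (simp_all add: powr_powr)
    ultimately have "v \<le> (a / \<epsilon>) powr (1 / (p - 1)) * y"
      using pos by (metis powr_mult divide_nonneg_pos less_imp_le powr_ge_zero)
    then have "a * y powr (p - 1) * v \<le> a * y powr (p - 1) * ((a / \<epsilon>) powr (1 / (p - 1)) * y)"
      using pos by (intro mult_left_mono) auto
    also have "\<dots> = a * (a / \<epsilon>) powr (1 / (p - 1)) * (y powr (p - 1) * y)" by simp
    also have "\<dots> \<le> \<epsilon> * v powr p + a * (a / \<epsilon>) powr (1 / (p - 1)) * y powr p"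
      using pos split[OF pos(3)] by simp
    finally show ?thesis .
  qed
qed

lemma integrable_one_plus_powr:
  assumes p: "p > 1" and \<Omega>: "\<Omega> \<in> lmeasurable" and u: "u \<in> frac_sobolev0 s p \<Omega>"
    and B: "B \<in> sets lebesgue" "B \<subseteq> \<Omega>"
  shows "integrable lebesgue (\<lambda>x. indicator B x * \<bar>1 + u x\<bar> powr p)"
proof -
  note [measurable] = u[THEN frac_sobolev0_measurable] B(1)
  show ?thesis
  proof (rule Bochner_Integration.integrable_bound)
    show "integrable lebesgue (\<lambda>x. 2 powr p * (indicator \<Omega> x + \<bar>u x\<bar> powr p))"
      using \<Omega> u unfolding frac_sobolev0_iff
      by (intro integrable_mult_right Bochner_Integration.integrable_add) (auto simp: fmeasurable_def)
    show "AE x in lebesgue. norm (indicator B x * \<bar>1 + u x\<bar> powr p)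
        \<le> norm (2 powr p * (indicator \<Omega> x + \<bar>u x\<bar> powr p))"
    proof (rule AE_I2)
      fix x
      have "\<bar>1 + u x\<bar> powr p \<le> 2 powr p * (1 + \<bar>u x\<bar> powr p)"
        using abs_add_powr_le[of p 1 "u x"] p by simp
      then show "norm (indicator B x * \<bar>1 + u x\<bar> powr p)
          \<le> norm (2 powr p * (indicator \<Omega> x + \<bar>u x\<bar> powr p))"
        using B by (auto simp: indicator_def)
    qed
  qed measurable
qed

text \<open>The test function is the positive part of \<open>w - k\<close>. Truncation contracts
  increments, so its energy is at most the form tested with it; Faber-Krahn acts on the level set
  and Young's inequality absorbs the test function. Faber-Krahn contributes the power 1 and the
  Young constant the power \<open>1 / (p - 1)\<close>, together \<open>p / (p - 1)\<close>.\<close>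

lemma level_set_estimate:
  fixes w u g :: "'a::euclidean_space \<Rightarrow> real"
  assumes p: "p > 1" and s: "s > 0" and \<Omega>: "\<Omega> \<in> lmeasurable"
    and w: "w \<in> frac_sobolev0 s p \<Omega>" and u: "u \<in> frac_sobolev0 s p \<Omega>" "\<And>x. 0 \<le> u x"
    and int: "\<And>v. v \<in> frac_sobolev0 s p \<Omega> \<Longrightarrow> set_integrable lebesgue \<Omega> (\<lambda>x. g x * v x)"
    and eq: "\<And>v. v \<in> frac_sobolev0 s p \<Omega> \<Longrightarrow> AE x in lebesgue. 0 \<le> v x \<Longrightarrow>
        frac_p_laplacian s p w v = (LINT x:\<Omega>|lebesgue. g x * v x)"
    and a: "a > 0" "AE x in lebesgue. g x \<le> a * (1 + u x) powr (p - 1)"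
  shows "\<exists>D>0. \<forall>k\<ge>0. (\<integral>x. max 0 (w x - k) powr p \<partial>lebesgue)
     \<le> D * measure lebesgue {x\<in>\<Omega>. w x > k} powr (s * p / real DIM('a) * (p / (p - 1))) *
        (\<integral>x. indicator {x\<in>\<Omega>. w x > k} x * (1 + u x) powr p \<partial>lebesgue)"
proof -
  note [measurable] = w[THEN frac_sobolev0_measurable] u(1)[THEN frac_sobolev0_measurable]
    fmeasurableD[OF \<Omega>]
  define \<alpha> where "\<alpha> = s * p / real DIM('a)"
  define F where "F = (2 / unit_ball_vol (real DIM('a))) powr ((real DIM('a) + s * p) / real DIM('a))"
  have "0 < unit_ball_vol (real DIM('a))" by simp
  then have "unit_ball_vol (real DIM('a)) \<noteq> 0" by linarith
  then have F: "F > 0" by (simp add: F_def)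
  define b where "b = 2 * F * a"
  have b: "b > 0" using F a by (simp add: b_def)
  have w0: "AE x in lebesgue. x \<notin> \<Omega> \<longrightarrow> w x = 0" using w by (simp add: frac_sobolev0_iff)
  have "(\<integral>x. max 0 (w x - k) powr p \<partial>lebesgue)
     \<le> b * b powr (1 / (p - 1)) * measure lebesgue {x\<in>\<Omega>. w x > k} powr (\<alpha> * (p / (p - 1))) *
        (\<integral>x. indicator {x\<in>\<Omega>. w x > k} x * (1 + u x) powr p \<partial>lebesgue)" if k: "k \<ge> 0" for k
  proof -
    define B where "B = {x\<in>\<Omega>. w x > k}"
    have "{x \<in> space lebesgue. w x > k} \<in> sets lebesgue" by measurable
    then have "\<Omega> \<inter> {x. w x > k} \<in> sets lebesgue" by auto
    moreover have "B = \<Omega> \<inter> {x. w x > k}" by (auto simp: B_def)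
    ultimately have B [measurable]: "B \<in> sets lebesgue" by simp
    have B\<Omega>: "B \<subseteq> \<Omega>" by (auto simp: B_def)
    have Bl: "B \<in> lmeasurable" using fmeasurableI2[OF \<Omega> B\<Omega> B] .
    define m where "m = measure lebesgue B"
    define v where "v x = max 0 (w x - k)" for x
    have v: "v \<in> frac_sobolev0 s p \<Omega>"
      unfolding v_def[abs_def] using k by (intro frac_sobolev0_lipschitz_image[OF p w, where C = 1]) auto
    have v0: "0 \<le> v x" for x by (simp add: v_def)
    note [measurable] = v[THEN frac_sobolev0_measurable]
    have vp: "integrable lebesgue (\<lambda>x. v x powr p)" using v v0 by (simp add: frac_sobolev0_iff)
    have vB: "AE x in lebesgue. x \<notin> B \<longrightarrow> v x = 0"
      using w0 by eventually_elim (use k in \<open>auto simp: v_def B_def max_def\<close>)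
    define X where "X = (\<integral>x. v x powr p \<partial>lebesgue)"
    define Y where "Y = (\<integral>x. indicator B x * (1 + u x) powr p \<partial>lebesgue)"
    have Y_int: "integrable lebesgue (\<lambda>x. indicator B x * (1 + u x) powr p)"
      using integrable_one_plus_powr[OF p \<Omega> u(1) B B\<Omega>] u(2) by simp
    have Y0: "Y \<ge> 0" unfolding Y_def by (intro Bochner_Integration.integral_nonneg) auto
    have X0: "X \<ge> 0" unfolding X_def by (intro Bochner_Integration.integral_nonneg) auto
    have E_le: "genergy s p v \<le> frac_p_laplacian s p w v"
      unfolding genergy_def frac_p_laplacian_eq0[OF w v]
    proof (intro integral_mono frac_sobolev0_energy_integrable[OF v] integrable_jp_dq[OF p w v])
      fix z :: "'a \<times> 'a"
      obtain x y where z: "z = (x, y)" by (cases z)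
      have ptw: "\<bar>max 0 (c - k) - max 0 (d - k)\<bar> powr p \<le> jp p (c - d) * (max 0 (c - k) - max 0 (d - k))"
        if "d \<le> c" for c d
      proof -
        let ?e = "max 0 (c - k) - max 0 (d - k)"
        have e: "0 \<le> ?e" "?e \<le> c - d" using that by auto
        have "\<bar>?e\<bar> powr p = jp p ?e * ?e" by (rule jp_mult_self[symmetric])
        also have "\<dots> \<le> jp p (c - d) * ?e" using e by (intro mult_right_mono jp_mono[OF p])
        finally show ?thesis .
      qed
      show "\<bar>dq v z\<bar> powr p \<le> jp p (dq w z) * dq v z"
      proof (cases "w y \<le> w x")
        case True
        then show ?thesis using ptw[of "w y" "w x"] by (simp add: z dq_def v_def)
      next
        case False
        have "jp p (w x - w y) = - jp p (w y - w x)" using jp_minus[of p "w y - w x"] by simp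
        then show ?thesis using ptw[of "w x" "w y"] False
          by (simp add: z dq_def v_def abs_minus_commute algebra_simps)
      qed
    qed
    have FK: "X \<le> F * m powr \<alpha> * genergy s p v"
    proof -
      have "(\<integral>x. \<bar>v x\<bar> powr p \<partial>lebesgue) \<le> F * measure lebesgue B powr \<alpha> * genergy s p v"
        unfolding F_def \<alpha>_def
        by (rule faber_krahn) (use p s v vB Bl in \<open>auto simp: frac_sobolev0_iff\<close>)
      then show ?thesis using v0 by (simp add: X_def m_def)
    qed
    show ?thesis
    proof (cases "m = 0")
      case True
      then have "X \<le> 0" using FK by simp
      moreover have "0 \<le> b * b powr (1 / (p - 1)) * m powr (\<alpha> * (p / (p - 1))) * Y"
        using b Y0 by simp
      ultimately show ?thesis by (simp add: X_def Y_def m_def B_def v_def)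
    next
      case False
      then have m: "m > 0" by (simp add: m_def zero_less_measure_iff)
      define T where "T = F * m powr \<alpha>"
      have T: "T > 0" using F m by (simp add: T_def)
      \<comment> \<open>With this choice the term \<open>T * \<epsilon> * X\<close> equals
        \<open>X / 2\<close> and is absorbed on the left.\<close>
      define \<epsilon> where "\<epsilon> = 1 / (2 * T)"
      have \<epsilon>: "\<epsilon> > 0" using T by (simp add: \<epsilon>_def)
      define c where "c = a * (a / \<epsilon>) powr (1 / (p - 1))"
      have "frac_p_laplacian s p w v = (\<integral>x. indicator \<Omega> x *\<^sub>R (g x * v x) \<partial>lebesgue)"
        using eq[OF v] v0 by (simp add: set_lebesgue_integral_def)
      also have "\<dots> \<le> (\<integral>x. \<epsilon> * v x powr p + c * (indicator B x * (1 + u x) powr p) \<partial>lebesgue)"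
      proof (rule integral_mono_AE)
        show "AE x in lebesgue. indicator \<Omega> x *\<^sub>R (g x * v x)
            \<le> \<epsilon> * v x powr p + c * (indicator B x * (1 + u x) powr p)"
          using vB a(2)
        proof eventually_elim
          case (elim x)
          show ?case
          proof (cases "x \<in> B")
            case True
            have "g x * v x \<le> a * (1 + u x) powr (p - 1) * v x"
              using elim v0 by (intro mult_right_mono) auto
            also have "\<dots> \<le> \<epsilon> * v x powr p + c * (1 + u x) powr p"
              unfolding c_def using u(2)[of x] v0 by (intro young_powr p a(1) \<epsilon>) auto
            finally show ?thesis using True B\<Omega> by auto
          qed (use elim \<epsilon> in auto)
        qed
      qed (use int[OF v] vp Y_int in \<open>auto simp: set_integrable_def\<close>)
      also have "\<dots> = \<epsilon> * X + c * Y"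
        using vp Y_int by (simp add: X_def Y_def)
      finally have "genergy s p v \<le> \<epsilon> * X + c * Y" using E_le by linarith
      then have "X \<le> T * (\<epsilon> * X + c * Y)"
        using FK T mult_left_mono[of "genergy s p v" "\<epsilon> * X + c * Y" T] by (simp add: T_def)
      also have "\<dots> = X / 2 + T * c * Y" using T by (simp add: \<epsilon>_def algebra_simps)
      finally have "X \<le> 2 * T * c * Y" by simp
      also have "2 * T * c = b * b powr (1 / (p - 1)) * m powr (\<alpha> * (p / (p - 1)))"
      proof -
        have "a / \<epsilon> = b * m powr \<alpha>" using T by (simp add: \<epsilon>_def b_def T_def)
        then have "2 * T * c = b * m powr \<alpha> * (b powr (1 / (p - 1)) * (m powr \<alpha>) powr (1 / (p - 1)))"
          using b by (simp add: c_def powr_mult b_def T_def mult_ac)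
        moreover have "m powr \<alpha> * (m powr \<alpha>) powr (1 / (p - 1)) = m powr (\<alpha> * (p / (p - 1)))"
        proof -
          have "\<alpha> + \<alpha> * (1 / (p - 1)) = \<alpha> * (p / (p - 1))" using p by (simp add: field_simps)
          then show ?thesis unfolding powr_powr by (metis powr_add)
        qed
        ultimately show ?thesis by (simp add: mult_ac)
      qed
      finally show ?thesis by (simp add: X_def Y_def m_def B_def v_def)
    qed
  qed
  then show ?thesis
    using b by (intro exI[of _ "b * b powr (1 / (p - 1))"]) (auto simp: \<alpha>_def)
qed

text \<open>\<open>measure_growth p \<Omega> \<tau> u\<close> is a weak-type integrability condition: it amounts to
  \<open>u\<close> belonging to weak \<open>L\<^sup>q\<close> with \<open>q = p / (1 - \<tau>)\<close> when \<open>0 < \<tau> < 1\<close>.\<close>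

definition measure_growth ::
    "real \<Rightarrow> 'a::euclidean_space set \<Rightarrow> real \<Rightarrow> ('a \<Rightarrow> real) \<Rightarrow> bool" where
  "measure_growth p \<Omega> \<tau> u \<longleftrightarrow>
     (\<exists>K\<ge>0. \<forall>B\<in>sets lebesgue. B \<subseteq> \<Omega> \<longrightarrow>
        (\<integral>x. indicator B x * (1 + u x) powr p \<partial>lebesgue) \<le> K * measure lebesgue B powr \<tau>)"

lemma measure_growth_0:
  assumes p: "p > 1" and \<Omega>: "\<Omega> \<in> lmeasurable"
    and u: "u \<in> frac_sobolev0 s p \<Omega>" "\<And>x. 0 \<le> u x"
  shows "measure_growth p \<Omega> 0 u"
proof -
  note [measurable] = u(1)[THEN frac_sobolev0_measurable]
  define K where "K = (\<integral>x. indicator \<Omega> x * (1 + u x) powr p \<partial>lebesgue)"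
  have int: "integrable lebesgue (\<lambda>x. indicator B x * (1 + u x) powr p)"
    if "B \<in> sets lebesgue" "B \<subseteq> \<Omega>" for B
    using integrable_one_plus_powr[OF p \<Omega> u(1) that] u(2) by simp
  have "(\<integral>x. indicator B x * (1 + u x) powr p \<partial>lebesgue) \<le> K * measure lebesgue B powr 0"
    if B: "B \<in> sets lebesgue" "B \<subseteq> \<Omega>" for B
  proof (cases "measure lebesgue B = 0")
    \<comment> \<open>Because \<open>0 powr 0 = 0\<close>, a null set must give integral 0; the
      bound by \<open>K\<close> would not be enough.\<close>
    case True
    have "B \<in> lmeasurable" using fmeasurableI2[OF \<Omega> B(2,1)] .
    then have "B \<in> null_sets lebesgue"
      using True by (intro null_setsI) (auto simp: emeasure_eq_measure2)
    then have "AE x in lebesgue. x \<notin> B" by (rule AE_not_in)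
    then have "AE x in lebesgue. indicator B x * (1 + u x) powr p = 0" by eventually_elim simp
    then have "(\<integral>x. indicator B x * (1 + u x) powr p \<partial>lebesgue) = 0"
      by (rule integral_eq_zero_AE)
    then show ?thesis using True by simp
  next
    case False
    have "(\<integral>x. indicator B x * (1 + u x) powr p \<partial>lebesgue) \<le> K"
      unfolding K_def using B by (intro integral_mono int fmeasurableD[OF \<Omega>]) (auto simp: indicator_def)
    then show ?thesis using False by simp
  qed
  moreover have "K \<ge> 0" unfolding K_def by (intro Bochner_Integration.integral_nonneg) auto
  ultimately show ?thesis unfolding measure_growth_def by blast
qed

text \<open>The level-set estimate and the growth of \<open>u\<close> give a recursion for the
  measures of the level sets of \<open>w\<close> with exponent \<open>\<tau> + \<beta>\<close>.
  Above 1 the iteration terminates at a finite level; below 1 the decay of level sets is turned back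
  into a growth condition.\<close>

lemma integrability_gain:
  fixes w u g :: "'a::euclidean_space \<Rightarrow> real"
  assumes p: "p > 1" and s: "s > 0" and \<Omega>: "\<Omega> \<in> lmeasurable"
    and w: "w \<in> frac_sobolev0 s p \<Omega>" "\<And>x. 0 \<le> w x"
    and u: "u \<in> frac_sobolev0 s p \<Omega>" "\<And>x. 0 \<le> u x"
    and int: "\<And>v. v \<in> frac_sobolev0 s p \<Omega> \<Longrightarrow> set_integrable lebesgue \<Omega> (\<lambda>x. g x * v x)"
    and eq: "\<And>v. v \<in> frac_sobolev0 s p \<Omega> \<Longrightarrow> AE x in lebesgue. 0 \<le> v x \<Longrightarrow>
        frac_p_laplacian s p w v = (LINT x:\<Omega>|lebesgue. g x * v x)"
    and a: "a > 0" "AE x in lebesgue. g x \<le> a * (1 + u x) powr (p - 1)"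
    and growth: "measure_growth p \<Omega> \<tau> u" and \<tau>: "0 \<le> \<tau>"
    and \<beta>: "0 < \<beta>" "\<beta> \<le> s * p / real DIM('a) * (p / (p - 1))"
  shows "\<tau> + \<beta> < 1 \<Longrightarrow> measure_growth p \<Omega> (\<tau> + \<beta>) w"
    and "\<tau> + \<beta> > 1 \<Longrightarrow> \<exists>M. AE x in lebesgue. x \<in> \<Omega> \<longrightarrow> w x \<le> M"
proof -
  note [measurable] = w(1)[THEN frac_sobolev0_measurable] fmeasurableD[OF \<Omega>]
  define \<gamma> where "\<gamma> = s * p / real DIM('a) * (p / (p - 1))"
  define \<theta> where "\<theta> = \<tau> + \<beta>"
  have \<theta>: "\<theta> > 0" using \<tau> \<beta> by (simp add: \<theta>_def)
  define B where "B k = {x\<in>\<Omega>. w x > k}" for k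
  define \<mu> where "\<mu> k = measure lebesgue (B k)" for k
  define V where "V = measure lebesgue \<Omega>"
  define X where "X k = (\<integral>x. max 0 (w x - k) powr p \<partial>lebesgue)" for k
  obtain D where D: "D > 0" and D_le: "\<And>k. k \<ge> 0 \<Longrightarrow> X k \<le> D * \<mu> k powr \<gamma> *
        (\<integral>x. indicator (B k) x * (1 + u x) powr p \<partial>lebesgue)"
    using level_set_estimate[OF p s \<Omega> w(1) u int eq a] unfolding \<gamma>_def \<mu>_def B_def X_def by blast
  obtain K where K: "K \<ge> 0" and K_le: "\<And>B. B \<in> sets lebesgue \<Longrightarrow> B \<subseteq> \<Omega> \<Longrightarrow>
        (\<integral>x. indicator B x * (1 + u x) powr p \<partial>lebesgue) \<le> K * measure lebesgue B powr \<tau>"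
    using growth unfolding measure_growth_def by blast
  have B [measurable]: "B k \<in> sets lebesgue" for k
  proof -
    have "{x \<in> space lebesgue. w x > k} \<in> sets lebesgue" by measurable
    then have "\<Omega> \<inter> {x. w x > k} \<in> sets lebesgue" by auto
    moreover have "B k = \<Omega> \<inter> {x. w x > k}" by (auto simp: B_def)
    ultimately show ?thesis by simp
  qed
  have B\<Omega>: "B k \<subseteq> \<Omega>" for k by (auto simp: B_def)
  have Bl: "B k \<in> lmeasurable" for k using fmeasurableI2[OF \<Omega> B\<Omega> B] .
  have ind_int: "integrable lebesgue (indicat_real S)" if "S \<in> lmeasurable" for S :: "'a set"
    using that by (intro integrable_real_indicator) (auto simp: fmeasurable_def)
  have \<mu>0: "0 \<le> \<mu> k" for k by (simp add: \<mu>_def)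
  have measure_le_V: "measure lebesgue A \<le> V" if "A \<in> sets lebesgue" "A \<subseteq> \<Omega>" for A
    unfolding V_def by (rule measure_mono_fmeasurable) (use that \<Omega> in auto)
  have \<mu>V: "\<mu> k \<le> V" for k unfolding \<mu>_def by (rule measure_le_V[OF B B\<Omega>])
  have V0: "0 \<le> V" by (simp add: V_def)
  have \<mu>_anti: "\<mu> j \<le> \<mu> k" if "k \<le> j" for j k
    unfolding \<mu>_def by (rule measure_mono_fmeasurable) (use that Bl in \<open>auto simp: B_def\<close>)
  \<comment> \<open>Lowering the exponent from \<open>\<gamma>\<close> to \<open>\<beta>\<close>
    costs only a power of \<open>V\<close>. This freedom lets \<open>\<tau> + \<beta>\<close> avoid
    the value 1.\<close>
  define A where "A = D * K * V powr (\<gamma> - \<beta>)"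
  have A: "A \<ge> 0" using D K by (simp add: A_def)
  have X_le: "X k \<le> A * \<mu> k powr \<theta>" if "k \<ge> 0" for k
  proof -
    have "X k \<le> D * \<mu> k powr \<gamma> * (K * \<mu> k powr \<tau>)"
    proof (rule order_trans[OF D_le[OF that] mult_left_mono])
      show "(\<integral>x. indicator (B k) x * (1 + u x) powr p \<partial>lebesgue) \<le> K * \<mu> k powr \<tau>"
        unfolding \<mu>_def by (rule K_le[OF B B\<Omega>])
    qed (use D in simp)
    also have "\<mu> k powr \<gamma> = \<mu> k powr (\<gamma> - \<beta>) * \<mu> k powr \<beta>" by (simp flip: powr_add)
    also have "D * (\<mu> k powr (\<gamma> - \<beta>) * \<mu> k powr \<beta>) * (K * \<mu> k powr \<tau>)
        = D * K * \<mu> k powr (\<gamma> - \<beta>) * \<mu> k powr \<theta>"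
      by (simp add: \<theta>_def powr_add)
    also have "\<dots> \<le> D * K * V powr (\<gamma> - \<beta>) * \<mu> k powr \<theta>"
      using D K \<beta> \<mu>V \<mu>0 by (intro mult_right_mono mult_left_mono powr_mono2) (auto simp: \<gamma>_def)
    finally show ?thesis by (simp add: A_def)
  qed
  have v: "(\<lambda>x. max 0 (w x - k)) \<in> frac_sobolev0 s p \<Omega>" if "k \<ge> 0" for k
    using that by (intro frac_sobolev0_lipschitz_image[OF p w(1), where C = 1]) auto
  have v_int: "integrable lebesgue (\<lambda>x. max 0 (w x - k) powr p)" if "k \<ge> 0" for k
    using v[OF that] by (simp add: frac_sobolev0_iff)
  have rec: "(j - k) powr p * \<mu> j \<le> A * \<mu> k powr \<theta>" if "0 \<le> k" "k < j" for j k
  proof -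
    \<comment> \<open>Chebyshev: on the higher level set the truncation at \<open>k\<close> is at
      least \<open>j - k\<close>.\<close>
    have "(j - k) powr p * \<mu> j = (\<integral>x. (j - k) powr p * indicator (B j) x \<partial>lebesgue)"
      using Bl[of j] by (simp add: \<mu>_def)
    also have "\<dots> \<le> X k"
      unfolding X_def
    proof (intro integral_mono v_int[OF that(1)] integrable_mult_right)
      show "integrable lebesgue (indicat_real (B j))" by (rule ind_int[OF Bl])
      show "(j - k) powr p * indicat_real (B j) x \<le> max 0 (w x - k) powr p" for x
        using that p by (auto simp: indicator_def B_def intro!: powr_mono2)
    qed
    finally show ?thesis using X_le[OF that(1)] by linarith
  qed
  have p0: "p > 0" using p by simp
  show "\<exists>M. AE x in lebesgue. x \<in> \<Omega> \<longrightarrow> w x \<le> M" if "\<tau> + \<beta> > 1"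
  proof -
    obtain d where d: "\<mu> d = 0"
      using stampacchia[OF p0 A _ \<mu>0 \<mu>_anti rec] \<open>\<tau> + \<beta> > 1\<close> unfolding \<theta>_def by blast
    then have "B d \<in> null_sets lebesgue"
      using Bl[of d] by (intro null_setsI) (auto simp: \<mu>_def emeasure_eq_measure2)
    then have "AE x in lebesgue. x \<notin> B d" by (rule AE_not_in)
    then have "AE x in lebesgue. x \<in> \<Omega> \<longrightarrow> w x \<le> d" by eventually_elim (auto simp: B_def)
    then show ?thesis by blast
  qed
  show "measure_growth p \<Omega> (\<tau> + \<beta>) w" if "\<tau> + \<beta> < 1"
  proof -
    obtain M where M: "M > 0" and M_le: "\<And>m. 0 < m \<Longrightarrow> m \<le> V \<Longrightarrow>
        \<exists>k\<ge>1. \<mu> k \<le> m \<and> k powr p * m \<le> M * m powr \<theta>"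
      using level_decay[OF p0 A \<theta> _ \<mu>0 \<mu>V rec] \<open>\<tau> + \<beta> < 1\<close> unfolding \<theta>_def by blast
    have "(\<integral>x. indicator S x * (1 + w x) powr p \<partial>lebesgue)
        \<le> 2 powr p * (2 powr p * M + A) * measure lebesgue S powr \<theta>"
      if S: "S \<in> sets lebesgue" "S \<subseteq> \<Omega>" for S
    proof -
      define m where "m = measure lebesgue S"
      have Sl: "S \<in> lmeasurable" using fmeasurableI2[OF \<Omega> S(2,1)] .
      show ?thesis
      proof (cases "m = 0")
        case True
        then have "S \<in> null_sets lebesgue"
          using Sl by (intro null_setsI) (auto simp: m_def emeasure_eq_measure2)
        then have "AE x in lebesgue. x \<notin> S" by (rule AE_not_in)
        then have "AE x in lebesgue. indicator S x * (1 + w x) powr p = 0" by eventually_elim simp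
        then have "(\<integral>x. indicator S x * (1 + w x) powr p \<partial>lebesgue) = 0"
          by (rule integral_eq_zero_AE)
        then show ?thesis using M A by simp
      next
        case False
        then have m: "0 < m" "m \<le> V"
          using measure_le_V[OF S] by (auto simp: m_def zero_less_measure_iff)
        \<comment> \<open>The level is adapted to the measure of \<open>S\<close>. As
          \<open>k \<ge> 1\<close>, \<open>1 + w x\<close> is at most
          \<open>2 * k + max 0 (w x - k)\<close>, and the contributions of both summands have order
          \<open>m powr \<theta>\<close>.\<close>
        obtain k where k: "k \<ge> 1" "\<mu> k \<le> m" "k powr p * m \<le> M * m powr \<theta>"
          using M_le[OF m] by blast
        have "(\<integral>x. indicator S x * (1 + w x) powr p \<partial>lebesgue)
            \<le> (\<integral>x. 2 powr p * ((2 * k) powr p * indicator S x + max 0 (w x - k) powr p) \<partial>lebesgue)"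
        proof (intro integral_mono integrable_mult_right Bochner_Integration.integrable_add)
          show "integrable lebesgue (\<lambda>x. indicator S x * (1 + w x) powr p)"
            using integrable_one_plus_powr[OF p \<Omega> w(1) S] w(2) by simp
          show "integrable lebesgue (indicat_real S)" by (rule ind_int[OF Sl])
          show "integrable lebesgue (\<lambda>x. max 0 (w x - k) powr p)" using k by (intro v_int) auto
          fix x
          have "(1 + w x) powr p \<le> \<bar>2 * k + max 0 (w x - k)\<bar> powr p"
            using p k w(2)[of x] by (intro powr_mono2) auto
          also have "\<dots> \<le> 2 powr p * (\<bar>2 * k\<bar> powr p + \<bar>max 0 (w x - k)\<bar> powr p)"
            using p by (intro abs_add_powr_le) auto
          finally show "indicator S x * (1 + w x) powr p
              \<le> 2 powr p * ((2 * k) powr p * indicator S x + max 0 (w x - k) powr p)"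
            using k by (auto simp: indicator_def)
        qed
        also have "\<dots> = 2 powr p * ((2 * k) powr p * m + X k)"
        proof -
          have "integrable lebesgue (indicat_real S)" by (rule ind_int[OF Sl])
          then show ?thesis using v_int[of k] k Sl by (simp add: X_def m_def)
        qed
        also have "\<dots> \<le> 2 powr p * (2 powr p * (M * m powr \<theta>) + A * m powr \<theta>)"
        proof (intro mult_left_mono add_mono)
          show "(2 * k) powr p * m \<le> 2 powr p * (M * m powr \<theta>)"
            using k(1,3) by (simp add: powr_mult mult.assoc)
          have "X k \<le> A * \<mu> k powr \<theta>" using k by (intro X_le) auto
          also have "\<dots> \<le> A * m powr \<theta>"
            using A k \<theta> \<mu>0 by (intro mult_left_mono powr_mono2) auto
          finally show "X k \<le> A * m powr \<theta>" .
        qed simp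
        also have "\<dots> = 2 powr p * (2 powr p * M + A) * m powr \<theta>" by (simp add: algebra_simps)
        finally show ?thesis by (simp add: m_def)
      qed
    qed
    then show ?thesis
      unfolding measure_growth_def using M A
      by (intro exI[of _ "2 powr p * (2 powr p * M + A)"]) (auto simp: \<theta>_def)
  qed
qed

section \<open>Iteration to a bounded solution and contradiction with the critical value\<close>

theorem theorem1p6:
  fixes p s :: real
    and \<Omega> :: "'a::euclidean_space set"
    and f :: "real \<Rightarrow> real"
  assumes p: "p > 1"
    and s: "0 < s" "s < 1"
    and \<Omega>: "bounded_C11_domain \<Omega>"
    and f_C1: "f C1_differentiable_on UNIV"
    and f_mono: "mono f"
    and f_0: "f 0 > 0"
    and f_superlinear: "filterlim (\<lambda>t. f t / t powr (p - 1)) at_top at_top"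
    and f_convex: "convex_on {0..} (\<lambda>t. f t powr (1 / (p - 1)))"
  shows "\<forall>l>0. ereal l > critical_value s p \<Omega> f \<longrightarrow> \<not> (\<exists>u. weak_solution s p \<Omega> f l u)"
proof (intro allI impI notI)
  fix l :: real
  assume l: "0 < l" and crit: "critical_value s p \<Omega> f < ereal l"
    and ex: "\<exists>u. weak_solution s p \<Omega> f l u"
  have \<Omega>m: "\<Omega> \<in> lmeasurable"
    using \<Omega> unfolding bounded_C11_domain_def by (intro bounded_set_imp_lmeasurable) auto
  obtain u0 where u0: "weak_solution s p \<Omega> f l u0" "\<And>x. 0 \<le> u0 x"
  proof -
    from ex obtain v where "weak_solution s p \<Omega> f l v" ..
    from nonneg_representative[OF p this] show thesis by (rule that) simp
  qed
  define \<gamma> where "\<gamma> = s * p / real DIM('a) * (p / (p - 1))"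
  have \<gamma>: "\<gamma> > 0" using p s by (simp add: \<gamma>_def)
  obtain n where n: "1 / \<gamma> < real n" using reals_Archimedean2 by blast
  text \<open>The half-integer keeps all the exponents \<open>i * \<beta>\<close> away from the critical value \<open>1\<close>.\<close>
  define \<beta> where "\<beta> = 1 / (real n + 1/2)"
  have \<beta>: "0 < \<beta>" "\<beta> \<le> \<gamma>"
  proof -
    show "0 < \<beta>" by (simp add: \<beta>_def)
    have "1 / (real n + 1/2) \<le> 1 / (1 / \<gamma>)"
      using n \<gamma> by (intro divide_left_mono mult_pos_pos) auto
    then show "\<beta> \<le> \<gamma>" by (simp add: \<beta>_def)
  qed
  \<comment> \<open>One descent: any loss in the parameter buys the fixed gain
    \<open>\<beta>\<close>, or boundedness once the exponent passes 1.\<close>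
  have step: "\<exists>w. weak_solution s p \<Omega> f l2 w \<and> (\<forall>x. 0 \<le> w x) \<and>
      (\<tau> + \<beta> < 1 \<longrightarrow> measure_growth p \<Omega> (\<tau> + \<beta>) w) \<and>
      (\<tau> + \<beta> > 1 \<longrightarrow> (\<exists>M. AE x in lebesgue. x \<in> \<Omega> \<longrightarrow> w x \<le> M))"
    if u: "weak_solution s p \<Omega> f l1 u" "\<And>x. 0 \<le> u x" and l12: "0 < l2" "l2 < l1"
      and g: "measure_growth p \<Omega> \<tau> u" "0 \<le> \<tau>" for u l1 l2 \<tau>
  proof -
    obtain w C where w: "weak_solution s p \<Omega> f l2 w" "\<And>x. 0 \<le> w x" and C: "C > 0"
      "AE x in lebesgue. f (w x) \<le> C * (1 + u x) powr (p - 1)"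
      by (rule solution_below_concave_image[OF p s(1) \<Omega>m f_C1 f_mono f_0 f_convex u l12]) (rule that)
    have W: "w \<in> frac_sobolev0 s p \<Omega>" "u \<in> frac_sobolev0 s p \<Omega>"
      using w u by (auto simp: weak_solution_def)
    have int: "set_integrable lebesgue \<Omega> (\<lambda>x. l2 * f (w x) * v x)" if "v \<in> frac_sobolev0 s p \<Omega>" for v
      using w(1) that by (auto simp: weak_solution_def in_frac_sobolev0_dual_def mult.assoc)
    have eq: "frac_p_laplacian s p w v = (LINT x:\<Omega>|lebesgue. l2 * f (w x) * v x)"
      if "v \<in> frac_sobolev0 s p \<Omega>" "AE x in lebesgue. 0 \<le> v x" for v
      using w(1) that by (simp add: weak_solution_def mult.assoc)
    have C': "0 < l2 * C" "AE x in lebesgue. l2 * f (w x) \<le> l2 * C * (1 + u x) powr (p - 1)"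
      using C l12 by (auto simp: mult.assoc)
    show ?thesis
      using integrability_gain[OF p s(1) \<Omega>m W(1) w(2) W(2) u(2) int eq C' g \<beta>[unfolded \<gamma>_def]] w
      by (intro exI[of _ w]) blast
  qed
  have iterate: "i \<le> n \<Longrightarrow> 0 < l' \<Longrightarrow> l' < l \<Longrightarrow>
      \<exists>u. weak_solution s p \<Omega> f l' u \<and> (\<forall>x. 0 \<le> u x) \<and> measure_growth p \<Omega> (real i * \<beta>) u" for i l'
  proof (induction i arbitrary: l')
    case 0
    \<comment> \<open>Here the descent only moves the parameter from \<open>l\<close> to
      \<open>l'\<close>; the growth condition with exponent 0 holds for every nonnegative member of
      the space.\<close>
    have "u0 \<in> frac_sobolev0 s p \<Omega>" using u0 by (simp add: weak_solution_def)
    then have "measure_growth p \<Omega> 0 u0" by (rule measure_growth_0[OF p \<Omega>m _ u0(2)])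
    then obtain w where w: "weak_solution s p \<Omega> f l' w" "\<forall>x. 0 \<le> w x"
      using step[OF u0 0(2,3)] by blast
    then have "w \<in> frac_sobolev0 s p \<Omega>" by (simp add: weak_solution_def)
    then have "measure_growth p \<Omega> 0 w" by (rule measure_growth_0[OF p \<Omega>m]) (use w in simp)
    then show ?case using w by auto
  next
    case (Suc i)
    \<comment> \<open>The first \<open>i\<close> gains are spent above the midpoint, the last one
      between the midpoint and \<open>l'\<close>.\<close>
    define l1 where "l1 = (l' + l) / 2"
    have l1: "0 < l1" "l' < l1" "l1 < l" using Suc.prems by (auto simp: l1_def)
    obtain u where u: "weak_solution s p \<Omega> f l1 u" "\<And>x. 0 \<le> u x" "measure_growth p \<Omega> (real i * \<beta>) u"
      using Suc.IH[OF _ l1(1,3)] Suc.prems by auto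
    have "real (Suc i) * \<beta> < 1" using Suc.prems by (simp add: \<beta>_def field_simps)
    then have "real i * \<beta> + \<beta> < 1" by (simp add: algebra_simps)
    then obtain w where "weak_solution s p \<Omega> f l' w" "\<forall>x. 0 \<le> w x"
        "measure_growth p \<Omega> (real i * \<beta> + \<beta>) w"
      using step[OF u(1,2) Suc.prems(2) l1(2) u(3)] \<beta> by auto
    then show ?case by (auto simp: algebra_simps)
  qed
  have bounded: "\<exists>u. bounded_weak_solution s p \<Omega> f l' u" if l': "0 < l'" "l' < l" for l'
  proof -
    define l1 where "l1 = (l' + l) / 2"
    have l1: "0 < l1" "l' < l1" "l1 < l" using l' by (auto simp: l1_def)
    obtain u where u: "weak_solution s p \<Omega> f l1 u" "\<And>x. 0 \<le> u x" "measure_growth p \<Omega> (real n * \<beta>) u"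
      using iterate[OF _ l1(1,3), of n] by auto
    \<comment> \<open>Thus \<open>n * \<beta> = 1 - \<beta> / 2\<close>, and one further gain lands
      at \<open>1 + \<beta> / 2\<close>.\<close>
    have "(real n + 1/2) * \<beta> = 1" by (simp add: \<beta>_def)
    then have "real n * \<beta> + \<beta> > 1" using \<beta>(1) by (simp add: distrib_right)
    then obtain w M where w: "weak_solution s p \<Omega> f l' w" "\<forall>x. 0 \<le> w x"
        and M: "AE x in lebesgue. x \<in> \<Omega> \<longrightarrow> w x \<le> M"
      using step[OF u(1,2) l'(1) l1(2) u(3)] \<beta> by auto
    from M have "AE x in lebesgue. x \<in> \<Omega> \<longrightarrow> \<bar>w x\<bar> \<le> M" using w(2) by simp
    then show ?thesis using w unfolding bounded_weak_solution_def by blast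
  qed
  obtain y where y: "critical_value s p \<Omega> f < ereal y" "ereal y < ereal l"
    using ereal_dense2[OF crit] by blast
  \<comment> \<open>The critical value is minus infinity if there are no bounded solutions, so
    \<open>y\<close> may be negative; the maximum with \<open>l / 2\<close> keeps the parameter
    positive.\<close>
  define l' where "l' = max y (l / 2)"
  have l': "0 < l'" "l' < l" using y l by (auto simp: l'_def)
  have "ereal l' \<le> critical_value s p \<Omega> f"
    unfolding critical_value_def using bounded[OF l'] l' by (intro Sup_upper) auto
  moreover have "ereal y \<le> ereal l'" by (simp add: l'_def)
  ultimately show False using y(1) by (meson leD order_trans)
qed

end
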